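(* The 25 classes $\mathscr P$ and $\mathscr M_{s,\lambda,\rho}$ for $s\in\{=,\neq,\le_l,\ge_l,\le_r,\ge_r\}$ and $\lambda,\rho\in\{0,1\}$ are precisely all the hereditary classes $\mathscr C$ of ordered graphs with growth $2^{\omega(n)}$ such that every proper (hereditary) subclass of $\mathscr C$ has growth $2^{O(n)}$.
   Context: An ordered graph is a finite simple undirected graph with a total order on its vertices. Classes are closed under isomorphism; a class is hereditary if closed under induced (ordered) subgraphs. The growth of a class maps $n$ to the number of its $n$-vertex members up to isomorphism. Growth $2^{\omega(n)}$ means that it equals $2^{f(n)}$ for some function $f$ with $f(n)/n\to\infty$. For a permutation $\sigma$ of $[n]=\{1,\dots,n\}$, consider the ordered graph on $a_1<\dots<a_n<b_1<\dots<b_n$ in which $a_i,b_j$ are adjacent iff, respectively: $\sigma(i)=j$ (for $s$ being $=$); $\sigma(i)\ne j$ ($\neq$); $i\le\sigma^{-1}(j)$ ($\le_l$); $i\ge\sigma^{-1}(j)$ ($\ge_l$); $j\le\sigma(i)$ ($\le_r$); $j\ge\sigma(i)$ ($\ge_r$); the $a_i$'s form a clique if $\lambda=1$ and an independent set if $\lambda=0$; the $b_i$'s form a clique if $\rho=1$ and an independent set if $\rho=0$. $\mathscr M_{s,\lambda,\rho}$ is the closure under induced ordered subgraphs of all these graphs, over all $n$ and $\sigma$. $\mathscr P$ is the class of all ordered permutation graphs: for a permutation $\pi$ of $[n]$, the ordered graph on $[n]$ with the natural order where $i<j$ are adjacent iff $\pi(i)>\pi(j)$. *)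

theory Defs
  imports
    Complex_Main
    "HOL-Combinatorics.Permutations"
    "HOL-Library.Landau_Symbols"
begin

record 'a ograph =
  verts :: "'a set"
  edges :: "'a rel"
  ord :: "'a rel"

definition ordered_graph :: "'a ograph \<Rightarrow> bool" where
  "ordered_graph G \<longleftrightarrow>
     finite (verts G) \<and>
     edges G \<subseteq> verts G \<times> verts G \<and> sym (edges G) \<and> irrefl (edges G) \<and>
     linear_order_on (verts G) (ord G)"

definition ograph_iso :: "'a ograph \<Rightarrow> 'b ograph \<Rightarrow> bool" (infix "\<cong>\<^sub>o" 50) where
  "G \<cong>\<^sub>o H \<longleftrightarrow>
     (\<exists>f. bij_betw f (verts G) (verts H) \<and>
        (\<forall>u\<in>verts G. \<forall>v\<in>verts G.
           ((u, v) \<in> edges G \<longleftrightarrow> (f u, f v) \<in> edges H) \<and>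
           ((u, v) \<in> ord G \<longleftrightarrow> (f u, f v) \<in> ord H)))"

definition induced :: "'a ograph \<Rightarrow> 'a set \<Rightarrow> 'a ograph" where
  "induced G W = \<lparr>verts = W, edges = edges G \<inter> W \<times> W, ord = ord G \<inter> W \<times> W\<rparr>"

text \<open>Every finite ordered graph has an isomorphic copy with vertices in \<^typ>\<open>nat\<close>, so
  isomorphism-closed classes of ordered graphs are represented by isomorphism-closed sets of
  ordered graphs with vertices in \<^typ>\<open>nat\<close>.\<close>

definition hereditary :: "nat ograph set \<Rightarrow> bool" where
  "hereditary C \<longleftrightarrow>
     (\<forall>G\<in>C. ordered_graph G) \<and>
     (\<forall>G\<in>C. \<forall>H. ordered_graph H \<and> H \<cong>\<^sub>o G \<longrightarrow> H \<in> C) \<and>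
     (\<forall>G\<in>C. \<forall>W\<subseteq>verts G. induced G W \<in> C)"

definition hereditary_closure :: "nat ograph set \<Rightarrow> nat ograph set" where
  "hereditary_closure S = {H. ordered_graph H \<and> (\<exists>G\<in>S. \<exists>W\<subseteq>verts G. H \<cong>\<^sub>o induced G W)}"

definition growth :: "nat ograph set \<Rightarrow> nat \<Rightarrow> nat" where
  "growth C n = card ({G \<in> C. card (verts G) = n} // {(G, H). G \<in> C \<and> H \<in> C \<and> G \<cong>\<^sub>o H})"

definition growth_two_pow_omega :: "nat ograph set \<Rightarrow> bool" where
  "growth_two_pow_omega C \<longleftrightarrow>
     (\<exists>f :: nat \<Rightarrow> real. (\<forall>n. real (growth C n) = 2 powr f n) \<and>
        filterlim (\<lambda>n. f n / real n) at_top sequentially)"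

text \<open>An upper bound rather than an equality, since the growth may be zero.\<close>

definition growth_two_pow_O :: "nat ograph set \<Rightarrow> bool" where
  "growth_two_pow_O C \<longleftrightarrow>
     (\<exists>g \<in> O(\<lambda>n. real n). \<forall>n. real (growth C n) \<le> 2 powr g n)"

definition nat_ord :: "nat set \<Rightarrow> nat rel" where
  "nat_ord V = {(u, v). u \<in> V \<and> v \<in> V \<and> u \<le> v}"

datatype rel_symbol = S_eq | S_neq | S_le_l | S_ge_l | S_le_r | S_ge_r

fun cross_adj :: "rel_symbol \<Rightarrow> (nat \<Rightarrow> nat) \<Rightarrow> nat \<Rightarrow> nat \<Rightarrow> bool" where
  "cross_adj S_eq \<sigma> i j \<longleftrightarrow> \<sigma> i = j"
| "cross_adj S_neq \<sigma> i j \<longleftrightarrow> \<sigma> i \<noteq> j"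
| "cross_adj S_le_l \<sigma> i j \<longleftrightarrow> i \<le> inv \<sigma> j"
| "cross_adj S_ge_l \<sigma> i j \<longleftrightarrow> i \<ge> inv \<sigma> j"
| "cross_adj S_le_r \<sigma> i j \<longleftrightarrow> j \<le> \<sigma> i"
| "cross_adj S_ge_r \<sigma> i j \<longleftrightarrow> j \<ge> \<sigma> i"

text \<open>The vertex $a_i$ is the number $i$ and the vertex $b_j$ is the number $n + j$; a parameter
  \<^term>\<open>True\<close> stands for 1 (clique) and \<^term>\<open>False\<close> for 0 (independent set).\<close>

definition M_graph :: "rel_symbol \<Rightarrow> bool \<Rightarrow> bool \<Rightarrow> nat \<Rightarrow> (nat \<Rightarrow> nat) \<Rightarrow> nat ograph" where
  "M_graph s lam rho n \<sigma> =
     (let E = {(i, n + j) | i j. i \<in> {1..n} \<and> j \<in> {1..n} \<and> cross_adj s \<sigma> i j} \<union>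
              {(i, i') | i i'. lam \<and> i \<in> {1..n} \<and> i' \<in> {1..n} \<and> i \<noteq> i'} \<union>
              {(n + j, n + j') | j j'. rho \<and> j \<in> {1..n} \<and> j' \<in> {1..n} \<and> j \<noteq> j'}
      in \<lparr>verts = {1..2 * n}, edges = E \<union> E\<inverse>, ord = nat_ord {1..2 * n}\<rparr>)"

definition M_class :: "rel_symbol \<Rightarrow> bool \<Rightarrow> bool \<Rightarrow> nat ograph set" where
  "M_class s lam rho = hereditary_closure {M_graph s lam rho n \<sigma> | n \<sigma>. \<sigma> permutes {1..n}}"

definition permutation_ograph :: "nat \<Rightarrow> (nat \<Rightarrow> nat) \<Rightarrow> nat ograph" where
  "permutation_ograph n \<pi> =
     (let E = {(i, j). i \<in> {1..n} \<and> j \<in> {1..n} \<and> i < j \<and> \<pi> i > \<pi> j}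
      in \<lparr>verts = {1..n}, edges = E \<union> E\<inverse>, ord = nat_ord {1..n}\<rparr>)"

definition P_class :: "nat ograph set" where
  "P_class = {G. ordered_graph G \<and> (\<exists>n \<pi>. \<pi> permutes {1..n} \<and> G \<cong>\<^sub>o permutation_ograph n \<pi>)}"

definition listed_classes :: "nat ograph set set" where
  "listed_classes = insert P_class {M_class s lam rho | s lam rho. True}"

end

theory Submission
  imports Defs "HOL-Library.Ramsey"
begin

text \<open>The heart of the matter is a dichotomy: a hereditary class of ordered graphs either includes one of
  the 25 listed classes or has at most \<open>M ^ n\<close> members on \<open>n\<close> vertices. Since the listed classes have at least
  \<open>(n div 2)!\<close> members on \<open>n\<close> vertices, and since none of them includes another one, they are then exactly
  the minimal classes of growth \<open>2 ^ \<omega>(n)\<close>.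

  For the dichotomy, cut the ordered vertex set into intervals of a large constant length and compare the rows of the
  adjacency matrix on these blocks. An interval is good if two of its vertices are near twins, that is, if their rows
  differ in a bounded number of blocks. In an interval that is not good, the rows are told apart again and again,
  on many disjoint ranges of blocks (\<open>disjoint_distinguishing_ranges\<close>).

  If more than half of the intervals are bad, these ranges are numerous, and a version of the Marcus-Tardos
  theorem for ranges (\<open>grid_free_range_family_linear\<close>) arranges some of them in a large grid, every cell of which has
  many distinct rows. Otherwise one of each pair of near twins is deleted. The graph can be recovered from the rest
  and from the sparse relation of the places where near twins differ. If this relation has no large grid, then by
  Klazar's counting argument (\<open>card_grid_free_relations\<close>) there are only exponentially many choices for it. As a fixed
  fraction of the vertices was deleted, a recursion on \<open>n\<close> gives the exponential bound
  (\<open>slice_bounded_if_not_contains_listed\<close>).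

  It remains to see that a large grid of either kind forces a listed class. A Ramsey theorem for pairs of rows and pairs
  of columns (\<open>product_ramsey\<close>) makes the grid homogeneous: the adjacency of the chosen vertices depends only on the
  relative position of their grid points. Choosing points along a permutation, one reads off all permutation graphs
  if the adjacency of two row vertices depends on the order of their columns; a class with a threshold symbol if the
  adjacency of a row vertex and a column vertex depends on their position; and a class with the symbol \<open>=\<close> or
  \<open>\<noteq>\<close> if it differs just at equal points (\<open>contains_listed_or_constant\<close>). If positions are irrelevant, then near
  twins would differ in too many places, which excludes grids of the second kind; and in a grid of the first kind the
  rows and columns inside the cells can be permuted at will, so a large diagonal or triangular matrix in
  a cell again yields a listed class (\<open>contains_listed_if_independent_labels\<close>).\<close>

section \<open>Grids in families of ranges\<close>

definition disjoint_ranges :: "(nat \<times> nat) set \<Rightarrow> bool" where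
  "disjoint_ranges H \<longleftrightarrow>
     (\<forall>(x, y)\<in>H. x \<le> y \<and> (\<forall>(x', y')\<in>H. (x, y) = (x', y') \<or> y < x' \<or> y' < x))"

text \<open>The triple \<open>(a, x, y)\<close> stands for the range of columns from \<open>x\<close> to \<open>y\<close> in row \<open>a\<close>.\<close>
definition range_family :: "(nat \<times> nat \<times> nat) set \<Rightarrow> bool" where
  "range_family F \<longleftrightarrow> finite F \<and> (\<forall>a. disjoint_ranges (F `` {a}))"

text \<open>A grid is given by one range for each cell instead of by dividing lines. The two order conditions
  compare ranges across all cells, so dividing lines could be inserted; leaving them out lets a grid pass
  from a contraction to the original family with no further bookkeeping.\<close>
definition has_grid :: "(nat \<times> nat \<times> nat) set \<Rightarrow> nat \<Rightarrow> bool" where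
  "has_grid F N \<longleftrightarrow>
     (\<exists>a x y. (\<forall>i<N. \<forall>j<N. (a i j, x i j, y i j) \<in> F) \<and>
        (\<forall>i<N. \<forall>i'<N. \<forall>j<N. \<forall>j'<N.
           (i < i' \<longrightarrow> a i j < a i' j') \<and> (j < j' \<longrightarrow> y i j < x i' j')))"

lemma disjoint_ranges_le: "disjoint_ranges H \<Longrightarrow> (x, y) \<in> H \<Longrightarrow> x \<le> y"
  by (auto simp: disjoint_ranges_def)

lemma disjoint_rangesD:
  "disjoint_ranges H \<Longrightarrow> (x, y) \<in> H \<Longrightarrow> (x', y') \<in> H \<Longrightarrow> (x, y) = (x', y') \<or> y < x' \<or> y' < x"
  unfolding disjoint_ranges_def by fastforce

lemma disjoint_rangesI:
  assumes "\<And>x y. (x, y) \<in> H \<Longrightarrow> x \<le> y"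
    and "\<And>x y x' y'. (x, y) \<in> H \<Longrightarrow> (x', y') \<in> H \<Longrightarrow> (x, y) = (x', y') \<or> y < x' \<or> y' < x"
  shows "disjoint_ranges H"
  unfolding disjoint_ranges_def using assms by (clarsimp, blast)

lemma disjoint_ranges_Un:
  assumes "disjoint_ranges H" "disjoint_ranges H'"
    and "\<And>x y x' y'. (x, y) \<in> H \<Longrightarrow> (x', y') \<in> H' \<Longrightarrow> y < x'"
  shows "disjoint_ranges (H \<union> H')"
proof (rule disjoint_rangesI)
  fix x y assume "(x, y) \<in> H \<union> H'"
  then show "x \<le> y" using disjoint_ranges_le assms(1,2) by blast
next
  fix x y x' y' assume "(x, y) \<in> H \<union> H'" "(x', y') \<in> H \<union> H'"
  then show "(x, y) = (x', y') \<or> y < x' \<or> y' < x"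
    using disjoint_rangesD[OF assms(1)] disjoint_rangesD[OF assms(2)] assms(3) by blast
qed

lemma disjoint_ranges_subset: "disjoint_ranges H \<Longrightarrow> H' \<subseteq> H \<Longrightarrow> disjoint_ranges H'"
  unfolding disjoint_ranges_def by blast

lemma range_family_subset: "range_family F \<Longrightarrow> F' \<subseteq> F \<Longrightarrow> range_family F'"
  unfolding range_family_def by (meson Image_mono disjoint_ranges_subset finite_subset subset_refl)

lemma range_family_finite: "range_family F \<Longrightarrow> finite F"
  by (simp add: range_family_def)

lemma range_familyD:
  assumes "range_family F" "(a, x, y) \<in> F" "(a, x', y') \<in> F"
  shows "(x, y) = (x', y') \<or> y < x' \<or> y' < x"
  using assms disjoint_rangesD[of "F `` {a}" x y x' y'] by (auto simp: range_family_def)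

lemma range_family_le: "range_family F \<Longrightarrow> (a, x, y) \<in> F \<Longrightarrow> x \<le> y"
  using disjoint_ranges_le[of "F `` {a}" x y] by (auto simp: range_family_def)

lemma has_gridE:
  assumes "has_grid F N"
  obtains a x y where "\<And>i j. i < N \<Longrightarrow> j < N \<Longrightarrow> (a i j, x i j, y i j) \<in> F"
    and "\<And>i i' j j'. i < i' \<Longrightarrow> i < N \<Longrightarrow> i' < N \<Longrightarrow> j < N \<Longrightarrow> j' < N \<Longrightarrow> a i j < a i' j'"
    and "\<And>i i' j j'. j < j' \<Longrightarrow> i < N \<Longrightarrow> i' < N \<Longrightarrow> j < N \<Longrightarrow> j' < N \<Longrightarrow> y i j < x i' j'"
proof -
  from assms obtain a x y where "\<forall>i<N. \<forall>j<N. (a i j, x i j, y i j) \<in> F"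
    "\<forall>i<N. \<forall>i'<N. \<forall>j<N. \<forall>j'<N.
           (i < i' \<longrightarrow> a i j < a i' j') \<and> (j < j' \<longrightarrow> y i j < x i' j')"
    unfolding has_grid_def by blast
  then show thesis by (intro that[of a x y]) simp_all
qed

lemma has_gridI:
  assumes "\<And>i j. i < N \<Longrightarrow> j < N \<Longrightarrow> (a i j, x i j, y i j) \<in> F"
    and "\<And>i i' j j'. i < i' \<Longrightarrow> i < N \<Longrightarrow> i' < N \<Longrightarrow> j < N \<Longrightarrow> j' < N \<Longrightarrow> a i j < a i' j'"
    and "\<And>i i' j j'. j < j' \<Longrightarrow> i < N \<Longrightarrow> i' < N \<Longrightarrow> j < N \<Longrightarrow> j' < N \<Longrightarrow> y i j < x i' j'"
  shows "has_grid F N"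
  unfolding has_grid_def using assms by (intro exI[of _ a] exI[of _ x] exI[of _ y]) simp

text \<open>Here \<open>f\<close> and \<open>g\<close> merge consecutive rows and columns, and \<open>H\<close> is a contraction of \<open>F\<close>:
  every range of \<open>H\<close> covers the image of a range of \<open>F\<close>. So contractions of grid-free families are
  grid-free, which is what makes the recursion below possible.\<close>
lemma has_grid_transfer:
  assumes "has_grid H N"
    and "\<And>A X Y. (A, X, Y) \<in> H \<Longrightarrow> \<exists>a x y. (a, x, y) \<in> F \<and> f a = A \<and> X \<le> g x \<and> g y \<le> Y"
    and "mono f" "mono g"
  shows "has_grid F N"
proof -
  obtain A X Y where H: "\<And>i j. i < N \<Longrightarrow> j < N \<Longrightarrow> (A i j, X i j, Y i j) \<in> H"
    and o1: "\<And>i i' j j'. i < i' \<Longrightarrow> i < N \<Longrightarrow> i' < N \<Longrightarrow> j < N \<Longrightarrow> j' < N \<Longrightarrow> A i j < A i' j'"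
    and o2: "\<And>i i' j j'. j < j' \<Longrightarrow> i < N \<Longrightarrow> i' < N \<Longrightarrow> j < N \<Longrightarrow> j' < N \<Longrightarrow> Y i j < X i' j'"
    using assms(1) by (rule has_gridE) blast
  have "\<exists>a x y. i < N \<longrightarrow> j < N \<longrightarrow> (a, x, y) \<in> F \<and> f a = A i j \<and> X i j \<le> g x \<and> g y \<le> Y i j" for i j
    using assms(2)[OF H, of i j] by blast
  then obtain a x y where
    F: "\<And>i j. i < N \<Longrightarrow> j < N \<Longrightarrow> (a i j, x i j, y i j) \<in> F \<and> f (a i j) = A i j \<and> X i j \<le> g (x i j) \<and> g (y i j) \<le> Y i j"
    by metis
  show ?thesis
  proof (rule has_gridI[of N a x y])
    fix i i' j j' assume *: "i < i'" "i < N" "i' < N" "j < N" "j' < N"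
    have "f (a i j) < f (a i' j')" using F[of i j] F[of i' j'] o1[of i i' j j'] * by simp
    then show "a i j < a i' j'" using \<open>mono f\<close> by (meson linorder_not_le monoD)
  next
    fix i i' j j' assume *: "j < j'" "i < N" "i' < N" "j < N" "j' < N"
    have "g (y i j) < g (x i' j')" using F[of i j] F[of i' j'] o2[of j j' i i'] * by linarith
    then show "y i j < x i' j'" using \<open>mono g\<close> by (meson linorder_not_le monoD)
  qed (use F in blast)
qed

lemma finite_rows:
  "finite G \<Longrightarrow> finite {a. \<exists>x y. (a, x, y) \<in> G \<and> P x y}"
  by (rule finite_subset[of _ "fst ` G"]) (auto intro: rev_image_eqI)

text \<open>The fullest of fewer than \<open>N\<close> rows has at least an \<open>N\<close>-th of all ranges, and its ranges can
  serve as one contracted row.\<close>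
lemma card_le_best_row:
  assumes "range_family G" "card (fst ` G) < N"
  shows "\<exists>H \<subseteq> snd ` G. disjoint_ranges H \<and> finite H \<and> card G \<le> N * card H"
proof (cases "G = {}")
  case False
  have fin: "finite G" using assms(1) range_family_finite by auto
  let ?S = "fst ` G"
  have ne: "finite ?S" "?S \<noteq> {}" using fin False by auto
  obtain b where b: "b \<in> ?S" "\<And>a. a \<in> ?S \<Longrightarrow> card (G `` {a}) \<le> card (G `` {b})"
  proof -
    let ?M = "Max ((\<lambda>a. card (G `` {a})) ` ?S)"
    have "?M \<in> (\<lambda>a. card (G `` {a})) ` ?S" using ne by (intro Max_in) auto
    then obtain m where m: "m \<in> ?S" "?M = card (G `` {m})" by (rule imageE)
    show thesis
    proof (rule that[OF m(1)])
      fix a assume "a \<in> ?S"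
      then have "card (G `` {a}) \<le> ?M" using ne by (intro Max_ge) auto
      then show "card (G `` {a}) \<le> card (G `` {m})" using m by simp
    qed
  qed
  have "G = (SIGMA a:?S. G `` {a})" by force
  then have "card G = (\<Sum>a\<in>?S. card (G `` {a}))"
    using ne fin by (metis card_SigmaI finite_Image)
  also have "\<dots> \<le> (\<Sum>a\<in>?S. card (G `` {b}))" using b by (intro sum_mono)
  also have "\<dots> \<le> N * card (G `` {b})" using assms(2) by simp
  finally have "card G \<le> N * card (G `` {b})" .
  moreover have "G `` {b} \<subseteq> snd ` G" by force
  moreover have "disjoint_ranges (G `` {b})" "finite (G `` {b})"
    using assms(1) fin by (auto simp: range_family_def)
  ultimately show ?thesis by blast
qed (auto simp: disjoint_ranges_def)

text \<open>The rows in \<open>S\<close> are to be merged into one row. Read the columns from left to right and close a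
  segment as soon as \<open>N\<close> rows own a complete range in it. Without its last column a segment is
  served by fewer than \<open>N\<close> rows, so one of them keeps an \<open>N\<close>-th of these ranges; the ranges through
  the last column are at most one for each row. Merging therefore costs a factor \<open>N\<close> instead of
  \<open>card S\<close>, plus \<open>card S\<close> for each segment.\<close>
lemma strip_packing:
  assumes "range_family G" "fst ` G \<subseteq> S" "finite S" "\<And>a x y. (a, x, y) \<in> G \<Longrightarrow> z \<le> x" "N \<ge> 1"
  shows "(\<exists>c. c 0 = z \<and> (\<forall>t<T. N \<le> card {a. \<exists>x y. (a, x, y) \<in> G \<and> c t \<le> x \<and> y < c (Suc t)})) \<or>
         (\<exists>H \<subseteq> snd ` G. disjoint_ranges H \<and> finite H \<and> card G \<le> N * card H + T * card S)"
  using assms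
proof (induction T arbitrary: G z)
  case 0
  show ?case by (rule disjI1) (rule exI[of _ "\<lambda>_. z"], simp)
next
  case (Suc T)
  have fin: "finite G" using Suc.prems(1) range_family_finite by auto
  define rows where "rows e = {a. \<exists>x y. (a, x, y) \<in> G \<and> z \<le> x \<and> y < e}" for e
  show ?case
  proof (cases "\<exists>e. N \<le> card (rows e)")
    case False
    obtain e where e: "\<And>a x y. (a, x, y) \<in> G \<Longrightarrow> y < e"
    proof -
      have "finite ((\<lambda>(a, x, y). y) ` G)" using fin by auto
      then obtain M where "\<forall>v\<in>(\<lambda>(a, x, y). y) ` G. v < M"
        by (meson finite_nat_set_iff_bounded)
      then show ?thesis by (intro that[of M]) force
    qed
    have "fst ` G \<subseteq> rows e" unfolding rows_def using e Suc.prems(4) by fastforce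
    moreover have "finite (rows e)" unfolding rows_def using fin by (rule finite_rows)
    moreover have "card (rows e) < N" using False by (metis not_le)
    ultimately have "card (fst ` G) < N" by (meson card_mono le_less_trans)
    from card_le_best_row[OF Suc.prems(1) this] show ?thesis
      by (meson trans_le_add1)
  next
    case True
    define e where "e = (LEAST e. N \<le> card (rows e))"
    have e: "N \<le> card (rows e)" using True unfolding e_def by (rule LeastI_ex)
    have "rows 0 = {}" by (simp add: rows_def)
    then have epos: "e > 0" using e Suc.prems(5) by (cases e) auto
    then have e1: "card (rows (e - 1)) < N"
      using not_less_Least[of "e - 1" "\<lambda>e. N \<le> card (rows e)"] unfolding e_def[symmetric] by auto
    have ez: "z < e"
    proof (rule ccontr)
      assume "\<not> z < e"
      then have "rows e = {}"
        unfolding rows_def using range_family_le[OF Suc.prems(1)] by fastforce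
      then show False using e Suc.prems(5) by simp
    qed
    define G0 where "G0 = {(a, x, y). (a, x, y) \<in> G \<and> y < e - 1}"
    define Gc where "Gc = {(a, x, y). (a, x, y) \<in> G \<and> x < e \<and> e - 1 \<le> y}"
    define G1 where "G1 = {(a, x, y). (a, x, y) \<in> G \<and> e \<le> x}"
    have sub: "G0 \<subseteq> G" "Gc \<subseteq> G" "G1 \<subseteq> G"
      unfolding G0_def Gc_def G1_def by auto
    have split: "G = G0 \<union> Gc \<union> G1"
      unfolding G0_def Gc_def G1_def by auto
    have "fst ` G0 \<subseteq> rows (e - 1)" unfolding rows_def G0_def using Suc.prems(4) by fastforce
    moreover have "finite (rows (e - 1))"
      unfolding rows_def using fin by (rule finite_rows)
    ultimately have "card (fst ` G0) < N" using e1 by (meson card_mono le_less_trans)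
    from card_le_best_row[OF range_family_subset[OF Suc.prems(1) sub(1)] this]
    obtain H0 where H0: "H0 \<subseteq> snd ` G0" "disjoint_ranges H0" "finite H0" "card G0 \<le> N * card H0"
      by blast
    have "card Gc \<le> card S"
    proof (rule card_inj_on_le[of fst])
      show "inj_on fst Gc"
      proof (rule inj_onI, clarsimp)
        fix a x y x' y' assume "(a, x, y) \<in> Gc" "(a, x', y') \<in> Gc"
        then show "x = x' \<and> y = y'"
          using range_familyD[OF Suc.prems(1), of a x y x' y'] by (auto simp: Gc_def)
      qed
      show "fst ` Gc \<subseteq> S" using Suc.prems(2) sub by blast
    qed (rule Suc.prems)
    have IH: "(\<exists>c. c 0 = e \<and> (\<forall>t<T. N \<le> card {a. \<exists>x y. (a, x, y) \<in> G1 \<and> c t \<le> x \<and> y < c (Suc t)})) \<or>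
         (\<exists>H \<subseteq> snd ` G1. disjoint_ranges H \<and> finite H \<and> card G1 \<le> N * card H + T * card S)"
    proof (rule Suc.IH)
      show "range_family G1" using range_family_subset Suc.prems(1) sub by blast
      show "fst ` G1 \<subseteq> S" using Suc.prems(2) sub by blast
    qed (use Suc.prems in \<open>auto simp: G1_def\<close>)
    then show ?thesis
    proof (elim disjE exE conjE)
      fix c assume c: "c 0 = e" "\<forall>t<T. N \<le> card {a. \<exists>x y. (a, x, y) \<in> G1 \<and> c t \<le> x \<and> y < c (Suc t)}"
      define c' where "c' t = (case t of 0 \<Rightarrow> z | Suc t \<Rightarrow> c t)" for t
      have "N \<le> card {a. \<exists>x y. (a, x, y) \<in> G \<and> c' t \<le> x \<and> y < c' (Suc t)}" if "t < Suc T" for t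
      proof (cases t)
        case 0
        then show ?thesis using e c(1) by (simp add: c'_def rows_def)
      next
        case (Suc t')
        have "N \<le> card {a. \<exists>x y. (a, x, y) \<in> G1 \<and> c t' \<le> x \<and> y < c (Suc t')}"
          using c(2) that Suc by auto
        also have "\<dots> \<le> card {a. \<exists>x y. (a, x, y) \<in> G \<and> c t' \<le> x \<and> y < c (Suc t')}"
        proof (rule card_mono)
          show "finite {a. \<exists>x y. (a, x, y) \<in> G \<and> c t' \<le> x \<and> y < c (Suc t')}"
            using fin by (rule finite_rows)
        qed (use sub in blast)
        finally show ?thesis using Suc by (simp add: c'_def)
      qed
      then show ?thesis by (intro disjI1 exI[of _ c']) (simp add: c'_def)
    next
      fix H assume H: "H \<subseteq> snd ` G1" "disjoint_ranges H" "finite H" "card G1 \<le> N * card H + T * card S"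
      have sep: "y < x'" if "(x, y) \<in> H0" "(x', y') \<in> H" for x y x' y'
      proof -
        have "y < e - 1" using that(1) H0(1) by (auto simp: G0_def)
        moreover have "e \<le> x'" using that(2) H(1) by (auto simp: G1_def)
        ultimately show ?thesis by linarith
      qed
      have le: "x' \<le> y'" if "(x', y') \<in> H" for x' y' using that H(2) disjoint_ranges_le by blast
      have dis: "H0 \<inter> H = {}" using sep le by (metis disjoint_iff leD prod.exhaust_sel)
      have "disjoint_ranges (H0 \<union> H)"
        using disjoint_ranges_Un[OF H0(2) H(2)] sep by blast
      moreover have "card G \<le> card G0 + card Gc + card G1"
        using card_Un_le[of "G0 \<union> Gc" G1] card_Un_le[of G0 Gc] arg_cong[OF split, of card] by linarith
      then have "card G \<le> N * card (H0 \<union> H) + Suc T * card S"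
        using H0 H \<open>card Gc \<le> card S\<close> dis by (simp add: card_Un_disjoint algebra_simps)
      moreover have "H0 \<union> H \<subseteq> snd ` G" using H0 H sub by blast
      ultimately show ?thesis using H0 H by (intro disjI2 exI[of _ "H0 \<union> H"]) auto
    qed
  qed
qed

lemma has_grid_superset:
  assumes "has_grid F N" "F \<subseteq> F'"
  shows "has_grid F' N"
proof -
  have "\<exists>a x y. (a, x, y) \<in> F' \<and> a = A \<and> X \<le> x \<and> y \<le> Y" if "(A, X, Y) \<in> F" for A X Y
    using that assms(2) by blast
  then show ?thesis
    using has_grid_transfer[OF assms(1), of F' "\<lambda>x. x" "\<lambda>x. x"] by (simp add: mono_def)
qed

lemma obtain_enumeration:
  fixes M :: "nat set"
  assumes "finite M" "N \<le> card M"
  obtains h where "\<And>i. i < N \<Longrightarrow> h i \<in> M" "\<And>i j. i < j \<Longrightarrow> j < N \<Longrightarrow> h i < h j"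
proof -
  obtain h where h: "bij_betw h {..<card M} M" "strict_mono_on {..<card M} h"
    using ex_bij_betw_strict_mono_card[OF assms(1)] .
  show thesis
  proof (rule that[of h])
    show "h i \<in> M" if "i < N" for i
      using that assms(2) bij_betwE[OF h(1)] by auto
    show "h i < h j" if "i < j" "j < N" for i j
      using that assms(2) by (intro strict_mono_onD[OF h(2)]) auto
  qed
qed

lemma large_fibre:
  assumes "finite A" "finite B" "f ` A \<subseteq> B" "N * card B \<le> card A" "B \<noteq> {}"
  shows "\<exists>b\<in>B. N \<le> card {a \<in> A. f a = b}"
proof -
  obtain b where b: "b \<in> B" "card A \<le> card (f -` {b} \<inter> A) * card B"
    using pigeonhole_card[of f A B] assms by auto
  have "N * card B \<le> card (f -` {b} \<inter> A) * card B" using b(2) assms(4) by linarith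
  then have "N \<le> card (f -` {b} \<inter> A)" using assms(2,5) by (simp add: card_gt_0_iff)
  moreover have "f -` {b} \<inter> A = {a \<in> A. f a = b}" by auto
  ultimately show ?thesis using b(1) by auto
qed

text \<open>Only \<open>2 ^ card S\<close> sets of rows are available, so \<open>N\<close> of the segments share the same rows.\<close>
lemma tall_segments_has_grid:
  assumes F: "range_family G" and S: "fst ` G \<subseteq> S" "finite S" and N: "N \<ge> 1"
    and tall: "\<And>t. t < N * 2 ^ card S \<Longrightarrow> N \<le> card {a. \<exists>x y. (a, x, y) \<in> G \<and> c t \<le> x \<and> y < c (Suc t)}"
  shows "has_grid G N"
proof -
  let ?T = "N * 2 ^ card S"
  define R where "R t = {a. \<exists>x y. (a, x, y) \<in> G \<and> c t \<le> x \<and> y < c (Suc t)}" for t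
  have RS: "R t \<subseteq> S" for t unfolding R_def using S(1) by (auto intro: rev_image_eqI)
  have step: "c t \<le> c (Suc t)" if "t < ?T" for t
  proof -
    have "R t \<noteq> {}" using tall[OF that] N unfolding R_def by force
    then obtain a x y where "(a, x, y) \<in> G" "c t \<le> x" "y < c (Suc t)" unfolding R_def by blast
    then show ?thesis using range_family_le[OF F] by fastforce
  qed
  have mono: "c t \<le> c t'" if "t \<le> t'" "t' \<le> ?T" for t t'
    using that
  proof (induction t' rule: dec_induct)
    case (step m) then show ?case using \<open>\<And>t. t < ?T \<Longrightarrow> c t \<le> c (Suc t)\<close>[of m] by simp
  qed simp
  have cp: "N * card (Pow S) \<le> card {..<?T}" using S by (simp add: card_Pow)
  have "R ` {..<?T} \<subseteq> Pow S" using RS by blast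
  moreover have "finite (Pow S)" "Pow S \<noteq> {}" using S by auto
  ultimately have "\<exists>D\<in>Pow S. N \<le> card {t \<in> {..<?T}. R t = D}"
    using cp by (intro large_fibre) auto
  then obtain D where D: "D \<in> Pow S" "N \<le> card {t \<in> {..<?T}. R t = D}" by blast
  obtain \<tau> where \<tau>: "\<And>j. j < N \<Longrightarrow> \<tau> j \<in> {t \<in> {..<?T}. R t = D}" "\<And>j j'. j < j' \<Longrightarrow> j' < N \<Longrightarrow> \<tau> j < \<tau> j'"
    using D(2) by (rule obtain_enumeration[rotated]) auto
  have "N \<le> card D"
  proof -
    have "R (\<tau> 0) = D" "\<tau> 0 < ?T" using \<tau>(1)[of 0] N by auto
    then show ?thesis using tall[of "\<tau> 0"] unfolding R_def by auto
  qed
  moreover have "finite D" using D(1) S(2) by (auto intro: finite_subset)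
  ultimately obtain \<alpha> where \<alpha>: "\<And>i. i < N \<Longrightarrow> \<alpha> i \<in> D" "\<And>i i'. i < i' \<Longrightarrow> i' < N \<Longrightarrow> \<alpha> i < \<alpha> i'"
    using obtain_enumeration by blast
  have "\<exists>x y. i < N \<longrightarrow> j < N \<longrightarrow> (\<alpha> i, x, y) \<in> G \<and> c (\<tau> j) \<le> x \<and> y < c (Suc (\<tau> j))" for i j
  proof (cases "i < N \<and> j < N")
    case True
    then have "\<alpha> i \<in> R (\<tau> j)" using \<alpha>(1) \<tau>(1) by blast
    then show ?thesis unfolding R_def by blast
  qed auto
  then obtain x y where xy: "\<And>i j. i < N \<Longrightarrow> j < N \<Longrightarrow> (\<alpha> i, x i j, y i j) \<in> G \<and> c (\<tau> j) \<le> x i j \<and> y i j < c (Suc (\<tau> j))"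
    by metis
  show ?thesis
  proof (rule has_gridI[of N "\<lambda>i j. \<alpha> i" x y])
    fix i i' j j' assume *: "j < j'" "i < N" "i' < N" "j < N" "j' < N"
    have "c (Suc (\<tau> j)) \<le> c (\<tau> j')" using mono \<tau>(2)[of j j'] \<tau>(1)[of j'] * by simp
    then show "y i j < x i' j'" using xy[of i j] xy[of i' j'] * by linarith
  qed (use xy \<alpha>(2) in blast)+
qed

lemma card_union_layers:
  assumes "finite I" "\<And>i. i \<in> I \<Longrightarrow> finite (L i)" "F \<subseteq> (\<Union>i\<in>I. L i)"
    "\<And>i. i \<in> I \<Longrightarrow> card (L i) \<le> N * card (H i) + d" "\<And>i. i \<in> I \<Longrightarrow> finite (H i)"
  shows "card F \<le> N * card (Sigma I H) + card I * d"
proof -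
  have "card F \<le> card (\<Union>i\<in>I. L i)" using assms by (intro card_mono) auto
  also have "\<dots> \<le> (\<Sum>i\<in>I. card (L i))" using assms(1) by (rule card_UN_le)
  also have "\<dots> \<le> (\<Sum>i\<in>I. N * card (H i) + d)" using assms(4) by (rule sum_mono)
  also have "\<dots> = N * card (Sigma I H) + card I * d"
    using assms by (simp add: sum.distrib sum_distrib_left)
  finally show ?thesis .
qed

text \<open>A strip of \<open>s\<close> rows of a grid-free family has fewer than \<open>N * 2 ^ s\<close> segments, so the additive loss
  is linear in the number of rows while the multiplicative loss is \<open>N\<close>, independent of \<open>s\<close>.\<close>
lemma row_contraction:
  assumes F: "range_family F" and ng: "\<not> has_grid F N" and N: "N \<ge> 1" and s: "s \<ge> 1"
    and rows: "\<And>a x y. (a, x, y) \<in> F \<Longrightarrow> a < R * s"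
  shows "\<exists>H. range_family H \<and> \<not> has_grid H N \<and>
    (\<forall>A X Y. (A, X, Y) \<in> H \<longrightarrow> A < R \<and> (\<exists>a. (a, X, Y) \<in> F)) \<and>
    card F \<le> N * card H + R * (N * 2 ^ s * s)"
proof -
  define L where "L A = {(a, x, y). (a, x, y) \<in> F \<and> a div s = A}" for A
  have LF: "L A \<subseteq> F" for A unfolding L_def by auto
  have fL: "range_family (L A)" for A using range_family_subset[OF F LF] .
  have "\<exists>H \<subseteq> snd ` L A. disjoint_ranges H \<and> finite H \<and> card (L A) \<le> N * card H + N * 2 ^ s * s" for A
  proof -
    define S where "S = {A * s..<A * s + s}"
    have S: "finite S" "card S = s" "fst ` L A \<subseteq> S"
    proof -
      have "fst p \<in> S" if "p \<in> L A" for p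
      proof -
        have "fst p div s = A" using that unfolding L_def by auto
        then show ?thesis using s unfolding S_def
          by (metis atLeastLessThan_iff add.commute div_times_less_eq_dividend dividend_less_div_times less_le_trans zero_less_one)
      qed
      then show "fst ` L A \<subseteq> S" by blast
    qed (auto simp: S_def)
    have "\<not> has_grid (L A) N"
    proof
      assume "has_grid (L A) N"
      then have "has_grid F N" using LF by (rule has_grid_superset)
      with ng show False ..
    qed
    then have no_tall: "\<not> (\<forall>t<N * 2 ^ s. N \<le> card {a. \<exists>x y. (a, x, y) \<in> L A \<and> c t \<le> x \<and> y < c (Suc t)})" for c
      using tall_segments_has_grid[OF fL S(3,1) N, of c] unfolding S(2) by blast
    have "0 \<le> x" for x :: nat by simp
    from strip_packing[OF fL S(3,1) this N, of "N * 2 ^ s"] no_tall show ?thesis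
      unfolding S(2) by blast
  qed
  then obtain H0 where H0: "\<And>A. H0 A \<subseteq> snd ` L A" "\<And>A. disjoint_ranges (H0 A)" "\<And>A. finite (H0 A)"
    "\<And>A. card (L A) \<le> N * card (H0 A) + N * 2 ^ s * s" by metis
  let ?H = "Sigma {..<R} H0"
  have pt: "A < R \<and> (\<exists>a. (a, X, Y) \<in> F \<and> a div s = A)" if "(A, X, Y) \<in> ?H" for A X Y
    using that H0(1)[of A] unfolding L_def by force
  have "card F \<le> N * card ?H + card {..<R} * (N * 2 ^ s * s)"
  proof (rule card_union_layers)
    show "F \<subseteq> (\<Union>A\<in>{..<R}. L A)"
      using rows s unfolding L_def by (force simp: less_mult_imp_div_less)
  qed (use H0 fL range_family_finite in auto)
  moreover have "range_family ?H" unfolding range_family_def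
  proof (intro conjI allI)
    fix A show "disjoint_ranges (?H `` {A})"
      by (rule disjoint_ranges_subset[OF H0(2)[of A]]) auto
  qed (use H0(3) in auto)
  moreover have "\<not> has_grid ?H N"
  proof
    assume "has_grid ?H N"
    then have "has_grid F N"
    proof (rule has_grid_transfer[where f = "\<lambda>a. a div s" and g = "\<lambda>x. x"])
      fix A X Y assume "(A, X, Y) \<in> ?H"
      then show "\<exists>a x y. (a, x, y) \<in> F \<and> a div s = A \<and> X \<le> x \<and> y \<le> Y" using pt by blast
    qed (auto simp: mono_def div_le_mono)
    with ng show False ..
  qed
  moreover have "\<forall>A X Y. (A, X, Y) \<in> ?H \<longrightarrow> A < R \<and> (\<exists>a. (a, X, Y) \<in> F)" using pt by blast
  ultimately show ?thesis unfolding card_lessThan by blast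
qed

text \<open>Keep the range that ends first, together with the blocks that it meets. It conflicts with at most \<open>N\<close> other
  ranges: all of them start in the block where it ends, fewer than \<open>N\<close> stay inside this block,
  and at most one leaves it.\<close>
lemma row_coarsening:
  assumes "finite K" "disjoint_ranges K"
    and "\<And>B. card {(x, y) \<in> K. x div s = B \<and> y div s = B} < N"
  shows "\<exists>H. finite H \<and> disjoint_ranges H \<and>
    (\<forall>X Y. (X, Y) \<in> H \<longrightarrow> (\<exists>x y. (x, y) \<in> K \<and> X = x div s \<and> Y = y div s)) \<and>
    card K \<le> (N + 1) * card H"
  using assms
proof (induction K rule: finite_psubset_induct)
  case (psubset K)
  show ?case
  proof (cases "K = {}")
    case True
    then show ?thesis by (intro exI[of _ "{}"]) (auto simp: disjoint_ranges_def)
  next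
    case False
    have "finite (snd ` K)" "snd ` K \<noteq> {}" using psubset.hyps False by auto
    then have "Min (snd ` K) \<in> snd ` K" and Min: "\<And>p. p \<in> K \<Longrightarrow> Min (snd ` K) \<le> snd p" by auto
    then obtain x0 y0 where p0: "(x0, y0) \<in> K" "y0 = Min (snd ` K)" by auto
    have ymin: "y0 \<le> y" if "(x, y) \<in> K" for x y using Min[OF that] p0(2) by simp
    define Y0 where "Y0 = y0 div s"
    define K' where "K' = {(x, y) \<in> K. Y0 < x div s}"
    define Kin where "Kin = {(x, y) \<in> K. x div s = Y0 \<and> y div s = Y0}"
    define Kout where "Kout = {(x, y) \<in> K. x div s = Y0 \<and> Y0 < y div s}"
    have start: "y0 < x" if "(x, y) \<in> K" "(x, y) \<noteq> (x0, y0)" for x y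
      using disjoint_rangesD[OF psubset.prems(1) that(1) p0(1)] ymin[OF that(1)]
        disjoint_ranges_le[OF psubset.prems(1) p0(1)] that(2)
      by auto
    have sub: "K' \<subseteq> K" "Kin \<subseteq> K" "Kout \<subseteq> K" unfolding K'_def Kin_def Kout_def by auto
    have "K \<subseteq> insert (x0, y0) (Kin \<union> Kout) \<union> K'"
    proof
      fix p assume p: "p \<in> K"
      obtain x y where xy: "p = (x, y)" by (cases p)
      show "p \<in> insert (x0, y0) (Kin \<union> Kout) \<union> K'"
      proof (cases "p = (x0, y0)")
        case False
        have "Y0 \<le> x div s" unfolding Y0_def using start[of x y] p xy False by (intro div_le_mono) auto
        moreover have "x div s \<le> y div s"
          using disjoint_ranges_le[OF psubset.prems(1), of x y] p xy by (intro div_le_mono) auto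
        ultimately show ?thesis using p unfolding xy K'_def Kin_def Kout_def by auto
      qed auto
    qed
    have fin: "finite Kin" "finite Kout" "finite K'" using sub psubset.hyps by (auto intro: finite_subset)
    have "card K \<le> card (insert (x0, y0) (Kin \<union> Kout) \<union> K')"
      using \<open>K \<subseteq> _\<close> fin by (intro card_mono) auto
    also have "\<dots> \<le> card (insert (x0, y0) (Kin \<union> Kout)) + card K'" by (rule card_Un_le)
    also have "card (insert (x0, y0) (Kin \<union> Kout)) \<le> Suc (card (Kin \<union> Kout))" by (rule card_insert_le_m1) auto
    also have "card (Kin \<union> Kout) \<le> card Kin + card Kout" by (rule card_Un_le)
    finally have c1: "card K \<le> Suc (card Kin + card Kout) + card K'" by simp
    have c2: "card Kin < N" unfolding Kin_def using psubset.prems(2) .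
    have c3: "card Kout \<le> 1"
    proof -
      have "p = q" if "p \<in> Kout" "q \<in> Kout" for p q
      proof -
        obtain x y x' y' where pq: "p = (x, y)" "q = (x', y')" by (cases p, cases q)
        have "\<not> y < x'" using that unfolding pq Kout_def using div_le_mono[of y x' s] by auto
        moreover have "\<not> y' < x" using that unfolding pq Kout_def using div_le_mono[of y' x s] by auto
        ultimately show ?thesis using disjoint_rangesD[OF psubset.prems(1), of x y x' y'] that sub(3) pq by auto
      qed
      then show ?thesis by (auto intro!: card_le_Suc0_iff_eq[THEN iffD2] fin)
    qed
    have "(x0, y0) \<notin> K'"
      unfolding K'_def Y0_def using disjoint_ranges_le[OF psubset.prems(1) p0(1)] div_le_mono[of x0 y0 s] by auto
    then have ps: "K' \<subset> K" using sub p0 by auto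
    have small: "card {(x, y) \<in> K'. x div s = B \<and> y div s = B} < N" for B
    proof -
      have "card {(x, y) \<in> K'. x div s = B \<and> y div s = B} \<le> card {(x, y) \<in> K. x div s = B \<and> y div s = B}"
        by (intro card_mono finite_subset[OF _ psubset.hyps]) (use sub in auto)
      then show ?thesis using psubset.prems(2)[of B] by simp
    qed
    obtain H where H: "finite H" "disjoint_ranges H"
      "\<forall>X Y. (X, Y) \<in> H \<longrightarrow> (\<exists>x y. (x, y) \<in> K' \<and> X = x div s \<and> Y = y div s)"
      "card K' \<le> (N + 1) * card H"
      using psubset.IH[OF ps disjoint_ranges_subset[OF psubset.prems(1) sub(1)] small] by blast
    have sep: "Y0 < X" if "(X, Y) \<in> H" for X Y
      using H(3) that unfolding K'_def by auto
    let ?H = "insert (x0 div s, Y0) H"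
    have "disjoint_ranges {(x0 div s, Y0)}"
      using disjoint_ranges_le[OF psubset.prems(1) p0(1)] unfolding disjoint_ranges_def Y0_def
      by (auto simp: div_le_mono)
    then have "disjoint_ranges ({(x0 div s, Y0)} \<union> H)"
      by (rule disjoint_ranges_Un) (use H sep in auto)
    moreover have "(x0 div s, Y0) \<notin> H"
      using sep div_le_mono[OF disjoint_ranges_le[OF psubset.prems(1) p0(1)], of s] unfolding Y0_def
      by (meson leD)
    then have "card K \<le> (N + 1) * card ?H"
      using c1 c2 c3 H by simp
    moreover have "\<forall>X Y. (X, Y) \<in> ?H \<longrightarrow> (\<exists>x y. (x, y) \<in> K \<and> X = x div s \<and> Y = y div s)"
      using H(3) sub(1) p0(1) unfolding Y0_def by blast
    ultimately show ?thesis using H(1) by (intro exI[of _ ?H]) auto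
  qed
qed

text \<open>Call a row dense in a block of \<open>s\<close> columns if \<open>N\<close> of its ranges lie inside the block. Among
  \<open>N * 2 ^ (s * s)\<close> rows that are dense in one block, some \<open>N\<close> have the same ranges there and form a
  grid. Hence the ranges inside blocks where their row is dense are few, and on the others only the
  factor \<open>N + 1\<close> is lost.\<close>
lemma column_contraction:
  assumes F: "range_family F" and ng: "\<not> has_grid F N" and N: "N \<ge> 1" and s: "s \<ge> 1"
    and cols: "\<And>a x y. (a, x, y) \<in> F \<Longrightarrow> y < C * s"
  shows "\<exists>H. range_family H \<and> \<not> has_grid H N \<and>
    (\<forall>A X Y. (A, X, Y) \<in> H \<longrightarrow> (\<exists>x. (A, x) \<in> F) \<and> Y < C) \<and>
    card F \<le> (N + 1) * card H + C * (N * 2 ^ (s * s) * s)"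
proof -
  have fin: "finite F" using F range_family_finite by auto
  define P where "P a B = {(x, y). (a, x, y) \<in> F \<and> x div s = B \<and> y div s = B}" for a B
  define Dn where "Dn B = {a \<in> fst ` F. N \<le> card (P a B)}" for B
  define W where "W = N * 2 ^ (s * s)"
  define box where "box B = {B * s..<B * s + s}" for B
  have in_box: "x \<in> box B" if "x div s = B" for x B
    using that s unfolding box_def
    by (metis atLeastLessThan_iff add.commute div_times_less_eq_dividend dividend_less_div_times less_le_trans zero_less_one)
  have boxc: "finite (box B)" "card (box B) = s" for B unfolding box_def by auto
  have Pbox: "P a B \<subseteq> box B \<times> box B" for a B 
  proof
    fix p assume "p \<in> P a B"
    then have "fst p div s = B" "snd p div s = B" unfolding P_def by auto
    then show "p \<in> box B \<times> box B" using in_box by (metis mem_Times_iff)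
  qed
  have Pfin: "finite (P a B)" for a B using Pbox boxc by (meson finite_SigmaI finite_subset)
  have Pinj: "inj_on fst (P a B)" for a B
  proof (rule inj_onI, clarsimp)
    fix x y y' assume "(x, y) \<in> P a B" "(x, y') \<in> P a B"
    then show "y = y'" using range_familyD[OF F, of a x y x y'] range_family_le[OF F] unfolding P_def by fastforce
  qed
  have Pcard: "card (P a B) \<le> s" for a B
    using card_inj_on_le[OF Pinj _ boxc(1)[of B], of a B] Pbox boxc(2) by fastforce
  have Dfin: "finite (Dn B)" for B unfolding Dn_def using fin by auto
  have few_dense: "card (Dn B) < W" for B
  proof (rule ccontr)
    assume "\<not> card (Dn B) < W"
    then have "N * card (Pow (box B \<times> box B)) \<le> card (Dn B)"
      using boxc unfolding W_def by (simp add: card_Pow card_cartesian_product)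
    moreover have "(\<lambda>a. P a B) ` Dn B \<subseteq> Pow (box B \<times> box B)" using Pbox by blast
    moreover have "finite (Pow (box B \<times> box B))" "Pow (box B \<times> box B) \<noteq> {}" using boxc by auto
    ultimately have "\<exists>Q\<in>Pow (box B \<times> box B). N \<le> card {a \<in> Dn B. P a B = Q}"
      using Dfin by (intro large_fibre)
    then obtain Q where Q: "N \<le> card {a \<in> Dn B. P a B = Q}" by blast
    have "finite {a \<in> Dn B. P a B = Q}" using Dfin by auto
    then obtain \<alpha> where \<alpha>: "\<And>i. i < N \<Longrightarrow> \<alpha> i \<in> {a \<in> Dn B. P a B = Q}" "\<And>i i'. i < i' \<Longrightarrow> i' < N \<Longrightarrow> \<alpha> i < \<alpha> i'"
      using Q obtain_enumeration by blast
    have Q0: "P (\<alpha> 0) B = Q" "N \<le> card (P (\<alpha> 0) B)" using \<alpha>(1)[of 0] N unfolding Dn_def by auto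
    then have "N \<le> card (fst ` Q)" using Pinj card_image by metis
    moreover have "finite (fst ` Q)" using Q0(1) Pfin by auto
    ultimately obtain \<xi> where \<xi>: "\<And>j. j < N \<Longrightarrow> \<xi> j \<in> fst ` Q" "\<And>j j'. j < j' \<Longrightarrow> j' < N \<Longrightarrow> \<xi> j < \<xi> j'"
      using obtain_enumeration by blast
    have "\<exists>y. j < N \<longrightarrow> (\<xi> j, y) \<in> Q" for j using \<xi>(1) by force
    then obtain \<eta> where \<eta>: "\<And>j. j < N \<Longrightarrow> (\<xi> j, \<eta> j) \<in> Q" by metis
    have inF: "(\<alpha> i, \<xi> j, \<eta> j) \<in> F" if "i < N" "j < N" for i j
      using \<alpha>(1)[OF that(1)] \<eta>[OF that(2)] unfolding P_def by blast
    have "has_grid F N"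
    proof (rule has_gridI[of N "\<lambda>i j. \<alpha> i" "\<lambda>i j. \<xi> j" "\<lambda>i j. \<eta> j"])
      fix i i' j j' assume *: "j < j'" "i < N" "i' < N" "j < N" "j' < N"
      have "\<xi> j < \<xi> j'" using \<xi>(2) * by blast
      moreover have "\<xi> j' \<le> \<eta> j'" using range_family_le[OF F inF[of i j']] * by blast
      ultimately show "\<eta> j < \<xi> j'"
        using range_familyD[OF F inF[of i j] inF[of i j']] * by auto
    qed (use inF \<alpha>(2) in blast)+
    then show False using ng by blast
  qed
  define D where "D = (\<Union>B\<in>{..<C}. Sigma (Dn B) (\<lambda>a. P a B))"
  have Dcard: "card D \<le> C * (W * s)"
  proof -
    have "card D \<le> (\<Sum>B\<in>{..<C}. card (Sigma (Dn B) (\<lambda>a. P a B)))"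
      unfolding D_def by (rule card_UN_le) simp
    also have "\<dots> \<le> (\<Sum>B\<in>{..<C}. W * s)"
    proof (rule sum_mono)
      fix B
      have "card (Sigma (Dn B) (\<lambda>a. P a B)) = (\<Sum>a\<in>Dn B. card (P a B))"
        using Dfin Pfin by (simp add: card_SigmaI)
      also have "\<dots> \<le> (\<Sum>a\<in>Dn B. s)" using Pcard by (intro sum_mono)
      also have "\<dots> \<le> W * s" using few_dense[of B] by simp
      finally show "card (Sigma (Dn B) (\<lambda>a. P a B)) \<le> W * s" .
    qed
    finally show ?thesis by simp
  qed
  define F' where "F' = F - D"
  have F'F: "F' \<subseteq> F" unfolding F'_def by auto
  have F': "range_family F'" using range_family_subset[OF F F'F] .
  have sparse: "card {(x, y) \<in> F' `` {a}. x div s = B \<and> y div s = B} < N" for a B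
  proof (cases "{(x, y) \<in> F' `` {a}. x div s = B \<and> y div s = B} = {}")
    case True
    show ?thesis unfolding True using N by simp
  next
    case False
    then obtain x y where xy: "(a, x, y) \<in> F" "(a, x, y) \<notin> D" "x div s = B" "y div s = B"
      unfolding F'_def by auto
    have "y div s < C" using cols[OF xy(1)] by (rule less_mult_imp_div_less)
    then have "a \<notin> Dn B" using xy unfolding D_def P_def by auto
    then have "card (P a B) < N" using xy(1) unfolding Dn_def by (force simp: not_le)
    moreover have "card {(x, y) \<in> F' `` {a}. x div s = B \<and> y div s = B} \<le> card (P a B)"
      by (rule card_mono[OF Pfin]) (use F'F in \<open>auto simp: P_def\<close>)
    ultimately show ?thesis by linarith
  qed
  have "\<exists>H. finite H \<and> disjoint_ranges H \<and>
    (\<forall>X Y. (X, Y) \<in> H \<longrightarrow> (\<exists>x y. (x, y) \<in> F' `` {a} \<and> X = x div s \<and> Y = y div s)) \<and>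
    card (F' `` {a}) \<le> (N + 1) * card H" for a
  proof (rule row_coarsening[OF _ _ sparse])
    show "finite (F' `` {a})" "disjoint_ranges (F' `` {a})"
      using F' by (auto simp: range_family_def)
  qed
  then obtain H0 where H0: "\<And>a. finite (H0 a)" "\<And>a. disjoint_ranges (H0 a)"
    "\<And>a X Y. (X, Y) \<in> H0 a \<Longrightarrow> \<exists>x y. (x, y) \<in> F' `` {a} \<and> X = x div s \<and> Y = y div s"
    "\<And>a. card (F' `` {a}) \<le> (N + 1) * card (H0 a)" by metis
  let ?H = "Sigma (fst ` F) H0"
  have pt: "\<exists>x y. (A, x, y) \<in> F \<and> X = x div s \<and> Y = y div s" if "(A, X, Y) \<in> ?H" for A X Y
    using that H0(3)[of X Y A] F'F by auto
  have "card F' \<le> (N + 1) * card ?H + card (fst ` F) * 0"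
  proof (rule card_union_layers)
    show "F' \<subseteq> (\<Union>a\<in>fst ` F. {a} \<times> F' `` {a})" using F'F by force
    show "card ({a} \<times> F' `` {a}) \<le> (N + 1) * card (H0 a) + 0" for a
      using H0(4)[of a] by (simp add: card_cartesian_product)
    show "finite ({a} \<times> F' `` {a})" for a
      using range_family_finite[OF F'] by auto
  qed (use fin H0 in auto)
  moreover have "card F \<le> card F' + card D"
  proof -
    have "finite D" unfolding D_def using Dfin Pfin by auto
    then show ?thesis unfolding F'_def using card_Diff_subset_Int diff_card_le_card_Diff[of D F] by linarith
  qed
  ultimately have "card F \<le> (N + 1) * card ?H + C * (W * s)" using Dcard by simp
  moreover have "range_family ?H" unfolding range_family_def
  proof (intro conjI allI)
    fix A show "disjoint_ranges (?H `` {A})"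
      by (rule disjoint_ranges_subset[OF H0(2)[of A]]) auto
  qed (use H0(1) fin in auto)
  moreover have "\<not> has_grid ?H N"
  proof
    assume "has_grid ?H N"
    then have "has_grid F N"
    proof (rule has_grid_transfer[where f = "\<lambda>a. a" and g = "\<lambda>x. x div s"])
      fix A X Y assume "(A, X, Y) \<in> ?H"
      then show "\<exists>a x y. (a, x, y) \<in> F \<and> a = A \<and> X \<le> x div s \<and> y div s \<le> Y" using pt by blast
    qed (auto simp: mono_def div_le_mono)
    with ng show False ..
  qed
  moreover have "\<forall>A X Y. (A, X, Y) \<in> ?H \<longrightarrow> (\<exists>x. (A, x) \<in> F) \<and> Y < C"
  proof (intro allI impI)
    fix A X Y assume "(A, X, Y) \<in> ?H"
    then obtain x y where "(A, x, y) \<in> F" "Y = y div s" using pt by blast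
    then show "(\<exists>x. (A, x) \<in> F) \<and> Y < C" using cols less_mult_imp_div_less by blast
  qed
  ultimately show ?thesis unfolding W_def by blast
qed

text \<open>The Marcus-Tardos theorem with ranges of columns in place of the nonzero entries of a matrix.
  Contracting by \<open>s = 2 * N * (N + 1)\<close> divides the size by \<open>s\<close> and the number of ranges by at most
  \<open>N * (N + 1) = s / 2\<close>, up to a linear error, so the recursion gives a linear bound. Rows and columns
  are contracted one after the other: in a contraction of both at once every row of a square block
  could lose ranges that cross the border of the block, which would cost a factor \<open>s\<close>.\<close>
theorem grid_free_range_family_linear:
  assumes N: "N \<ge> 1"
  shows "\<exists>K. \<forall>m F. range_family F \<longrightarrow> \<not> has_grid F N \<longrightarrow>
     (\<forall>a x y. (a, x, y) \<in> F \<longrightarrow> a < m \<and> y < m) \<longrightarrow> card F \<le> K * m"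
proof -
  define s where "s = 2 * N * (N + 1)"
  define Q where "Q = N * (N * 2 ^ (s * s) * s) + N * 2 ^ s * s"
  define K where "K = 6 * Q + 2 * s"
  have s: "s \<ge> 1" "s > 1" using N unfolding s_def by (cases N; simp)+
  have "card F \<le> K * m" if "range_family F" "\<not> has_grid F N"
    "\<And>a x y. (a, x, y) \<in> F \<Longrightarrow> a < m \<and> y < m" for m F
    using that
  proof (induction m arbitrary: F rule: less_induct)
    case (less m)
    show ?case
    \<comment> \<open>For small \<open>m\<close> only the trivial bound \<open>m * m\<close> is available; this is why \<open>K\<close> exceeds \<open>2 * s\<close>.\<close>
    proof (cases "m < 2 * s")
      case True
      have "inj_on (\<lambda>(a, x, y). (a, x)) F"
      proof (rule inj_onI, clarsimp)
        fix a x y y' assume "(a, x, y) \<in> F" "(a, x, y') \<in> F"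
        then show "y = y'" using range_familyD[OF less.prems(1), of a x y x y'] range_family_le[OF less.prems(1)] by fastforce
      qed
      moreover have "(\<lambda>(a, x, y). (a, x)) ` F \<subseteq> {..<m} \<times> {..<m}"
        using less.prems(3) range_family_le[OF less.prems(1)] by fastforce
      ultimately have "card F \<le> m * m"
        using card_inj_on_le[of "\<lambda>(a, x, y). (a, x)" F "{..<m} \<times> {..<m}"] by simp
      also have "\<dots> \<le> K * m" using True unfolding K_def by (intro mult_right_mono) auto
      finally show ?thesis .
    next
      case False
      define r where "r = m div s + 1"
      have rm: "m < r * s" unfolding r_def using s dividend_less_div_times[of s m] by simp
      have rs: "r * s \<le> m + s" unfolding r_def by simp
      have "2 * r < 2 * m"
      proof -
        have "m div s \<le> m div 2" using s(2) by (intro div_le_mono2) auto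
        moreover have "2 * (m div 2) \<le> m" by simp
        ultimately have "2 * (m div s) \<le> m" by (meson le_trans mult_le_mono2)
        then have "2 * r \<le> m + 2" unfolding r_def by (simp only: distrib_left)
        then show ?thesis using False s(2) by linarith
      qed
      then have "r < m" by simp
      obtain H1 where H1: "range_family H1" "\<not> has_grid H1 N"
        "\<And>A X Y. (A, X, Y) \<in> H1 \<Longrightarrow> A < r \<and> (\<exists>a. (a, X, Y) \<in> F)"
        "card F \<le> N * card H1 + r * (N * 2 ^ s * s)"
      proof -
        have "a < r * s" if "(a, x, y) \<in> F" for a x y using less.prems(3)[OF that] rm by linarith
        then have "\<exists>H. range_family H \<and> \<not> has_grid H N \<and>
          (\<forall>A X Y. (A, X, Y) \<in> H \<longrightarrow> A < r \<and> (\<exists>a. (a, X, Y) \<in> F)) \<and>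
          card F \<le> N * card H + r * (N * 2 ^ s * s)"
          by (intro row_contraction[OF less.prems(1,2) N s(1)])
        then show thesis using that by blast
      qed
      obtain H2 where H2: "range_family H2" "\<not> has_grid H2 N"
        "\<And>A X Y. (A, X, Y) \<in> H2 \<Longrightarrow> (\<exists>x. (A, x) \<in> H1) \<and> Y < r"
        "card H1 \<le> (N + 1) * card H2 + r * (N * 2 ^ (s * s) * s)"
      proof -
        have "y < r * s" if "(a, x, y) \<in> H1" for a x y
          using H1(3)[OF that] less.prems(3) rm by (meson less_trans)
        then have "\<exists>H. range_family H \<and> \<not> has_grid H N \<and>
          (\<forall>A X Y. (A, X, Y) \<in> H \<longrightarrow> (\<exists>x. (A, x) \<in> H1) \<and> Y < r) \<and>
          card H1 \<le> (N + 1) * card H + r * (N * 2 ^ (s * s) * s)"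
          by (intro column_contraction[OF H1(1,2) N s(1)])
        then show thesis using that by blast
      qed
      have "card H2 \<le> K * r"
      proof (rule less.IH[OF \<open>r < m\<close> H2(1,2)])
        fix a x y assume "(a, x, y) \<in> H2"
        then show "a < r \<and> y < r" using H2(3) H1(3) by fast
      qed
      have "N * card H1 \<le> N * ((N + 1) * card H2 + r * (N * 2 ^ (s * s) * s))"
        using H2(4) by (rule mult_left_mono) simp
      then have "card F \<le> N * (N + 1) * card H2 + r * Q"
        using H1(4) unfolding Q_def by (simp add: algebra_simps)
      then have "2 * card F \<le> s * card H2 + 2 * (r * Q)" unfolding s_def by (simp add: algebra_simps)
      also have "\<dots> \<le> s * (K * r) + 2 * (r * Q)"
        using \<open>card H2 \<le> K * r\<close> by simp
      also have "\<dots> = K * (r * s) + 2 * (r * Q)" by simp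
      also have "\<dots> \<le> K * (m + s) + 2 * (m * Q)"
        using rs \<open>r < m\<close> by (intro add_mono mult_left_mono mult_right_mono) auto
      finally have "4 * card F \<le> 2 * (K * (m + s)) + 4 * (m * Q)" by simp
      also have "\<dots> = 2 * (K * m) + K * (2 * s) + 4 * (m * Q)" by (simp add: algebra_simps)
      also have "K * (2 * s) \<le> K * m" using False by (intro mult_left_mono) auto
      also have "4 * (m * Q) \<le> K * m" unfolding K_def by (simp add: algebra_simps)
      finally show ?thesis by simp
    qed
  qed
  then show ?thesis by blast
qed

section \<open>Counting relations without a large grid\<close>

definition point_ranges :: "(nat \<times> nat) set \<Rightarrow> (nat \<times> nat \<times> nat) set" where
  "point_ranges D = (\<lambda>(a, x). (a, x, x)) ` D"

lemma in_point_ranges [simp]: "(a, x, y) \<in> point_ranges D \<longleftrightarrow> (a, x) \<in> D \<and> y = x"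
  unfolding point_ranges_def by auto

lemma grid_free_points_linear:
  assumes "N \<ge> 1"
  shows "\<exists>K. \<forall>m D. D \<subseteq> {..<m} \<times> {..<m} \<longrightarrow> \<not> has_grid (point_ranges D) N \<longrightarrow> card D \<le> K * m"
proof -
  obtain K where K: "\<forall>m F. range_family F \<longrightarrow> \<not> has_grid F N \<longrightarrow>
     (\<forall>a x y. (a, x, y) \<in> F \<longrightarrow> a < m \<and> y < m) \<longrightarrow> card F \<le> K * m"
    using grid_free_range_family_linear[OF assms] by blast
  have "card D \<le> K * m" if D: "D \<subseteq> {..<m} \<times> {..<m}" and ng: "\<not> has_grid (point_ranges D) N" for m D
  proof -
    have "finite D" using D finite_subset by fastforce
    then have "range_family (point_ranges D)"
      unfolding range_family_def disjoint_ranges_def by (auto simp: point_ranges_def)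
    moreover have "\<forall>a x y. (a, x, y) \<in> point_ranges D \<longrightarrow> a < m \<and> y < m" using D by auto
    ultimately have "card (point_ranges D) \<le> K * m" using K ng by blast
    moreover have "card (point_ranges D) = card D"
      unfolding point_ranges_def by (rule card_image) (auto simp: inj_on_def)
    ultimately show ?thesis by simp
  qed
  then show ?thesis by blast
qed

text \<open>Klazar's argument. Halving both coordinates turns a grid-free relation on \<open>n\<close> points into one on
  \<open>(n + 1) div 2\<close> points, which has only linearly many pairs. Each of its pairs stands for a nonempty
  part of a two by two square, so it has only exponentially many preimages.\<close>
theorem card_grid_free_relations:
  assumes "N \<ge> 1"
  shows "\<exists>L\<ge>1. \<forall>n. card {D. D \<subseteq> {..<n} \<times> {..<n} \<and> \<not> has_grid (point_ranges D) N} \<le> L ^ n"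
proof -
  obtain K where K: "\<And>m D. D \<subseteq> {..<m} \<times> {..<m} \<Longrightarrow> \<not> has_grid (point_ranges D) N \<Longrightarrow> card D \<le> K * m"
    using grid_free_points_linear[OF assms] by blast
  define S where "S n = {D. D \<subseteq> {..<n} \<times> {..<n} \<and> \<not> has_grid (point_ranges D) N}" for n
  define c where "c = (2::nat) ^ (4 * K + 1)"
  have c2: "2 \<le> c" unfolding c_def by simp
  have finS: "finite (S n)" for n
    by (rule finite_subset[of _ "Pow ({..<n} \<times> {..<n})"]) (auto simp: S_def)
  have "card (S n) \<le> (c ^ 2) ^ n" for n
  proof (induction n rule: less_induct)
    case (less n)
    show ?case
    proof (cases "n < 2")
      case True
      have "card (S n) \<le> card (Pow ({..<n} \<times> {..<n}))" by (rule card_mono) (auto simp: S_def)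
      also have "\<dots> = 2 ^ (n * n)" by (simp add: card_Pow card_cartesian_product)
      also have "n * n = n" using True by (cases n) auto
      also have "(2::nat) ^ n \<le> (c ^ 2) ^ n"
        using c2 by (intro power_mono) (auto simp: power2_eq_square intro: le_trans[OF c2])
      finally show ?thesis .
    next
      case False
      define n' where "n' = (n + 1) div 2"
      \<comment> \<open>The second inequality makes the base \<open>c ^ 2\<close> work: \<open>(c ^ 2) ^ n' * c ^ n' = c ^ (3 * n')\<close>.\<close>
      have n': "n' < n" "3 * n' \<le> 2 * n" unfolding n'_def using False by linarith+
      define half where "half = (\<lambda>(a::nat, x::nat). (a div 2, x div 2))"
      define expand where "expand D = {p. half p \<in> D}" for D
      have sub: "expand D \<subseteq> (\<Union>(a, x)\<in>D. {2 * a, 2 * a + 1} \<times> {2 * x, 2 * x + 1})" for D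
        unfolding expand_def half_def by (auto; force)
      have ex: "finite (expand D) \<and> card (expand D) \<le> 4 * card D" if "finite D" for D
      proof -
        have "finite (\<Union>(a, x)\<in>D. {2 * a, 2 * a + 1} \<times> {2 * x, 2 * x + 1})" using that by auto
        moreover have "card (\<Union>(a, x)\<in>D. {2 * a, 2 * a + 1} \<times> {2 * x, 2 * x + 1})
            \<le> (\<Sum>(a, x)\<in>D. card ({2 * a, 2 * a + 1} \<times> {2 * x, 2 * x + 1}))"
          using card_UN_le[OF that, of "\<lambda>(a, x). {2 * a, 2 * a + 1} \<times> {2 * x, 2 * x + 1}"]
          by (simp add: case_prod_unfold)
        moreover have "\<dots> = (\<Sum>p\<in>D. 4)"
          by (rule sum.cong) (auto simp: card_cartesian_product)
        ultimately show ?thesis using sub[of D] card_mono[OF _ sub[of D]] finite_subset by fastforce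
      qed
      have "S n \<subseteq> (\<Union>D'\<in>S n'. Pow (expand D'))"
      proof
        fix D assume D: "D \<in> S n"
        have "half ` D \<subseteq> {..<n'} \<times> {..<n'}"
          using D unfolding S_def half_def n'_def by fastforce
        moreover have "\<not> has_grid (point_ranges (half ` D)) N"
        proof
          assume "has_grid (point_ranges (half ` D)) N"
          then have "has_grid (point_ranges D) N"
          proof (rule has_grid_transfer[where f = "\<lambda>a. a div 2" and g = "\<lambda>a. a div 2"])
            fix A X Y assume "(A, X, Y) \<in> point_ranges (half ` D)"
            then obtain a x where "(a, x) \<in> D" "A = a div 2" "X = x div 2" "Y = x div 2"
              by (auto simp: half_def)
            then show "\<exists>a x y. (a, x, y) \<in> point_ranges D \<and> a div 2 = A \<and> X \<le> x div 2 \<and> y div 2 \<le> Y"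
              by (intro exI[of _ a] exI[of _ x]) auto
          qed (auto simp: mono_def div_le_mono)
          then show False using D unfolding S_def by blast
        qed
        ultimately have "half ` D \<in> S n'" unfolding S_def by blast
        moreover have "D \<subseteq> expand (half ` D)" unfolding expand_def by auto
        ultimately show "D \<in> (\<Union>D'\<in>S n'. Pow (expand D'))" by blast
      qed
      moreover have finS': "finite D'" if "D' \<in> S n'" for D'
        using that unfolding S_def by (auto intro: finite_subset)
      then have "finite (\<Union>D'\<in>S n'. Pow (expand D'))" using finS ex by auto
      ultimately have "card (S n) \<le> card (\<Union>D'\<in>S n'. Pow (expand D'))" by (meson card_mono)
      also have "\<dots> \<le> (\<Sum>D'\<in>S n'. card (Pow (expand D')))" using finS by (rule card_UN_le)
      also have "\<dots> \<le> (\<Sum>D'\<in>S n'. c ^ n')"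
      proof (rule sum_mono)
        fix D' assume D': "D' \<in> S n'"
        then have f: "finite D'" by (rule finS')
        have "card D' \<le> K * n'" using D' K unfolding S_def by blast
        then have "card (expand D') \<le> (4 * K + 1) * n'" using ex[OF f] by (simp add: algebra_simps)
        then have "(2::nat) ^ card (expand D') \<le> 2 ^ ((4 * K + 1) * n')" by (intro power_increasing) auto
        then show "card (Pow (expand D')) \<le> c ^ n'"
          using ex[OF f] unfolding c_def power_mult[symmetric] by (simp add: card_Pow)
      qed
      also have "\<dots> = card (S n') * c ^ n'" by simp
      also have "\<dots> \<le> (c ^ 2) ^ n' * c ^ n'" using less.IH[OF n'(1)] by simp
      also have "\<dots> = c ^ (3 * n')" by (simp flip: power_mult power_add)
      also have "\<dots> \<le> c ^ (2 * n)" using n'(2) c2 by (intro power_increasing) auto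
      also have "\<dots> = (c ^ 2) ^ n" by (simp add: power_mult)
      finally show ?thesis .
    qed
  qed
  moreover have "1 \<le> c ^ 2" using c2 by simp
  ultimately show ?thesis unfolding S_def by blast
qed

section \<open>Rows that differ in many blocks\<close>

text \<open>Think of \<open>B r b\<close> as the part of row \<open>r\<close> in block \<open>b\<close>. The first range is the shortest one starting
  at \<open>z\<close> on which \<open>I\<close> shows \<open>q\<close> distinct rows. Without its last block fewer than \<open>q\<close> rows are seen, so a
  \<open>q\<close>-th of \<open>I\<close> agrees there; these rows still differ in many blocks, and all but one of these lie to the right
  of the range. The remaining ranges are found among them.\<close>
lemma disjoint_distinguishing_ranges:
  fixes B :: "nat \<Rightarrow> nat \<Rightarrow> 'b"
  assumes "finite I" "2 \<le> q" "q ^ c \<le> card I"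
    and "\<And>r r'. r \<in> I \<Longrightarrow> r' \<in> I \<Longrightarrow> r \<noteq> r' \<Longrightarrow> c < card {b. z \<le> b \<and> b < m \<and> B r b \<noteq> B r' b}"
  shows "\<exists>x y. (\<forall>l<c. z \<le> x l \<and> x l \<le> y l \<and> y l < m \<and> q \<le> card ((\<lambda>r. restrict (B r) {x l..y l}) ` I)) \<and>
    (\<forall>l<c. \<forall>l'<c. l < l' \<longrightarrow> y l < x l')"
  using assms
proof (induction c arbitrary: I z)
  case 0
  then show ?case by auto
next
  case (Suc c)
  define f where "f e = (\<lambda>r. restrict (B r) {z..<e})" for e
  have qI: "q \<le> card I"
    using self_le_power[of q "Suc c"] Suc.prems(2,3) by linarith
  have inj: "inj_on (f m) I"
  proof (rule inj_onI, rule ccontr)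
    fix r r' assume rr: "r \<in> I" "r' \<in> I" "f m r = f m r'" "r \<noteq> r'"
    have "B r b = B r' b" if "z \<le> b" "b < m" for b
      using fun_cong[OF rr(3), of b] that unfolding f_def by auto
    then have "{b. z \<le> b \<and> b < m \<and> B r b \<noteq> B r' b} = {}" by auto
    then show False using Suc.prems(4)[OF rr(1,2,4)] by (metis card.empty not_less0)
  qed
  define e where "e = (LEAST e. q \<le> card (f e ` I))"
  have qm: "q \<le> card (f m ` I)" using qI card_image[OF inj] by simp
  then have e: "q \<le> card (f e ` I)" "e \<le> m"
    unfolding e_def using LeastI[of "\<lambda>e. q \<le> card (f e ` I)", OF qm]
      Least_le[of "\<lambda>e. q \<le> card (f e ` I)", OF qm] by blast+
  have ez: "z < e"
  proof (rule ccontr)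
    assume "\<not> z < e"
    then have "f e ` I \<subseteq> {\<lambda>_. undefined}" unfolding f_def by auto
    then have "card (f e ` I) \<le> card {\<lambda>_::nat. undefined :: 'b}" by (intro card_mono) auto
    then show False using e(1) Suc.prems(2) by simp
  qed
  have "\<not> q \<le> card (f (e - 1) ` I)"
    using not_less_Least[of "e - 1" "\<lambda>e. q \<le> card (f e ` I)"] ez unfolding e_def[symmetric] by auto
  then have "q ^ c * card (f (e - 1) ` I) \<le> q ^ c * q" by (intro mult_left_mono) auto
  also have "\<dots> \<le> card I" using Suc.prems(3) by (simp add: mult.commute)
  finally have "q ^ c * card (f (e - 1) ` I) \<le> card I" .
  moreover have "I \<noteq> {}" using qI Suc.prems(2) by auto
  ultimately have "\<exists>v\<in>f (e - 1) ` I. q ^ c \<le> card {r \<in> I. f (e - 1) r = v}"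
    using Suc.prems(1) by (intro large_fibre) auto
  then obtain v where v: "q ^ c \<le> card {r \<in> I. f (e - 1) r = v}" by blast
  define I' where "I' = {r \<in> I. f (e - 1) r = v}"
  have I': "finite I'" "q ^ c \<le> card I'" "I' \<subseteq> I" using v Suc.prems(1) unfolding I'_def by auto
  have diff: "c < card {b. e \<le> b \<and> b < m \<and> B r b \<noteq> B r' b}" if rr: "r \<in> I'" "r' \<in> I'" "r \<noteq> r'" for r r'
  proof -
    have eq: "f (e - 1) r = f (e - 1) r'" using rr unfolding I'_def by auto
    have "B r b = B r' b" if "z \<le> b" "b < e - 1" for b
      using fun_cong[OF eq, of b] that unfolding f_def by auto
    then have "{b. z \<le> b \<and> b < m \<and> B r b \<noteq> B r' b} \<subseteq> insert (e - 1) {b. e \<le> b \<and> b < m \<and> B r b \<noteq> B r' b}"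
      using ez by fastforce
    then have "card {b. z \<le> b \<and> b < m \<and> B r b \<noteq> B r' b} \<le> card (insert (e - 1) {b. e \<le> b \<and> b < m \<and> B r b \<noteq> B r' b})"
      by (intro card_mono) auto
    also have "\<dots> \<le> Suc (card {b. e \<le> b \<and> b < m \<and> B r b \<noteq> B r' b})" by (rule card_insert_le_m1) auto
    finally show ?thesis using Suc.prems(4)[of r r'] rr I'(3) by fastforce
  qed
  obtain x y where xy: "\<And>l. l < c \<Longrightarrow> e \<le> x l \<and> x l \<le> y l \<and> y l < m \<and> q \<le> card ((\<lambda>r. restrict (B r) {x l..y l}) ` I')"
    "\<And>l l'. l < c \<Longrightarrow> l' < c \<Longrightarrow> l < l' \<Longrightarrow> y l < x l'"
    using Suc.IH[OF I'(1) Suc.prems(2) I'(2) diff] by blast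
  define x' where "x' l = (case l of 0 \<Rightarrow> z | Suc l \<Rightarrow> x l)" for l
  define y' where "y' l = (case l of 0 \<Rightarrow> e - 1 | Suc l \<Rightarrow> y l)" for l
  have "z \<le> x' l \<and> x' l \<le> y' l \<and> y' l < m \<and> q \<le> card ((\<lambda>r. restrict (B r) {x' l..y' l}) ` I)" if "l < Suc c" for l
  proof (cases l)
    case 0
    have "{z..e - 1} = {z..<e}" using ez by auto
    then show ?thesis using 0 e ez unfolding x'_def y'_def f_def by auto
  next
    case (Suc k)
    have "card ((\<lambda>r. restrict (B r) {x k..y k}) ` I') \<le> card ((\<lambda>r. restrict (B r) {x k..y k}) ` I)"
      using Suc.prems(1) I'(3) by (intro card_mono) auto
    then show ?thesis using xy(1)[of k] that Suc ez unfolding x'_def y'_def by auto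
  qed
  moreover have "y' l < x' l'" if "l < l'" "l' < Suc c" for l l'
  proof (cases l)
    case 0
    then obtain k where "l' = Suc k" "k < c" using \<open>l < l'\<close> \<open>l' < Suc c\<close> by (cases l') auto
    then show ?thesis using xy(1)[of k] 0 ez unfolding x'_def y'_def by auto
  next
    case (Suc k)
    then obtain k' where "l' = Suc k'" "k' < c" "k < k'" using \<open>l < l'\<close> \<open>l' < Suc c\<close> by (cases l') auto
    then show ?thesis using xy(2)[of k k'] Suc unfolding x'_def y'_def by auto
  qed
  ultimately show ?case by blast
qed

section \<open>Ramsey's theorem for rows and columns\<close>

text \<open>The finite Ramsey theorem for pairs, with an arbitrary finite set of colours and with the
  homogeneous set given by its increasing enumeration.\<close>
lemma ramsey_pairs:
  fixes H :: nat
  assumes "finite (K :: 'c set)"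
  shows "\<exists>N. \<forall>col :: nat \<Rightarrow> nat \<Rightarrow> 'c. (\<forall>i j. i < j \<longrightarrow> j < N \<longrightarrow> col i j \<in> K) \<longrightarrow>
    (\<exists>f c. (\<forall>i<H. f i < N) \<and> (\<forall>i j. i < j \<longrightarrow> j < H \<longrightarrow> f i < f j) \<and>
       (\<forall>i j. i < j \<longrightarrow> j < H \<longrightarrow> col (f i) (f j) = c))"
proof -
  obtain e where e: "bij_betw e K {..<card K}"
    using assms by (metis atLeast0LessThan ex_bij_betw_finite_nat)
  obtain N :: nat where N: "partn_lst {..<N} (replicate (card K) H) 2"
    using ramsey_full by blast
  show ?thesis
  proof (rule exI[of _ N], intro allI impI)
    fix col :: "nat \<Rightarrow> nat \<Rightarrow> 'c"
    assume col: "\<forall>i j. i < j \<longrightarrow> j < N \<longrightarrow> col i j \<in> K"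
    define g where "g X = e (col (Min X) (Max X))" for X
    have pair: "Min {i, j} = i" "Max {i, j} = j" if "i < j" for i j :: nat using that by auto
    have "g X \<in> {..<card K}" if X: "X \<in> [{..<N}]\<^bsup>2\<^esup>" for X
    proof -
      obtain i j where "X = {i, j}" "i < j" "j < N" using X unfolding ordered_nsets_2_eq by auto
      then show ?thesis using col bij_betwE[OF e] unfolding g_def by (simp add: pair)
    qed
    then obtain c X where c: "c < card K" and X: "X \<in> [{..<N}]\<^bsup>H\<^esup>" "g ` [X]\<^bsup>2\<^esup> \<subseteq> {c}"
      using partn_lstE[OF N, of g "card K"] by (metis Pi_I length_replicate nth_replicate)
    have fX: "finite X" "card X = H" "X \<subseteq> {..<N}" using X(1) unfolding nsets_def by auto
    obtain f where f: "bij_betw f {..<card X} X" "strict_mono_on {..<card X} f"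
      using ex_bij_betw_strict_mono_card[OF fX(1)] .
    have fin: "f i \<in> X" if "i < H" for i using bij_betwE[OF f(1)] that fX(2) by auto
    have fm: "f i < f j" if "i < j" "j < H" for i j
      using strict_mono_onD[OF f(2)] that fX(2) by auto
    have fN: "f i < N" if "i < H" for i using fin[OF that] fX(3) by blast
    have "col (f i) (f j) = inv_into K e c" if "i < j" "j < H" for i j
    proof -
      have "{f i, f j} \<in> [X]\<^bsup>2\<^esup>" using fin fm that by (simp add: less_imp_neq)
      then have "e (col (f i) (f j)) = c" using X(2) fm[OF that] unfolding g_def
        by (metis (no_types, lifting) imageI pair singletonD subsetD)
      moreover have "col (f i) (f j) \<in> K"
        using col fm[OF that] fin[OF that(2)] fX(3) by auto
      ultimately show ?thesis using e by (metis bij_betw_inv_into_left)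
    qed
    then show "\<exists>f c. (\<forall>i<H. f i < N) \<and> (\<forall>i j. i < j \<longrightarrow> j < H \<longrightarrow> f i < f j) \<and>
       (\<forall>i j. i < j \<longrightarrow> j < H \<longrightarrow> col (f i) (f j) = c)"
      using fN fm by blast
  qed
qed

text \<open>Fix a large finite set of columns and colour a pair of rows by the whole colouring of the pairs of
  these columns. Ramsey's theorem for rows makes the colour independent of the rows, and a second
  application to the columns finishes.\<close>
lemma product_ramsey:
  fixes H :: nat
  assumes "finite (K :: 'c set)"
  shows "\<exists>N. \<forall>col :: nat \<Rightarrow> nat \<Rightarrow> nat \<Rightarrow> nat \<Rightarrow> 'c.
    (\<forall>i i' j j'. i < i' \<longrightarrow> i' < N \<longrightarrow> j < j' \<longrightarrow> j' < N \<longrightarrow> col i i' j j' \<in> K) \<longrightarrow>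
    (\<exists>f g c. (\<forall>i<H. f i < N \<and> g i < N) \<and> (\<forall>i j. i < j \<longrightarrow> j < H \<longrightarrow> f i < f j \<and> g i < g j) \<and>
       (\<forall>i i' j j'. i < i' \<longrightarrow> i' < H \<longrightarrow> j < j' \<longrightarrow> j' < H \<longrightarrow> col (f i) (f i') (g j) (g j') = c))"
proof -
  obtain M where M: "\<And>col :: nat \<Rightarrow> nat \<Rightarrow> 'c. (\<forall>i j. i < j \<longrightarrow> j < M \<longrightarrow> col i j \<in> K) \<Longrightarrow>
    (\<exists>f c. (\<forall>i<H. f i < M) \<and> (\<forall>i j. i < j \<longrightarrow> j < H \<longrightarrow> f i < f j) \<and>
       (\<forall>i j. i < j \<longrightarrow> j < H \<longrightarrow> col (f i) (f j) = c))"
    using ramsey_pairs[OF assms, of H] by blast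
  define J where "J = {(j, j'). j < j' \<and> j' < M}"
  have "finite J" by (rule finite_subset[of _ "{..<M} \<times> {..<M}"]) (auto simp: J_def)
  then have "finite (J \<rightarrow>\<^sub>E K)" using assms by (intro finite_PiE)
  \<comment> \<open>At least two rows are kept, so that the colour of a pair of columns is attained by a pair of rows.\<close>
  from ramsey_pairs[OF this, of "H + 2"] obtain N0 where
    N0: "\<And>col :: nat \<Rightarrow> nat \<Rightarrow> nat \<times> nat \<Rightarrow> 'c. (\<forall>i j. i < j \<longrightarrow> j < N0 \<longrightarrow> col i j \<in> J \<rightarrow>\<^sub>E K) \<Longrightarrow>
    (\<exists>f c. (\<forall>i<H+2. f i < N0) \<and> (\<forall>i j. i < j \<longrightarrow> j < H+2 \<longrightarrow> f i < f j) \<and>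
       (\<forall>i j. i < j \<longrightarrow> j < H+2 \<longrightarrow> col (f i) (f j) = c))"
    by blast
  show ?thesis
  proof (rule exI[of _ "max M N0"], intro allI impI)
    fix col :: "nat \<Rightarrow> nat \<Rightarrow> nat \<Rightarrow> nat \<Rightarrow> 'c"
    assume col: "\<forall>i i' j j'. i < i' \<longrightarrow> i' < max M N0 \<longrightarrow> j < j' \<longrightarrow> j' < max M N0 \<longrightarrow> col i i' j j' \<in> K"
    define rc where "rc i i' = restrict (\<lambda>(j, j'). col i i' j j') J" for i i'
    have "rc i i' \<in> J \<rightarrow>\<^sub>E K" if "i < i'" "i' < N0" for i i'
      using col that unfolding rc_def J_def by auto
    then obtain f c1 where f: "\<forall>i<H+2. f i < N0" "\<forall>i j. i < j \<longrightarrow> j < H+2 \<longrightarrow> f i < f j"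
      "\<forall>i j. i < j \<longrightarrow> j < H+2 \<longrightarrow> rc (f i) (f j) = c1"
      using N0[of rc] by blast
    have "f 0 < f 1" "f 1 < N0" "rc (f 0) (f 1) = c1" using f by auto
    then have "c1 (j, j') \<in> K" if "j < j'" "j' < M" for j j'
      using col that unfolding rc_def J_def by auto
    then obtain g c where g: "\<forall>i<H. g i < M" "\<forall>i j. i < j \<longrightarrow> j < H \<longrightarrow> g i < g j"
      "\<forall>i j. i < j \<longrightarrow> j < H \<longrightarrow> c1 (g i, g j) = c"
      using M[of "\<lambda>j j'. c1 (j, j')"] by blast
    have "col (f i) (f i') (g j) (g j') = c" if "i < i'" "i' < H" "j < j'" "j' < H" for i i' j j'
    proof -
      have "(g j, g j') \<in> J" using g that unfolding J_def by auto
      moreover have "rc (f i) (f i') = c1" using f(3) that by auto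
      ultimately have "col (f i) (f i') (g j) (g j') = c1 (g j, g j')"
        unfolding rc_def by (metis (no_types, lifting) case_prod_conv restrict_apply')
      then show ?thesis using g(3) that by auto
    qed
    then show "\<exists>f g c. (\<forall>i<H. f i < max M N0 \<and> g i < max M N0) \<and>
       (\<forall>i j. i < j \<longrightarrow> j < H \<longrightarrow> f i < f j \<and> g i < g j) \<and>
       (\<forall>i i' j j'. i < i' \<longrightarrow> i' < H \<longrightarrow> j < j' \<longrightarrow> j' < H \<longrightarrow> col (f i) (f i') (g j) (g j') = c)"
      using f g by (intro exI[of _ f] exI[of _ g] exI[of _ c]) (simp add: less_max_iff_disj)
  qed
qed

section \<open>Induced copies of the listed graphs\<close>

definition canonical :: "nat \<Rightarrow> nat rel \<Rightarrow> nat ograph" where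
  "canonical n E = \<lparr>verts = {..<n}, edges = E, ord = nat_ord {..<n}\<rparr>"

text \<open>Every ordered graph on \<open>n\<close> vertices is isomorphic to exactly one graph \<open>canonical n E\<close>, so the
  slice represents the members on \<open>n\<close> vertices up to isomorphism.\<close>
definition slice :: "nat ograph set \<Rightarrow> nat \<Rightarrow> nat rel set" where
  "slice C n = {E. canonical n E \<in> C}"

lemma linear_order_nat_ord: "linear_order_on V (nat_ord V)"
  unfolding linear_order_on_def partial_order_on_def preorder_on_def refl_on_def trans_def
    antisym_def total_on_def nat_ord_def by auto

lemma ordered_graph_nat:
  "ordered_graph \<lparr>verts = V, edges = E, ord = nat_ord V\<rparr> \<longleftrightarrow>
     finite V \<and> E \<subseteq> V \<times> V \<and> sym E \<and> irrefl E"
  by (simp add: ordered_graph_def linear_order_nat_ord)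

text \<open>All memberships in hereditary classes are obtained from increasing maps that preserve adjacency.\<close>
lemma hereditary_embed:
  assumes "hereditary C" "G \<in> C" "ord G = nat_ord (verts G)"
    and H: "ordered_graph H" "ord H = nat_ord (verts H)"
    and f: "\<And>u. u \<in> verts H \<Longrightarrow> f u \<in> verts G"
      "\<And>u v. u \<in> verts H \<Longrightarrow> v \<in> verts H \<Longrightarrow> u < v \<Longrightarrow> f u < f v"
      "\<And>u v. u \<in> verts H \<Longrightarrow> v \<in> verts H \<Longrightarrow> u < v \<Longrightarrow> (u, v) \<in> edges H \<longleftrightarrow> (f u, f v) \<in> edges G"
  shows "H \<in> C"
proof -
  have G: "ordered_graph G" using assms(1,2) unfolding hereditary_def by blast
  let ?I = "induced G (f ` verts H)"
  have "?I \<in> C" using assms(1,2) f(1) unfolding hereditary_def by blast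
  have inj: "inj_on f (verts H)"
    by (rule inj_onI) (metis f(2) less_irrefl linorder_neqE_nat)
  have ed: "(u, v) \<in> edges H \<longleftrightarrow> (f u, f v) \<in> edges G" if "u \<in> verts H" "v \<in> verts H" for u v
  proof -
    have s: "sym (edges H)" "irrefl (edges H)" "sym (edges G)" "irrefl (edges G)"
      using H(1) G unfolding ordered_graph_def by auto
    consider "u < v" | "u = v" | "v < u" by linarith
    then show ?thesis
      using f(3)[of u v] f(3)[of v u] that s by cases (auto simp: sym_def irrefl_def)
  qed
  have od: "u \<le> v \<longleftrightarrow> f u \<le> f v" if "u \<in> verts H" "v \<in> verts H" for u v
    using f(2)[of u v] f(2)[of v u] that by (cases u v rule: linorder_cases) auto
  have "H \<cong>\<^sub>o ?I"
    unfolding ograph_iso_def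
  proof (intro exI[of _ f] conjI ballI)
    show "bij_betw f (verts H) (verts ?I)" using inj by (simp add: induced_def bij_betw_def)
    fix u v assume uv: "u \<in> verts H" "v \<in> verts H"
    show "(u, v) \<in> edges H \<longleftrightarrow> (f u, f v) \<in> edges ?I" using ed[OF uv] uv by (simp add: induced_def)
    show "(u, v) \<in> ord H \<longleftrightarrow> (f u, f v) \<in> ord ?I"
      using od[OF uv] uv f(1) by (simp add: induced_def H(2) assms(3) nat_ord_def)
  qed
  then show ?thesis using \<open>?I \<in> C\<close> assms(1) H(1) unfolding hereditary_def by blast
qed

lemma M_graph_simps:
  "verts (M_graph s lam rho n \<sigma>) = {1..2 * n}"
  "ord (M_graph s lam rho n \<sigma>) = nat_ord {1..2 * n}"
  by (simp_all add: M_graph_def Let_def)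

lemma M_graph_edges:
  "edges (M_graph s lam rho n \<sigma>) =
     (let E = {(i, n + j) | i j. i \<in> {1..n} \<and> j \<in> {1..n} \<and> cross_adj s \<sigma> i j} \<union>
              {(i, i') | i i'. lam \<and> i \<in> {1..n} \<and> i' \<in> {1..n} \<and> i \<noteq> i'} \<union>
              {(n + j, n + j') | j j'. rho \<and> j \<in> {1..n} \<and> j' \<in> {1..n} \<and> j \<noteq> j'}
      in E \<union> E\<inverse>)"
  by (simp add: M_graph_def Let_def)

lemma M_graph_edge_iff:
  assumes "i \<in> {1..n}" "j \<in> {1..n}"
  shows "(i, n + j) \<in> edges (M_graph s lam rho n \<sigma>) \<longleftrightarrow> cross_adj s \<sigma> i j"
    "i \<noteq> j \<Longrightarrow> (i, j) \<in> edges (M_graph s lam rho n \<sigma>) \<longleftrightarrow> lam"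
    "i \<noteq> j \<Longrightarrow> (n + i, n + j) \<in> edges (M_graph s lam rho n \<sigma>) \<longleftrightarrow> rho"
  using assms unfolding M_graph_edges Let_def by (auto simp del: cross_adj.simps)

lemma ordered_graph_M_graph: "ordered_graph (M_graph s lam rho n \<sigma>)"
proof -
  have "edges (M_graph s lam rho n \<sigma>) \<subseteq> {1..2*n} \<times> {1..2*n}"
    unfolding M_graph_edges Let_def by (auto simp del: cross_adj.simps)
  moreover have "sym (edges (M_graph s lam rho n \<sigma>))"
    unfolding M_graph_edges Let_def by (simp add: sym_Un_converse)
  moreover have "irrefl (edges (M_graph s lam rho n \<sigma>))"
    unfolding M_graph_edges Let_def irrefl_def by (auto simp del: cross_adj.simps)
  ultimately show ?thesis
    by (simp add: ordered_graph_def M_graph_simps linear_order_nat_ord)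
qed

lemma permutation_ograph_simps:
  "verts (permutation_ograph n \<pi>) = {1..n}"
  "ord (permutation_ograph n \<pi>) = nat_ord {1..n}"
  by (simp_all add: permutation_ograph_def Let_def)

lemma permutation_ograph_edge_iff:
  assumes "i \<in> {1..n}" "j \<in> {1..n}" "i < j"
  shows "(i, j) \<in> edges (permutation_ograph n \<pi>) \<longleftrightarrow> \<pi> j < \<pi> i"
  using assms by (auto simp: permutation_ograph_def Let_def)

lemma ordered_graph_permutation_ograph: "ordered_graph (permutation_ograph n \<pi>)"
  unfolding ordered_graph_def permutation_ograph_simps
  by (auto simp: permutation_ograph_def Let_def linear_order_nat_ord sym_Un_converse irrefl_def)

text \<open>The sizes are bounded by \<open>h\<close> because Ramsey arguments produce one large finite structure at a time.
  There are finitely many listed classes, so letting \<open>h\<close> grow yields an entire class.\<close>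
definition contains_M :: "nat ograph set \<Rightarrow> rel_symbol \<Rightarrow> bool \<Rightarrow> bool \<Rightarrow> nat \<Rightarrow> bool" where
  "contains_M C s lam rho h \<longleftrightarrow>
     (\<forall>k\<le>h. \<forall>\<sigma>. \<sigma> permutes {1..k} \<longrightarrow> M_graph s lam rho k \<sigma> \<in> C)"

definition contains_P :: "nat ograph set \<Rightarrow> nat \<Rightarrow> bool" where
  "contains_P C h \<longleftrightarrow> (\<forall>k\<le>h. \<forall>\<pi>. \<pi> permutes {1..k} \<longrightarrow> permutation_ograph k \<pi> \<in> C)"

definition contains_listed :: "nat ograph set \<Rightarrow> nat \<Rightarrow> bool" where
  "contains_listed C h \<longleftrightarrow> contains_P C h \<or> (\<exists>s lam rho. contains_M C s lam rho h)"

text \<open>Exchanging the two sides of a graph \<open>M_graph s lam rho k \<sigma>\<close> replaces \<open>\<sigma>\<close> by its inverse and \<open>s\<close> by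
  its transpose.\<close>
fun transpose_symbol :: "rel_symbol \<Rightarrow> rel_symbol" where
  "transpose_symbol S_eq = S_eq"
| "transpose_symbol S_neq = S_neq"
| "transpose_symbol S_le_l = S_le_r"
| "transpose_symbol S_ge_l = S_ge_r"
| "transpose_symbol S_le_r = S_le_l"
| "transpose_symbol S_ge_r = S_ge_l"

lemma cross_adj_transpose:
  assumes "\<sigma> permutes S"
  shows "cross_adj (transpose_symbol s) (inv \<sigma>) i j \<longleftrightarrow> cross_adj s \<sigma> j i"
proof -
  have "inv \<sigma> i = j \<longleftrightarrow> \<sigma> j = i" using permutes_inverses[OF assms] by auto
  then show ?thesis using permutes_inv_inv[OF assms] by (cases s) auto
qed

locale host =
  fixes C :: "nat ograph set" and n :: nat and E :: "nat rel"
  assumes hereditary: "hereditary C" and in_slice: "E \<in> slice C n"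
begin

lemma sym_E: "(u, v) \<in> E \<longleftrightarrow> (v, u) \<in> E"
  using hereditary in_slice
  unfolding hereditary_def slice_def ordered_graph_def canonical_def sym_def by fastforce

lemma embed_permutation_graph:
  assumes v: "\<And>i. i \<in> {1..k} \<Longrightarrow> v i < n"
    "\<And>i j. i \<in> {1..k} \<Longrightarrow> j \<in> {1..k} \<Longrightarrow> i < j \<Longrightarrow> v i < v j"
    "\<And>i j. i \<in> {1..k} \<Longrightarrow> j \<in> {1..k} \<Longrightarrow> i < j \<Longrightarrow> (v i, v j) \<in> E \<longleftrightarrow> \<pi> j < \<pi> i"
  shows "permutation_ograph k \<pi> \<in> C"
  by (rule hereditary_embed[OF hereditary, of "canonical n E", where f = v])
    (use in_slice v in \<open>auto simp: slice_def canonical_def ordered_graph_permutation_ograph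
      permutation_ograph_simps permutation_ograph_edge_iff\<close>)

text \<open>The relative order of the vertices \<open>a i\<close> and \<open>b j\<close> is left open: a grid in an ordered graph may put
  either side first, and then the transposed pattern is the one that occurs as an induced subgraph.\<close>

definition bipattern :: "(nat \<Rightarrow> nat) \<Rightarrow> (nat \<Rightarrow> nat) \<Rightarrow> rel_symbol \<Rightarrow> bool \<Rightarrow> bool \<Rightarrow> nat \<Rightarrow> (nat \<Rightarrow> nat) \<Rightarrow> bool" where
  "bipattern a b s lam rho k \<sigma> \<longleftrightarrow>
     (\<forall>i\<in>{1..k}. a i < n \<and> b i < n) \<and>
     (\<forall>i\<in>{1..k}. \<forall>j\<in>{1..k}. i < j \<longrightarrow> a i < a j \<and> b i < b j \<and>
        ((a i, a j) \<in> E \<longleftrightarrow> lam) \<and> ((b i, b j) \<in> E \<longleftrightarrow> rho)) \<and>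
     (\<forall>i\<in>{1..k}. \<forall>j\<in>{1..k}. (a i, b j) \<in> E \<longleftrightarrow> cross_adj s \<sigma> i j)"

lemma embed_M_graph:
  assumes p: "bipattern a b s lam rho k \<sigma>"
    and ab: "\<And>i j. i \<in> {1..k} \<Longrightarrow> j \<in> {1..k} \<Longrightarrow> a i < b j"
  shows "M_graph s lam rho k \<sigma> \<in> C"
proof -
  define f where "f u = (if u \<le> k then a u else b (u - k))" for u
  have f_bound: "f u < n" if "u \<in> {1..2 * k}" for u
  proof (cases "u \<le> k")
    case False
    then have "u - k \<in> {1..k}" using that by (simp, linarith)
    then show ?thesis using False p unfolding bipattern_def f_def by auto
  qed (use that p in \<open>auto simp: bipattern_def f_def\<close>)
  show ?thesis
  proof (rule hereditary_embed[OF hereditary, of "canonical n E", where f = f])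
    fix u v assume uv: "u \<in> verts (M_graph s lam rho k \<sigma>)" "v \<in> verts (M_graph s lam rho k \<sigma>)" "u < v"
    then have r: "u \<in> {1..2 * k}" "v \<in> {1..2 * k}" by (simp_all add: M_graph_simps)
    have low: "w \<in> {1..k}" if "w \<in> {1..2 * k}" "w \<le> k" for w using that by auto
    have high: "w = k + (w - k) \<and> w - k \<in> {1..k} \<and> k < w" if "w \<in> {1..2 * k}" "\<not> w \<le> k" for w
      using that by (simp, linarith)
    consider (aa) "u \<in> {1..k}" "v \<in> {1..k}"
      | (bb) "u = k + (u - k)" "v = k + (v - k)" "u - k \<in> {1..k}" "v - k \<in> {1..k}" "k < u" "k < v"
      | (ab) "u \<in> {1..k}" "v = k + (v - k)" "v - k \<in> {1..k}" "k < v"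
      using low[OF r(1)] low[OF r(2)] high[OF r(1)] high[OF r(2)] uv(3) by linarith
    note cs = this
    from cs show "f u < f v"
      using p ab uv(3) unfolding bipattern_def f_def by cases auto
    from cs show "(u, v) \<in> edges (M_graph s lam rho k \<sigma>) \<longleftrightarrow> (f u, f v) \<in> edges (canonical n E)"
    proof cases
      case aa
      then show ?thesis using p uv(3) M_graph_edge_iff(2)[of u k v]
        by (simp add: canonical_def f_def bipattern_def)
    next
      case bb
      have "(u, v) \<in> edges (M_graph s lam rho k \<sigma>) \<longleftrightarrow> rho"
        using M_graph_edge_iff(3)[OF bb(3,4), of s lam rho \<sigma>] bb(1,2) uv(3) by (metis less_irrefl)
      then show ?thesis using p bb uv(3) by (simp add: canonical_def f_def bipattern_def)
    next
      case ab
      have "(u, v) \<in> edges (M_graph s lam rho k \<sigma>) \<longleftrightarrow> cross_adj s \<sigma> u (v - k)"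
        using M_graph_edge_iff(1)[OF ab(1,3), of s lam rho \<sigma>] ab(2) by simp
      then show ?thesis using p ab by (simp add: canonical_def f_def bipattern_def)
    qed
  qed (use in_slice f_bound in \<open>auto simp: slice_def canonical_def ordered_graph_M_graph M_graph_simps\<close>)
qed

lemma contains_M_of_bipatterns:
  assumes "\<And>k \<sigma>. k \<le> h \<Longrightarrow> \<sigma> permutes {1..k} \<Longrightarrow> \<exists>a b. bipattern a b s lam rho k \<sigma> \<and>
      (\<forall>i\<in>{1..k}. \<forall>j\<in>{1..k}. a i < b j)"
  shows "contains_M C s lam rho h"
  unfolding contains_M_def using assms embed_M_graph by blast

lemma contains_M_of_bipatterns_transposed:
  assumes "\<And>k \<sigma>. k \<le> h \<Longrightarrow> \<sigma> permutes {1..k} \<Longrightarrow> \<exists>a b. bipattern a b s lam rho k \<sigma> \<and>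
      (\<forall>i\<in>{1..k}. \<forall>j\<in>{1..k}. b j < a i)"
  shows "contains_M C (transpose_symbol s) rho lam h"
proof (rule contains_M_of_bipatterns)
  fix k \<sigma> assume k: "k \<le> h" and \<sigma>: "\<sigma> permutes {1..k}"
  have \<sigma>': "inv \<sigma> permutes {1..k}" using \<sigma> by (rule permutes_inv)
  obtain a b where ab: "bipattern a b s lam rho k (inv \<sigma>)" "\<forall>i\<in>{1..k}. \<forall>j\<in>{1..k}. b j < a i"
    using assms[OF k \<sigma>'] by blast
  have "cross_adj s (inv \<sigma>) j i \<longleftrightarrow> cross_adj (transpose_symbol s) \<sigma> i j" for i j
    using cross_adj_transpose[OF \<sigma>', of s i j] permutes_inv_inv[OF \<sigma>] by simp
  then have "bipattern b a (transpose_symbol s) rho lam k \<sigma>"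
    using ab(1) sym_E unfolding bipattern_def by metis
  then show "\<exists>a b. bipattern a b (transpose_symbol s) rho lam k \<sigma> \<and> (\<forall>i\<in>{1..k}. \<forall>j\<in>{1..k}. a i < b j)"
    using ab(2) by blast
qed

end

section \<open>Homogeneous grids of vertices\<close>

text \<open>Each point \<open>(i, j)\<close> of an \<open>H\<close> by \<open>H\<close> grid carries vertices \<open>u x i j\<close> and \<open>w x i j\<close> for all labels
  \<open>x < k\<close>. The vertices \<open>u\<close> follow the order of the rows and the vertices \<open>w\<close> that of the columns,
  whatever the other coordinate and the label are.\<close>
locale labelled_grid = host +
  fixes k H :: nat and u w :: "nat \<Rightarrow> nat \<Rightarrow> nat \<Rightarrow> nat"
  assumes u_bound: "\<And>x i j. x < k \<Longrightarrow> i < H \<Longrightarrow> j < H \<Longrightarrow> u x i j < n"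
    and w_bound: "\<And>x i j. x < k \<Longrightarrow> i < H \<Longrightarrow> j < H \<Longrightarrow> w x i j < n"
    and u_mono: "\<And>x x' i i' j j'. x < k \<Longrightarrow> x' < k \<Longrightarrow> i < i' \<Longrightarrow> i' < H \<Longrightarrow> j < H \<Longrightarrow> j' < H \<Longrightarrow>
      u x i j < u x' i' j'"
    and w_mono: "\<And>x x' i i' j j'. x < k \<Longrightarrow> x' < k \<Longrightarrow> j < j' \<Longrightarrow> j' < H \<Longrightarrow> i < H \<Longrightarrow> i' < H \<Longrightarrow>
      w x i j < w x' i' j'"

definition grid_precedes where
  "grid_precedes k H u w \<longleftrightarrow>
     (\<forall>x<k. \<forall>y<k. \<forall>i<H. \<forall>i'<H. \<forall>j<H. \<forall>j'<H. (u x i j :: nat) < w y i' j')"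
  for k H :: nat and u w :: "nat \<Rightarrow> nat \<Rightarrow> nat \<Rightarrow> nat"

text \<open>Adjacency depends on the labels and on the relative position of the two points only; \<open>\<Delta>\<close> describes the
  vertices at one point. A permutation chooses points in distinct rows and columns, so two points that
  share just one coordinate never matter.\<close>
locale homogeneous_grid = labelled_grid +
  fixes FU FW :: "nat \<Rightarrow> nat \<Rightarrow> bool \<Rightarrow> bool"
    and Q :: "nat \<Rightarrow> nat \<Rightarrow> bool \<Rightarrow> bool \<Rightarrow> bool" and \<Delta> :: "nat \<Rightarrow> nat \<Rightarrow> bool"
  assumes separated: "grid_precedes k H u w \<or> grid_precedes k H w u"
    and FU: "\<And>x x' i i' j j'. x < k \<Longrightarrow> x' < k \<Longrightarrow> i < i' \<Longrightarrow> i' < H \<Longrightarrow> j < H \<Longrightarrow> j' < H \<Longrightarrow> j \<noteq> j' \<Longrightarrow>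
      (u x i j, u x' i' j') \<in> E \<longleftrightarrow> FU x x' (j < j')"
    and FW: "\<And>y y' i i' j j'. y < k \<Longrightarrow> y' < k \<Longrightarrow> j < j' \<Longrightarrow> j' < H \<Longrightarrow> i < H \<Longrightarrow> i' < H \<Longrightarrow> i \<noteq> i' \<Longrightarrow>
      (w y i j, w y' i' j') \<in> E \<longleftrightarrow> FW y y' (i < i')"
    and Q: "\<And>x y i i' j j'. x < k \<Longrightarrow> y < k \<Longrightarrow> i < H \<Longrightarrow> i' < H \<Longrightarrow> j < H \<Longrightarrow> j' < H \<Longrightarrow> i \<noteq> i' \<Longrightarrow> j \<noteq> j' \<Longrightarrow>
      (u x i j, w y i' j') \<in> E \<longleftrightarrow> Q x y (i < i') (j < j')"
    and \<Delta>: "\<And>x y i j. x < k \<Longrightarrow> y < k \<Longrightarrow> i < H \<Longrightarrow> j < H \<Longrightarrow> (u x i j, w y i j) \<in> E \<longleftrightarrow> \<Delta> x y"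
begin

text \<open>Reflecting the grid exchanges the roles of \<open>u\<close> and \<open>w\<close>, which halves the case distinctions below.\<close>
lemma transposed_grid:
  "homogeneous_grid C n E k H (\<lambda>x i j. w x j i) (\<lambda>x i j. u x j i) FW FU
     (\<lambda>x y \<alpha> \<beta>. Q y x (\<not> \<beta>) (\<not> \<alpha>)) (\<lambda>x y. \<Delta> y x)"
proof unfold_locales
  show "grid_precedes k H (\<lambda>x i j. w x j i) (\<lambda>x i j. u x j i) \<or>
    grid_precedes k H (\<lambda>x i j. u x j i) (\<lambda>x i j. w x j i)"
    using separated unfolding grid_precedes_def by blast
  fix x y i i' j j' assume *: "x < k" "y < k" "i < H" "i' < H" "j < H" "j' < H" "i \<noteq> i'" "j \<noteq> j'"
  have "(w x j i, u y j' i') \<in> E \<longleftrightarrow> Q y x (j' < j) (i' < i)"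
    using Q[of y x j' j i' i] sym_E * by blast
  moreover have "(j' < j) = (\<not> j < j')" "(i' < i) = (\<not> i < i')" using * by auto
  ultimately show "(w x j i, u y j' i') \<in> E \<longleftrightarrow> Q y x (\<not> j < j') (\<not> i < i')" by simp
next
  fix x y i j assume "x < k" "y < k" "i < H" "j < H"
  then show "(w x j i, u y j i) \<in> E \<longleftrightarrow> \<Delta> y x" using \<Delta> sym_E by blast
qed (use u_bound w_bound u_mono w_mono FU FW in simp_all)

text \<open>Take the point in column \<open>\<pi> i\<close> of row \<open>i\<close>: the vertices \<open>u\<close> are ordered by \<open>i\<close>, and their adjacency
  depends on the order of the values of \<open>\<pi>\<close>. If it marks the pairs in order instead of the inversions,
  reverse the columns.\<close>
lemma contains_P_if_FU_nonconstant:
  assumes x: "x < k" and F: "FU x x True \<noteq> FU x x False" and h: "h + 2 \<le> H"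
  shows "contains_P C h"
  unfolding contains_P_def
proof (intro allI impI)
  fix m \<pi> assume m: "m \<le> h" and \<pi>: "\<pi> permutes {1..m}"
  have r: "\<pi> i \<in> {1..m}" if "i \<in> {1..m}" for i using permutes_in_image[OF \<pi>] that by blast
  have inj: "\<pi> i \<noteq> \<pi> j" if "i \<noteq> j" for i j using permutes_inj[OF \<pi>] that by (auto dest: injD)
  define col where "col i = (if FU x x True then m + 1 - \<pi> i else \<pi> i)" for i
  have col: "col i < H" "i < H" if "i \<in> {1..m}" for i using r[OF that] m h that unfolding col_def by auto
  show "permutation_ograph m \<pi> \<in> C"
  proof (rule embed_permutation_graph[of m "\<lambda>i. u x i (col i)"])
    fix i j assume ij: "i \<in> {1..m}" "j \<in> {1..m}" "i < j"
    show "u x i (col i) < u x j (col j)" using u_mono x ij col by auto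
    have c: "col i \<noteq> col j" "col i < col j \<longleftrightarrow> (if FU x x True then \<pi> j < \<pi> i else \<pi> i < \<pi> j)"
      using inj[of i j] ij(3) r[OF ij(1)] r[OF ij(2)] unfolding col_def by auto
    have "(u x i (col i), u x j (col j)) \<in> E \<longleftrightarrow> FU x x (col i < col j)"
      using FU[OF x x ij(3)] col ij c(1) by blast
    also have "\<dots> \<longleftrightarrow> \<pi> j < \<pi> i"
      using F c(2) inj[of i j] ij(3) by (cases "FU x x True"; cases "col i < col j") auto
    finally show "(u x i (col i), u x j (col j)) \<in> E \<longleftrightarrow> \<pi> j < \<pi> i" .
  qed (use u_bound x col in auto)
qed

lemma contains_M_of_patterns:
  assumes "0 < k" "0 < H"
    "\<And>m \<sigma>. m \<le> h \<Longrightarrow> \<sigma> permutes {1..m} \<Longrightarrow> \<exists>xa ia ja yb ib jb.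
       bipattern (\<lambda>i. u (xa i) (ia i) (ja i)) (\<lambda>j. w (yb j) (ib j) (jb j)) s lam rho m \<sigma> \<and>
       (\<forall>i\<in>{1..m}. xa i < k \<and> ia i < H \<and> ja i < H \<and> yb i < k \<and> ib i < H \<and> jb i < H)"
  shows "\<exists>s lam rho. contains_M C s lam rho h"
  using separated
proof
  assume sep: "grid_precedes k H u w"
  have "contains_M C s lam rho h"
  proof (rule contains_M_of_bipatterns)
    fix m \<sigma> assume "m \<le> h" "\<sigma> permutes {1..m}"
    from assms(3)[OF this] show "\<exists>a b. bipattern a b s lam rho m \<sigma> \<and> (\<forall>i\<in>{1..m}. \<forall>j\<in>{1..m}. a i < b j)"
      using sep unfolding grid_precedes_def by meson
  qed
  then show ?thesis by blast
next
  assume sep: "grid_precedes k H w u"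
  have "contains_M C (transpose_symbol s) rho lam h"
  proof (rule contains_M_of_bipatterns_transposed)
    fix m \<sigma> assume "m \<le> h" "\<sigma> permutes {1..m}"
    from assms(3)[OF this] show "\<exists>a b. bipattern a b s lam rho m \<sigma> \<and> (\<forall>i\<in>{1..m}. \<forall>j\<in>{1..m}. b j < a i)"
      using sep unfolding grid_precedes_def by meson
  qed
  then show ?thesis by blast
qed

text \<open>Put the rows of the vertices \<open>u\<close> and those of the vertices \<open>w\<close> on different sides, so that the first
  argument of \<open>Q\<close> is always \<open>\<alpha>\<close>. The columns are then free to interleave: \<open>u\<close> uses the even columns
  \<open>2 * \<sigma> i\<close> and \<open>w\<close> the odd columns next to \<open>2 * j\<close>, on the side that decides the case \<open>\<sigma> i = j\<close> as
  the symbol demands.\<close>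
lemma contains_M_if_Q_varies_with_column:
  assumes x: "x < k" and y: "y < k" and FUc: "FU x x True = FU x x False"
    and FWc: "FW y y True = FW y y False" and Qv: "Q x y \<alpha> True \<noteq> Q x y \<alpha> False"
    and h: "2 * h + 2 \<le> H"
  shows "\<exists>s lam rho. contains_M C s lam rho h"
proof (rule contains_M_of_patterns[where s = "if Q x y \<alpha> True then S_ge_r else S_le_r"
      and lam = "FU x x True" and rho = "FW y y True"])
  fix m \<sigma> assume m: "m \<le> h" and \<sigma>: "\<sigma> permutes {1..m}"
  have r: "\<sigma> i \<in> {1..m}" if "i \<in> {1..m}" for i using permutes_in_image[OF \<sigma>] that by blast
  have inj: "\<sigma> i \<noteq> \<sigma> j" if "i \<noteq> j" for i j using permutes_inj[OF \<sigma>] that by (auto dest: injD)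
  define ia where "ia i = (if \<alpha> then i else m + i)" for i
  define ib where "ib i = (if \<alpha> then m + i else i)" for i
  define jb where "jb j = (if Q x y \<alpha> True then 2 * j + 1 else 2 * j - 1)" for j :: nat
  have bd: "ia i < H \<and> 2 * \<sigma> i < H \<and> ib i < H \<and> jb i < H" if "i \<in> {1..m}" for i
    using that r[OF that] m h unfolding ia_def ib_def jb_def by auto
  have FU': "FU x x b = FU x x True" for b using FUc by (cases b) auto
  have FW': "FW y y b = FW y y True" for b using FWc by (cases b) auto
  have mo: "ia i < ia j" "ib i < ib j" "jb i < jb j" if "i < j" "i \<in> {1..m}" for i j
    using that unfolding ia_def ib_def jb_def by auto
  have "bipattern (\<lambda>i. u x (ia i) (2 * \<sigma> i)) (\<lambda>j. w y (ib j) (jb j))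
      (if Q x y \<alpha> True then S_ge_r else S_le_r) (FU x x True) (FW y y True) m \<sigma>"
    unfolding bipattern_def
  proof (intro conjI ballI impI)
    fix i assume i: "i \<in> {1..m}"
    show "u x (ia i) (2 * \<sigma> i) < n" "w y (ib i) (jb i) < n" using u_bound w_bound x y bd[OF i] by auto
    fix j assume j: "j \<in> {1..m}"
    {
      assume ij: "i < j"
      note b = bd[OF i] bd[OF j] and mm = mo[OF ij i]
      show "u x (ia i) (2 * \<sigma> i) < u x (ia j) (2 * \<sigma> j)" using u_mono x b mm by blast
      show "w y (ib i) (jb i) < w y (ib j) (jb j)" using w_mono y b mm by blast
      have "2 * \<sigma> i \<noteq> 2 * \<sigma> j" using inj[of i j] ij by auto
      then show "(u x (ia i) (2 * \<sigma> i), u x (ia j) (2 * \<sigma> j)) \<in> E \<longleftrightarrow> FU x x True"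
        using FU[OF x x mm(1)] b FU' by blast
      show "(w y (ib i) (jb i), w y (ib j) (jb j)) \<in> E \<longleftrightarrow> FW y y True"
        using FW[OF y y mm(3)] b mm(2) FW' by (metis less_irrefl)
    }
    have rel: "(ia i < ib j) = \<alpha>" "ia i \<noteq> ib j" using i j unfolding ia_def ib_def by auto
    have ne: "2 * \<sigma> i \<noteq> jb j"
    proof -
      have "odd (jb j)" using j unfolding jb_def by auto
      then show ?thesis by (metis dvd_triv_left)
    qed
    have "(u x (ia i) (2 * \<sigma> i), w y (ib j) (jb j)) \<in> E \<longleftrightarrow> Q x y \<alpha> (2 * \<sigma> i < jb j)"
      using Q[OF x y, of "ia i" "ib j" "2 * \<sigma> i" "jb j"] bd[OF i] bd[OF j] rel ne by simp
    also have "\<dots> \<longleftrightarrow> cross_adj (if Q x y \<alpha> True then S_ge_r else S_le_r) \<sigma> i j"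
    proof (cases "Q x y \<alpha> True")
      case True
      then have "2 * \<sigma> i < jb j \<longleftrightarrow> \<sigma> i \<le> j" unfolding jb_def by auto
      then show ?thesis using True Qv by (cases "\<sigma> i \<le> j") auto
    next
      case False
      then have "2 * \<sigma> i < jb j \<longleftrightarrow> \<not> j \<le> \<sigma> i" using j unfolding jb_def by auto
      then show ?thesis using False Qv by (cases "j \<le> \<sigma> i") auto
    qed
    finally show "(u x (ia i) (2 * \<sigma> i), w y (ib j) (jb j)) \<in> E \<longleftrightarrow>
        cross_adj (if Q x y \<alpha> True then S_ge_r else S_le_r) \<sigma> i j" .
  qed
  then show "\<exists>xa ia ja yb ib jb.
       bipattern (\<lambda>i. u (xa i) (ia i) (ja i)) (\<lambda>j. w (yb j) (ib j) (jb j))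
         (if Q x y \<alpha> True then S_ge_r else S_le_r) (FU x x True) (FW y y True) m \<sigma> \<and>
       (\<forall>i\<in>{1..m}. xa i < k \<and> ia i < H \<and> ja i < H \<and> yb i < k \<and> ib i < H \<and> jb i < H)"
    using bd x y by - (rule exI[of _ "\<lambda>i. x"], rule exI[of _ ia], rule exI[of _ "\<lambda>i. 2 * \<sigma> i"],
      rule exI[of _ "\<lambda>i. y"], rule exI[of _ ib], rule exI[of _ jb], blast)
qed (use x h in auto)

text \<open>The points \<open>(i, \<sigma> i)\<close> provide both the vertices \<open>u\<close> and the vertices \<open>w\<close>. Two of them are the same
  point exactly where \<open>\<sigma> i = j\<close>, and only there the adjacency is \<open>\<Delta> x y\<close>.\<close>
lemma contains_M_if_diagonal_differs:
  assumes x: "x < k" and y: "y < k" and FUc: "FU x x True = FU x x False"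
    and FWc: "FW y y True = FW y y False" and Qc: "\<And>\<alpha> \<beta>. Q x y \<alpha> \<beta> \<noteq> \<Delta> x y"
    and h: "2 * h + 2 \<le> H"
  shows "\<exists>s lam rho. contains_M C s lam rho h"
proof (rule contains_M_of_patterns[where s = "if \<Delta> x y then S_eq else S_neq"
      and lam = "FU x x True" and rho = "FW y y True"])
  fix m \<sigma> assume m: "m \<le> h" and \<sigma>: "\<sigma> permutes {1..m}"
  have \<sigma>': "inv \<sigma> permutes {1..m}" using \<sigma> by (rule permutes_inv)
  have r: "\<sigma> i \<in> {1..m}" "inv \<sigma> i \<in> {1..m}" if "i \<in> {1..m}" for i
    using permutes_in_image[OF \<sigma>] permutes_in_image[OF \<sigma>'] that by blast+
  have inj: "\<sigma> i \<noteq> \<sigma> j" "inv \<sigma> i \<noteq> inv \<sigma> j" if "i \<noteq> j" for i j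
    using permutes_inj[OF \<sigma>] permutes_inj[OF \<sigma>'] that by (auto dest: injD)
  have bd: "i < H \<and> \<sigma> i < H \<and> inv \<sigma> i < H" if "i \<in> {1..m}" for i
    using that r[OF that] m h by auto
  have FU': "FU x x b = FU x x True" for b using FUc by (cases b) auto
  have FW': "FW y y b = FW y y True" for b using FWc by (cases b) auto
  have "bipattern (\<lambda>i. u x i (\<sigma> i)) (\<lambda>j. w y (inv \<sigma> j) j)
      (if \<Delta> x y then S_eq else S_neq) (FU x x True) (FW y y True) m \<sigma>"
    unfolding bipattern_def
  proof (intro conjI ballI impI)
    fix i assume i: "i \<in> {1..m}"
    show "u x i (\<sigma> i) < n" "w y (inv \<sigma> i) i < n" using u_bound w_bound x y bd[OF i] by auto
    fix j assume j: "j \<in> {1..m}"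
    note b = bd[OF i] bd[OF j]
    {
      assume ij: "i < j"
      then have ne: "\<sigma> i \<noteq> \<sigma> j" "inv \<sigma> i \<noteq> inv \<sigma> j" using inj[of i j] by auto
      show "u x i (\<sigma> i) < u x j (\<sigma> j)" using u_mono x b ij by blast
      show "w y (inv \<sigma> i) i < w y (inv \<sigma> j) j" using w_mono y b ij by blast
      show "(u x i (\<sigma> i), u x j (\<sigma> j)) \<in> E \<longleftrightarrow> FU x x True"
        using FU[OF x x ij] b FU' ne by blast
      show "(w y (inv \<sigma> i) i, w y (inv \<sigma> j) j) \<in> E \<longleftrightarrow> FW y y True"
        using FW[OF y y ij] b ne FW' by blast
    }
    show "(u x i (\<sigma> i), w y (inv \<sigma> j) j) \<in> E \<longleftrightarrow> cross_adj (if \<Delta> x y then S_eq else S_neq) \<sigma> i j"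
    proof (cases "\<sigma> i = j")
      case True
      then have "inv \<sigma> j = i" using permutes_inverses[OF \<sigma>] by auto
      then show ?thesis using True \<Delta>[OF x y, of i j] b by auto
    next
      case False
      then have "i \<noteq> inv \<sigma> j" using permutes_inverses[OF \<sigma>] by auto
      then have "(u x i (\<sigma> i), w y (inv \<sigma> j) j) \<in> E \<longleftrightarrow> Q x y (i < inv \<sigma> j) (\<sigma> i < j)"
        using Q[OF x y, of i "inv \<sigma> j" "\<sigma> i" j] b False by blast
      then show ?thesis using False Qc[of "i < inv \<sigma> j" "\<sigma> i < j"] by auto
    qed
  qed
  then show "\<exists>xa ia ja yb ib jb.
       bipattern (\<lambda>i. u (xa i) (ia i) (ja i)) (\<lambda>j. w (yb j) (ib j) (jb j))
         (if \<Delta> x y then S_eq else S_neq) (FU x x True) (FW y y True) m \<sigma> \<and>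
       (\<forall>i\<in>{1..m}. xa i < k \<and> ia i < H \<and> ja i < H \<and> yb i < k \<and> ib i < H \<and> jb i < H)"
    using bd x y by - (rule exI[of _ "\<lambda>i. x"], rule exI[of _ "\<lambda>i. i"], rule exI[of _ \<sigma>],
      rule exI[of _ "\<lambda>i. y"], rule exI[of _ "inv \<sigma>"], rule exI[of _ "\<lambda>i. i"], blast)
qed (use x h in auto)

text \<open>A homogeneous grid yields a listed class unless the adjacency between \<open>u\<close> and \<open>w\<close> ignores positions
  altogether and depends on the labels only.\<close>
lemma contains_listed_or_constant:
  assumes h: "2 * h + 2 \<le> H"
  shows "contains_listed C h \<or>
    ((\<forall>x<k. \<forall>b. FU x x b = FU x x True) \<and> (\<forall>y<k. \<forall>b. FW y y b = FW y y True) \<and>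
     (\<forall>x<k. \<forall>y<k. \<forall>\<alpha> \<beta>. Q x y \<alpha> \<beta> = \<Delta> x y))"
proof (rule disjCI)
  assume "\<not> ((\<forall>x<k. \<forall>b. FU x x b = FU x x True) \<and> (\<forall>y<k. \<forall>b. FW y y b = FW y y True) \<and>
     (\<forall>x<k. \<forall>y<k. \<forall>\<alpha> \<beta>. Q x y \<alpha> \<beta> = \<Delta> x y))"
  then consider (U) x where "x < k" "FU x x True \<noteq> FU x x False"
    | (W) y where "y < k" "FW y y True \<noteq> FW y y False"
    | (Q) x y \<alpha> \<beta> where "x < k" "y < k" "Q x y \<alpha> \<beta> \<noteq> \<Delta> x y"
      "FU x x True = FU x x False" "FW y y True = FW y y False"
    by (metis (full_types))
  then show "contains_listed C h"
  proof cases
    case U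
    then show ?thesis using contains_P_if_FU_nonconstant h unfolding contains_listed_def by simp
  next
    case W
    then show ?thesis
      using homogeneous_grid.contains_P_if_FU_nonconstant[OF transposed_grid] h
      unfolding contains_listed_def by simp
  next
    case Q
    consider (col) \<gamma> where "Q x y \<gamma> True \<noteq> Q x y \<gamma> False" | (row) \<gamma> where "Q x y True \<gamma> \<noteq> Q x y False \<gamma>"
      | (const) "\<And>\<gamma> \<delta>. Q x y \<gamma> \<delta> = Q x y \<alpha> \<beta>"
      by (metis (full_types))
    then show ?thesis
    proof cases
      case col
      then show ?thesis
        using contains_M_if_Q_varies_with_column[OF Q(1,2,4,5) col h] unfolding contains_listed_def by blast
    next
      case row
      then show ?thesis
        using homogeneous_grid.contains_M_if_Q_varies_with_column[OF transposed_grid Q(2,1,5,4), of "\<not> \<gamma>"] h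
        unfolding contains_listed_def by auto
    next
      case const
      then show ?thesis
        using contains_M_if_diagonal_differs[OF Q(1,2,4,5) _ h] Q(3) unfolding contains_listed_def by auto
    qed
  qed
qed

end

context homogeneous_grid
begin

text \<open>The labels 0 and 1 are told apart at one point of the grid. If positions do not matter, they are told
  apart by all later vertices \<open>w\<close> on the diagonal, which are more than \<open>e\<close>.\<close>
lemma contains_listed_if_sparse_difference:
  assumes k: "2 \<le> k" and \<Delta>01: "\<Delta> 0 0 \<noteq> \<Delta> 1 0" and h: "2 * h + 2 \<le> H" and e: "e + 2 \<le> H"
    and sparse: "card {v. v < n \<and> ((u 0 0 0, v) \<in> E) \<noteq> ((u 1 0 0, v) \<in> E)} \<le> e"
  shows "contains_listed C h"
proof (rule ccontr)
  assume "\<not> contains_listed C h"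
  then have Qc: "Q x y \<alpha> \<beta> = \<Delta> x y" if "x < k" "y < k" for x y \<alpha> \<beta>
    using contains_listed_or_constant[OF h] that by blast
  define v where "v i = w 0 (Suc i) (Suc i)" for i
  have "v i < v j" if "i < j" "j < Suc e" for i j unfolding v_def using w_mono that e k by auto
  then have "inj_on v {..<Suc e}" by (intro linorder_inj_onI) (auto simp: less_imp_neq)
  moreover have "v ` {..<Suc e} \<subseteq> {v. v < n \<and> ((u 0 0 0, v) \<in> E) \<noteq> ((u 1 0 0, v) \<in> E)}"
  proof (clarsimp, intro conjI)
    fix i assume i: "i < Suc e"
    show "v i < n" unfolding v_def using w_bound i k e by auto
    have "(u x 0 0, v i) \<in> E \<longleftrightarrow> \<Delta> x 0" if "x < k" for x
      unfolding v_def using Q[of x 0 0 "Suc i" 0 "Suc i"] Qc that i k e by auto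
    then show "((u 0 0 0, v i) \<in> E) = ((u (Suc 0) 0 0, v i) \<notin> E)" using \<Delta>01 k by simp
  qed
  ultimately have "Suc e \<le> card {v. v < n \<and> ((u 0 0 0, v) \<in> E) \<noteq> ((u 1 0 0, v) \<in> E)}"
    using card_inj_on_le[of v "{..<Suc e}"] by simp
  then show False using sparse by simp
qed

text \<open>On the diagonal points \<open>(i, i)\<close> the labels can be assigned in any order, so an adjacency that depends
  on the order of the labels produces every permutation graph.\<close>
lemma contains_P_of_labels:
  assumes t: "\<And>x. x \<le> h \<Longrightarrow> t x < k"
    and F: "\<And>x y. x < y \<Longrightarrow> y \<le> h \<Longrightarrow> FU (t x) (t y) True = f1 \<and> FU (t y) (t x) True = f2"
    and f: "f1 \<noteq> f2" and h: "h + 2 \<le> H"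
  shows "contains_P C h"
  unfolding contains_P_def
proof (intro allI impI)
  fix m \<pi> assume m: "m \<le> h" and \<pi>: "\<pi> permutes {1..m}"
  have r: "\<pi> i \<in> {1..m}" if "i \<in> {1..m}" for i using permutes_in_image[OF \<pi>] that by blast
  have inj: "\<pi> i \<noteq> \<pi> j" if "i \<noteq> j" for i j using permutes_inj[OF \<pi>] that by (auto dest: injD)
  define col where "col i = (if f1 then m + 1 - \<pi> i else \<pi> i)" for i
  have col: "col i \<le> h" "i < H" if "i \<in> {1..m}" for i using r[OF that] m h that unfolding col_def by auto
  show "permutation_ograph m \<pi> \<in> C"
  proof (rule embed_permutation_graph[of m "\<lambda>i. u (t (col i)) i i"])
    fix i j assume ij: "i \<in> {1..m}" "j \<in> {1..m}" "i < j"
    have tc: "t (col i) < k" "t (col j) < k" using t col ij by auto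
    show "u (t (col i)) i i < u (t (col j)) j j" using u_mono tc ij col by auto
    have c: "col i \<noteq> col j" "col i < col j \<longleftrightarrow> (if f1 then \<pi> j < \<pi> i else \<pi> i < \<pi> j)"
      using inj[of i j] ij(3) r[OF ij(1)] r[OF ij(2)] unfolding col_def by auto
    have "(u (t (col i)) i i, u (t (col j)) j j) \<in> E \<longleftrightarrow> FU (t (col i)) (t (col j)) True"
      using FU[OF tc ij(3), of i j] col ij by auto
    also have "\<dots> \<longleftrightarrow> (if col i < col j then f1 else f2)"
      using F[of "col i" "col j"] F[of "col j" "col i"] c(1) col ij by auto
    also have "\<dots> \<longleftrightarrow> \<pi> j < \<pi> i"
      using f c(2) inj[of i j] ij(3) by auto
    finally show "(u (t (col i)) i i, u (t (col j)) j j) \<in> E \<longleftrightarrow> \<pi> j < \<pi> i" .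
  qed (use u_bound t col in auto)
qed

text \<open>Since positions are irrelevant, row \<open>i\<close> may use any label and column \<open>j\<close> the label \<open>inv \<sigma> j\<close>. The
  matrix \<open>\<Delta>\<close> of the labels is a diagonal or its complement if \<open>e \<noteq> d\<close>, and a triangle if \<open>e = d\<close>; these
  give the symbols \<open>S_eq\<close>, \<open>S_neq\<close>, \<open>S_le_l\<close> and \<open>S_ge_l\<close>.\<close>
lemma contains_M_of_labels:
  assumes t: "\<And>x. x \<le> h + 1 \<Longrightarrow> t x < k"
    and F: "\<And>x y. x \<noteq> y \<Longrightarrow> x \<le> h + 1 \<Longrightarrow> y \<le> h + 1 \<Longrightarrow> FU (t x) (t y) True = f \<and> FW (t x) (t y) True = g"
    and D: "\<And>x y. x \<le> h + 1 \<Longrightarrow> y \<le> h \<Longrightarrow> \<Delta> (t x) (t y) = (if x = y then d else if x < y then e else \<not> d)"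
    and Qc: "\<And>x y \<alpha> \<beta>. x < k \<Longrightarrow> y < k \<Longrightarrow> Q x y \<alpha> \<beta> = \<Delta> x y" and h: "h + 2 \<le> H"
  shows "\<exists>s lam rho. contains_M C s lam rho h"
proof -
  define s where "s = (if e = d then (if d then S_le_l else S_ge_l) else (if d then S_eq else S_neq))"
  \<comment> \<open>For \<open>S_ge_l\<close> the triangle is strict, \<open>x > y\<close>; shifting the labels of the rows by one includes equality.\<close>
  define la where "la i = (if e = d \<and> \<not> d then i + 1 else i)" for i :: nat
  show ?thesis
  proof (rule contains_M_of_patterns[where s = s and lam = f and rho = g])
    show "0 < k" using t[of 0] by simp
    show "0 < H" using h by simp
    fix m \<sigma> assume m: "m \<le> h" and \<sigma>: "\<sigma> permutes {1..m}"
    have \<sigma>': "inv \<sigma> permutes {1..m}" using \<sigma> by (rule permutes_inv)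
    have r: "inv \<sigma> i \<in> {1..m}" if "i \<in> {1..m}" for i
      using permutes_in_image[OF \<sigma>'] that by blast
    have inj: "inv \<sigma> i \<noteq> inv \<sigma> j" if "i \<noteq> j" for i j
      using permutes_inj[OF \<sigma>'] that by (auto dest: injD)
    have eq: "i = inv \<sigma> j \<longleftrightarrow> \<sigma> i = j" for i j using permutes_inverses[OF \<sigma>] by auto
    have bd: "i < H \<and> la i \<le> h + 1 \<and> t (la i) < k \<and> inv \<sigma> i \<le> h \<and> t (inv \<sigma> i) < k" if "i \<in> {1..m}" for i
      using that r[OF that] m h t unfolding la_def by auto
    have "bipattern (\<lambda>i. u (t (la i)) i i) (\<lambda>j. w (t (inv \<sigma> j)) j j) s f g m \<sigma>"
      unfolding bipattern_def
    proof (intro conjI ballI impI)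
      fix i assume i: "i \<in> {1..m}"
      show "u (t (la i)) i i < n" "w (t (inv \<sigma> i)) i i < n" using u_bound w_bound bd[OF i] by auto
      fix j assume j: "j \<in> {1..m}"
      note b = bd[OF i] bd[OF j]
      {
        assume ij: "i < j"
        have ne: "inv \<sigma> i \<noteq> inv \<sigma> j" "la i \<noteq> la j" using inj[of i j] ij unfolding la_def by auto
        show "u (t (la i)) i i < u (t (la j)) j j" using u_mono b ij by blast
        show "w (t (inv \<sigma> i)) i i < w (t (inv \<sigma> j)) j j" using w_mono b ij by blast
        have "(u (t (la i)) i i, u (t (la j)) j j) \<in> E \<longleftrightarrow> FU (t (la i)) (t (la j)) True"
          using FU[of "t (la i)" "t (la j)" i j i j] b ij by simp
        then show "(u (t (la i)) i i, u (t (la j)) j j) \<in> E \<longleftrightarrow> f"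
          using F[OF ne(2)] b by simp
        have "(w (t (inv \<sigma> i)) i i, w (t (inv \<sigma> j)) j j) \<in> E \<longleftrightarrow> FW (t (inv \<sigma> i)) (t (inv \<sigma> j)) True"
          using FW[of "t (inv \<sigma> i)" "t (inv \<sigma> j)" i j i j] b ij by simp
        then show "(w (t (inv \<sigma> i)) i i, w (t (inv \<sigma> j)) j j) \<in> E \<longleftrightarrow> g"
          using F[OF ne(1)] b by simp
      }
      have "(u (t (la i)) i i, w (t (inv \<sigma> j)) j j) \<in> E \<longleftrightarrow> \<Delta> (t (la i)) (t (inv \<sigma> j))"
      proof (cases "i = j")
        case True
        then show ?thesis using \<Delta>[of "t (la i)" "t (inv \<sigma> j)" i i] b by simp
      next
        case False
        then show ?thesis
          using Q[of "t (la i)" "t (inv \<sigma> j)" i j i j] Qc[of "t (la i)" "t (inv \<sigma> j)"] b by simp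
      qed
      also have "\<dots> \<longleftrightarrow> (if la i = inv \<sigma> j then d else if la i < inv \<sigma> j then e else \<not> d)"
        using D[of "la i" "inv \<sigma> j"] b by simp
      also have "\<dots> \<longleftrightarrow> cross_adj s \<sigma> i j"
        unfolding s_def la_def using eq[of i j] by (cases d; cases e) auto
      finally show "(u (t (la i)) i i, w (t (inv \<sigma> j)) j j) \<in> E \<longleftrightarrow> cross_adj s \<sigma> i j" .
    qed
    then show "\<exists>xa ia ja yb ib jb.
       bipattern (\<lambda>i. u (xa i) (ia i) (ja i)) (\<lambda>j. w (yb j) (ib j) (jb j)) s f g m \<sigma> \<and>
       (\<forall>i\<in>{1..m}. xa i < k \<and> ia i < H \<and> ja i < H \<and> yb i < k \<and> ib i < H \<and> jb i < H)"
      using bd by - (rule exI[of _ "\<lambda>i. t (la i)"], rule exI[of _ "\<lambda>i. i"], rule exI[of _ "\<lambda>i. i"],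
        rule exI[of _ "\<lambda>j. t (inv \<sigma> j)"], rule exI[of _ "\<lambda>i. i"], rule exI[of _ "\<lambda>i. i"], blast)
  qed
qed

end

text \<open>Ramsey's theorem for the labels brings the matrix \<open>\<Delta>\<close> into the normal form of the previous lemma and
  makes the adjacencies inside both sides depend on the order of the labels only.\<close>
lemma contains_listed_if_independent_labels:
  "\<exists>k. \<forall>C n E H u w FU FW Q \<Delta>. homogeneous_grid C n E k H u w FU FW Q \<Delta> \<longrightarrow>
     2 * h + 2 \<le> H \<longrightarrow> (\<forall>x y. x < y \<longrightarrow> y < k \<longrightarrow> \<Delta> y x \<noteq> \<Delta> x x) \<longrightarrow> contains_listed C h"
proof -
  obtain k where k: "\<And>col :: nat \<Rightarrow> nat \<Rightarrow> bool \<times> bool \<times> bool \<times> bool \<times> bool \<times> bool.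
    (\<forall>i j. i < j \<longrightarrow> j < k \<longrightarrow> col i j \<in> UNIV) \<Longrightarrow>
    (\<exists>f c. (\<forall>i<h+2. f i < k) \<and> (\<forall>i j. i < j \<longrightarrow> j < h+2 \<longrightarrow> f i < f j) \<and>
       (\<forall>i j. i < j \<longrightarrow> j < h+2 \<longrightarrow> col (f i) (f j) = c))"
    using ramsey_pairs[of "UNIV :: (bool \<times> bool \<times> bool \<times> bool \<times> bool \<times> bool) set" "h + 2"] by auto
  show ?thesis
  proof (rule exI[of _ k], intro allI impI)
    fix C n E H u w FU FW Q \<Delta>
    assume hg: "homogeneous_grid C n E k H u w FU FW Q \<Delta>" and h: "2 * h + 2 \<le> H"
      and ind: "\<forall>x y. x < y \<longrightarrow> y < k \<longrightarrow> \<Delta> y x \<noteq> \<Delta> x x"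
    interpret homogeneous_grid C n E k H u w FU FW Q \<Delta> by (rule hg)
    have h2: "h + 2 \<le> H" using h by simp
    obtain t d e f1 f2 g1 g2 where t: "\<forall>i<h+2. t i < k" "\<forall>i j. i < j \<longrightarrow> j < h+2 \<longrightarrow> t i < t j"
      "\<forall>i j. i < j \<longrightarrow> j < h+2 \<longrightarrow> (\<Delta> (t i) (t i), \<Delta> (t i) (t j), FU (t i) (t j) True, FU (t j) (t i) True,
        FW (t i) (t j) True, FW (t j) (t i) True) = (d, e, f1, f2, g1, g2)"
      using k[of "\<lambda>x y. (\<Delta> x x, \<Delta> x y, FU x y True, FU y x True, FW x y True, FW y x True)"]
      by (metis (no_types, lifting) UNIV_I prod_cases6)
    have tk: "t x < k" if "x \<le> h + 1" for x using t(1) that by simp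
    have T: "\<Delta> (t x) (t x) = d \<and> \<Delta> (t x) (t y) = e \<and> FU (t x) (t y) True = f1 \<and> FU (t y) (t x) True = f2 \<and>
        FW (t x) (t y) True = g1 \<and> FW (t y) (t x) True = g2" if "x < y" "y \<le> h + 1" for x y
      using t(3) that by simp
    show "contains_listed C h"
    proof (rule ccontr)
      assume nc: "\<not> contains_listed C h"
      then have Qc: "Q x y \<alpha> \<beta> = \<Delta> x y" if "x < k" "y < k" for x y \<alpha> \<beta>
        using contains_listed_or_constant[OF h] that by blast
      have "f1 = f2"
      proof (rule ccontr)
        assume "f1 \<noteq> f2"
        then have "contains_P C h"
          using contains_P_of_labels[of h t f1 f2] tk T h2 by simp
        then show False using nc unfolding contains_listed_def by blast
      qed
      moreover have "g1 = g2"
      proof (rule ccontr)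
        assume "g1 \<noteq> g2"
        then have "contains_P C h"
          using homogeneous_grid.contains_P_of_labels[OF transposed_grid, of h t g1 g2] tk T h2 by simp
        then show False using nc unfolding contains_listed_def by blast
      qed
      ultimately have F: "FU (t x) (t y) True = f1 \<and> FW (t x) (t y) True = g1"
        if "x \<noteq> y" "x \<le> h + 1" "y \<le> h + 1" for x y
        using T[of x y] T[of y x] that by (cases "x < y") auto
      have D: "\<Delta> (t x) (t y) = (if x = y then d else if x < y then e else \<not> d)" if "x \<le> h + 1" "y \<le> h" for x y
      proof -
        have "\<Delta> (t y) (t y) = d" using T[of y "h + 1"] that by simp
        moreover have "\<Delta> (t x) (t y) \<noteq> \<Delta> (t y) (t y)" if "y < x"
          using ind t(2) tk that \<open>x \<le> h + 1\<close> by simp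
        ultimately show ?thesis using T[of x y] that by (cases x y rule: linorder_cases) auto
      qed
      have "\<exists>s lam rho. contains_M C s lam rho h"
        using contains_M_of_labels[of h t f1 g1 d e, OF tk F D Qc h2] by simp
      then show False using nc unfolding contains_listed_def by blast
    qed
  qed
qed

text \<open>One of two opposite quarters of the grid has all its vertices \<open>u\<close> on one side of all its vertices \<open>w\<close>:
  if a vertex \<open>u\<close> of the first half of the rows is not below some vertex \<open>w\<close> of the second half of the
  columns, then the other halves are separated the other way round. Product Ramsey makes such a quarter homogeneous.\<close>
lemma homogeneous_subgrid:
  "\<exists>N. \<forall>C n E u w. labelled_grid C n E k N u w \<longrightarrow>
     (\<exists>f g FU FW Q \<Delta>. (\<forall>i<H. f i < N \<and> g i < N) \<and>
        homogeneous_grid C n E k H (\<lambda>x i j. u x (f i) (g j)) (\<lambda>x i j. w x (f i) (g j)) FU FW Q \<Delta>)"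
proof -
  define K where "K = Pow ({..<2 * k} \<times> {..<2 * k} \<times> {..<3::nat})"
  have "finite K" unfolding K_def by simp
  \<comment> \<open>With \<open>H + 1\<close> rows and columns every point of the \<open>H\<close> by \<open>H\<close> grid has a point beyond it in both
    directions, and so its own adjacencies are part of a colour.\<close>
  from product_ramsey[OF this, of "H + 1"] obtain N0 :: nat where
    N0: "\<forall>col. (\<forall>i i' j j'. i < i' \<longrightarrow> i' < N0 \<longrightarrow> j < j' \<longrightarrow> j' < N0 \<longrightarrow> col i i' j j' \<in> K) \<longrightarrow>
    (\<exists>f g c. (\<forall>i<H+1. f i < N0 \<and> g i < N0) \<and> (\<forall>i j. i < j \<longrightarrow> j < H+1 \<longrightarrow> f i < f j \<and> g i < g j) \<and>
       (\<forall>i i' j j'. i < i' \<longrightarrow> i' < H+1 \<longrightarrow> j < j' \<longrightarrow> j' < H+1 \<longrightarrow> col (f i) (f i') (g j) (g j') = c))"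
    by (rule exE)
  show ?thesis
  proof (rule exI[of _ "2 * N0"], intro allI impI)
    fix C n E u w assume lg: "labelled_grid C n E k (2 * N0) u w"
    interpret labelled_grid C n E k "2 * N0" u w by (rule lg)
    define U where "U p q x i j = u x (p + i) (q + j)" for p q x i j
    define W where "W p q x i j = w x (p + i) (q + j)" for p q x i j
    have "\<exists>p q. p \<le> N0 \<and> q \<le> N0 \<and> (grid_precedes k N0 (U p q) (W p q) \<or> grid_precedes k N0 (W p q) (U p q))"
    proof (cases "grid_precedes k N0 (U 0 N0) (W 0 N0)")
      case True
      then show ?thesis by - (rule exI[of _ 0], rule exI[of _ N0], simp)
    next
      case False
      then obtain x y i i' j j' where b: "x < k" "y < k" "i < N0" "i' < N0" "j < N0" "j' < N0"
        and le: "w y i' (N0 + j') \<le> u x i (N0 + j)"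
        unfolding grid_precedes_def U_def W_def add_0 by (metis not_le)
      have "w y2 (N0 + i2') j2' < u x2 (N0 + i2) j2"
        if "x2 < k" "y2 < k" "i2 < N0" "i2' < N0" "j2 < N0" "j2' < N0" for x2 y2 i2 i2' j2 j2'
      proof -
        have "w y2 (N0 + i2') j2' < w y i' (N0 + j')" using w_mono b that by simp
        also note le
        also have "u x i (N0 + j) < u x2 (N0 + i2) j2" using u_mono b that by simp
        finally show ?thesis .
      qed
      then have "grid_precedes k N0 (W N0 0) (U N0 0)" unfolding grid_precedes_def U_def W_def by simp
      then show ?thesis by - (rule exI[of _ N0], rule exI[of _ 0], simp)
    qed
    then obtain p q where pq: "p \<le> N0" "q \<le> N0"
      and sep: "grid_precedes k N0 (U p q) (W p q) \<or> grid_precedes k N0 (W p q) (U p q)" by blast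
    \<comment> \<open>One family \<open>z\<close> collects the vertices \<open>u\<close> and \<open>w\<close>. The colour of two rows and two columns records the adjacencies
      between \<open>(i, j)\<close> and \<open>(i', j')\<close> (0), between \<open>(i, j')\<close> and \<open>(i', j)\<close> (1), and at \<open>(i, j)\<close> (2).\<close>
    define z where "z l i j = (if l < k then u l (p + i) (q + j) else w (l - k) (p + i) (q + j))" for l i j
    define col where "col i i' j j' = {(l, l', \<epsilon>). l < 2 * k \<and> l' < 2 * k \<and>
      ((\<epsilon> = 0 \<and> (z l i j, z l' i' j') \<in> E) \<or> (\<epsilon> = 1 \<and> (z l i j', z l' i' j) \<in> E) \<or>
       (\<epsilon> = (2::nat) \<and> (z l i j, z l' i j) \<in> E))}" for i i' j j'
    have "col i i' j j' \<in> K" for i i' j j' unfolding col_def K_def by auto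
    then have "\<forall>i i' j j'. i < i' \<longrightarrow> i' < N0 \<longrightarrow> j < j' \<longrightarrow> j' < N0 \<longrightarrow> col i i' j j' \<in> K" by simp
    from N0[THEN spec, THEN mp, OF this] obtain f g c where fgc:
      "(\<forall>i<H+1. f i < N0 \<and> g i < N0) \<and> (\<forall>i j. i < j \<longrightarrow> j < H+1 \<longrightarrow> f i < f j \<and> g i < g j) \<and>
       (\<forall>i i' j j'. i < i' \<longrightarrow> i' < H+1 \<longrightarrow> j < j' \<longrightarrow> j' < H+1 \<longrightarrow> col (f i) (f i') (g j) (g j') = c)"
      by (elim exE)
    have fg: "\<And>i. i < H + 1 \<Longrightarrow> f i < N0 \<and> g i < N0"
      "\<And>i j. i < j \<Longrightarrow> j < H + 1 \<Longrightarrow> f i < f j \<and> g i < g j"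
      and cc: "\<And>i i' j j'. i < i' \<Longrightarrow> i' < H+1 \<Longrightarrow> j < j' \<Longrightarrow> j' < H+1 \<Longrightarrow> col (f i) (f i') (g j) (g j') = c"
      using fgc by simp_all
    have c0: "(z l (f i) (g j), z l' (f i') (g j')) \<in> E \<longleftrightarrow> (l, l', 0) \<in> c"
      if "i < i'" "i' < H" "j < j'" "j' < H" "l < 2 * k" "l' < 2 * k" for i i' j j' l l'
      using cc[of i i' j j'] that unfolding col_def by auto
    have c1: "(z l (f i) (g j'), z l' (f i') (g j)) \<in> E \<longleftrightarrow> (l, l', 1) \<in> c"
      if "i < i'" "i' < H" "j < j'" "j' < H" "l < 2 * k" "l' < 2 * k" for i i' j j' l l'
      using cc[of i i' j j'] that unfolding col_def by auto
    have c2: "(z l (f i) (g j), z l' (f i) (g j)) \<in> E \<longleftrightarrow> (l, l', 2) \<in> c"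
      if "i < H" "j < H" "l < 2 * k" "l' < 2 * k" for i j l l'
      using cc[of i "i + 1" j "j + 1"] that unfolding col_def by auto
    have zu: "u x (p + f i) (q + g j) = z x (f i) (g j)" if "x < k" for x i j
      using that unfolding z_def by simp
    have zw: "w y (p + f i) (q + g j) = z (k + y) (f i) (g j)" for y i j
      unfolding z_def by simp
    define FU where "FU x x' b = (if b then (x, x', 0) \<in> c else (x, x', 1) \<in> c)" for x x' and b :: bool
    define FW where "FW y y' b = (if b then (k + y, k + y', 0) \<in> c else (k + y', k + y, 1) \<in> c)" for y y' and b :: bool
    define Q where "Q x y a b = (if a then (if b then (x, k + y, 0) \<in> c else (x, k + y, 1) \<in> c)
        else (if b then (k + y, x, 1) \<in> c else (k + y, x, 0) \<in> c))" for x y and a b :: bool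
    have fb: "p + f i < 2 * N0 \<and> q + g i < 2 * N0" if "i < H" for i using fg(1)[of i] that pq by auto
    have mono: "p + f i < p + f j \<and> q + g i < q + g j" if "i < j" "j < H" for i j using fg(2)[of i j] that by auto
    have "homogeneous_grid C n E k H (\<lambda>x i j. u x (p + f i) (q + g j)) (\<lambda>x i j. w x (p + f i) (q + g j))
        FU FW Q (\<lambda>x y. (x, k + y, 2) \<in> c)"
    proof unfold_locales
      have "f i < N0" "g i < N0" if "i < H" for i using fg(1)[of i] that by simp_all
      note bounds = this
      show "grid_precedes k H (\<lambda>x i j. u x (p + f i) (q + g j)) (\<lambda>x i j. w x (p + f i) (q + g j)) \<or>
        grid_precedes k H (\<lambda>x i j. w x (p + f i) (q + g j)) (\<lambda>x i j. u x (p + f i) (q + g j))"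
        by (rule disj_forward[OF sep]) (simp_all add: grid_precedes_def U_def W_def bounds)
    next
      fix x x' i i' j j' assume *: "x < k" "x' < k" "i < i'" "i' < H" "j < H" "j' < H" "j \<noteq> j'"
      show "(u x (p + f i) (q + g j), u x' (p + f i') (q + g j')) \<in> E \<longleftrightarrow> FU x x' (j < j')"
        using c0[of i i' j j' x x'] c1[of i i' j' j x x'] * unfolding zu[OF *(1)] zu[OF *(2)] FU_def by auto
    next
      fix y y' i i' j j' assume *: "y < k" "y' < k" "j < j'" "j' < H" "i < H" "i' < H" "i \<noteq> i'"
      show "(w y (p + f i) (q + g j), w y' (p + f i') (q + g j')) \<in> E \<longleftrightarrow> FW y y' (i < i')"
        using c0[of i i' j j' "k + y" "k + y'"] c1[of i' i j j' "k + y'" "k + y"] *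
          sym_E[of "z (k + y) (f i) (g j)"] unfolding zw FW_def by auto
    next
      fix x y i i' j j' assume *: "x < k" "y < k" "i < H" "i' < H" "j < H" "j' < H" "i \<noteq> i'" "j \<noteq> j'"
      show "(u x (p + f i) (q + g j), w y (p + f i') (q + g j')) \<in> E \<longleftrightarrow> Q x y (i < i') (j < j')"
        using c0[of i i' j j' x "k + y"] c1[of i i' j' j x "k + y"]
          c0[of i' i j' j "k + y" x] c1[of i' i j j' "k + y" x] *
          sym_E[of "z x (f i) (g j)"] unfolding zw zu[OF *(1)] Q_def by auto
    next
      fix x y i j assume *: "x < k" "y < k" "i < H" "j < H"
      show "(u x (p + f i) (q + g j), w y (p + f i) (q + g j)) \<in> E \<longleftrightarrow> (x, k + y, 2) \<in> c"
        using c2[of i j x "k + y"] * unfolding zw zu[OF *(1)] by auto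
    qed (use u_bound w_bound u_mono w_mono fb mono in simp_all)
    then show "\<exists>f g FU FW Q \<Delta>. (\<forall>i<H. f i < 2 * N0 \<and> g i < 2 * N0) \<and>
        homogeneous_grid C n E k H (\<lambda>x i j. u x (f i) (g j)) (\<lambda>x i j. w x (f i) (g j)) FU FW Q \<Delta>"
      using fb by - (rule exI[of _ "\<lambda>i. p + f i"], rule exI[of _ "\<lambda>i. q + g i"], blast)
  qed
qed

section \<open>Grids that force a listed class\<close>

text \<open>A pair \<open>(a, v)\<close> in \<open>D\<close> records that column \<open>v\<close> tells the row of \<open>a\<close> from that of its near twin \<open>p a\<close>.
  The last condition says that different pairs of near twins do not interleave.\<close>
definition near_twin_pairs :: "nat \<Rightarrow> nat rel \<Rightarrow> nat \<Rightarrow> (nat \<Rightarrow> nat) \<Rightarrow> nat rel \<Rightarrow> bool" where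
  "near_twin_pairs n E e p D \<longleftrightarrow> D \<subseteq> {..<n} \<times> {..<n} \<and>
     (\<forall>(a, v)\<in>D. p a < n \<and> ((a, v) \<in> E) \<noteq> ((p a, v) \<in> E) \<and>
        card {v. v < n \<and> ((a, v) \<in> E) \<noteq> ((p a, v) \<in> E)} \<le> e) \<and>
     (\<forall>(a, v)\<in>D. \<forall>(a', v')\<in>D. a < a' \<longrightarrow> max a (p a) < min a' (p a'))"

text \<open>The labels 0 and 1 stand for a vertex and its near twin, and all labels of columns for the column that tells
  them apart.\<close>
lemma contains_listed_if_near_twin_grid:
  "\<exists>N\<ge>1. \<forall>C n E D p. host C n E \<longrightarrow> near_twin_pairs n E e p D \<longrightarrow>
     has_grid (point_ranges D) N \<longrightarrow> contains_listed C h"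
proof -
  define H where "H = 2 * h + e + 2"
  obtain N where N: "\<forall>C n E u w. labelled_grid C n E 2 N u w \<longrightarrow>
     (\<exists>f g FU FW Q \<Delta>. (\<forall>i<H. f i < N \<and> g i < N) \<and>
        homogeneous_grid C n E 2 H (\<lambda>x i j. u x (f i) (g j)) (\<lambda>x i j. w x (f i) (g j)) FU FW Q \<Delta>)"
    using homogeneous_subgrid[of 2 H] by (rule exE)
  show ?thesis
  proof (rule exI[of _ "Suc N"], intro conjI allI impI)
    fix C n E D and p :: "nat \<Rightarrow> nat"
    assume host: "host C n E" and twins: "near_twin_pairs n E e p D"
      and g: "has_grid (point_ranges D) (Suc N)"
    have Dn: "D \<subseteq> {..<n} \<times> {..<n}"
      and tw: "\<And>a v. (a, v) \<in> D \<Longrightarrow> p a < n \<and> ((a, v) \<in> E) \<noteq> ((p a, v) \<in> E) \<and>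
        card {v. v < n \<and> ((a, v) \<in> E) \<noteq> ((p a, v) \<in> E)} \<le> e"
      and ord: "\<And>a v a' v'. (a, v) \<in> D \<Longrightarrow> (a', v') \<in> D \<Longrightarrow> a < a' \<Longrightarrow> max a (p a) < min a' (p a')"
      using twins unfolding near_twin_pairs_def by fast+
    obtain a x y where ax: "\<And>i j. i < Suc N \<Longrightarrow> j < Suc N \<Longrightarrow> (a i j, x i j, y i j) \<in> point_ranges D"
      and am: "\<And>i i' j j'. i < i' \<Longrightarrow> i < Suc N \<Longrightarrow> i' < Suc N \<Longrightarrow> j < Suc N \<Longrightarrow> j' < Suc N \<Longrightarrow> a i j < a i' j'"
      and xm: "\<And>i i' j j'. j < j' \<Longrightarrow> i < Suc N \<Longrightarrow> i' < Suc N \<Longrightarrow> j < Suc N \<Longrightarrow> j' < Suc N \<Longrightarrow> y i j < x i' j'"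
      using g by (rule has_gridE) blast
    have D: "(a i j, x i j) \<in> D" "y i j = x i j" if "i < N" "j < N" for i j
      using ax[of i j] that by auto
    define u where "u l i j = (if l = 0 then a i j else p (a i j))" for l :: nat and i j
    define w where "w l i j = x i j" for l :: nat and i j
    interpret host C n E by (rule host)
    have lg: "labelled_grid C n E 2 N u w"
    proof unfold_locales
      fix l i j assume "i < N" "j < N"
      then show "u l i j < n" "w l i j < n" using D[of i j] tw Dn unfolding u_def w_def by auto
    next
      fix l l' i i' j j' assume *: "i < i'" "i' < N" "j < N" "j' < N"
      have "max (a i j) (p (a i j)) < min (a i' j') (p (a i' j'))"
        by (rule ord[OF D(1)[of i j] D(1)[of i' j']]) (use am[of i i' j j'] * in auto)
      then show "u l i j < u l' i' j'" unfolding u_def by auto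
    next
      fix l l' i i' j j' assume *: "j < j'" "j' < N" "i < N" "i' < N"
      show "w l i j < w l' i' j'" unfolding w_def using xm[of j j' i i'] D(2)[of i j] * by simp
    qed
    obtain f g FU FW Q \<Delta> where fg: "\<forall>i<H. f i < N \<and> g i < N"
      and hg: "homogeneous_grid C n E 2 H (\<lambda>x i j. u x (f i) (g j)) (\<lambda>x i j. w x (f i) (g j)) FU FW Q \<Delta>"
      using N[rule_format, OF lg] by (elim exE conjE)
    interpret homogeneous_grid C n E 2 H "\<lambda>x i j. u x (f i) (g j)" "\<lambda>x i j. w x (f i) (g j)" FU FW Q \<Delta>
      by (rule hg)
    have H0: "0 < H" unfolding H_def by simp
    then have "f 0 < N" "g 0 < N" using fg by auto
    note d = tw[OF D(1)[OF this]]
    show "contains_listed C h"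
    proof (rule contains_listed_if_sparse_difference)
      show "\<Delta> 0 0 \<noteq> \<Delta> 1 0" using \<Delta>[of 0 0 0 0] \<Delta>[of 1 0 0 0] d H0 by (simp add: u_def w_def)
      show "card {v. v < n \<and> ((u 0 (f 0) (g 0), v) \<in> E) \<noteq> ((u 1 (f 0) (g 0), v) \<in> E)} \<le> e"
        using d by (simp add: u_def)
    qed (auto simp: H_def)
  qed simp
qed

text \<open>Split the rows by a column on which two of them differ. The larger part is kept, and a row from the
  other part becomes the next member of the sequence.\<close>
lemma halving_sequence:
  fixes P :: "'a \<Rightarrow> 'b \<Rightarrow> bool"
  assumes "finite I" "2 ^ l \<le> card I"
    and "\<And>r r'. r \<in> I \<Longrightarrow> r' \<in> I \<Longrightarrow> r \<noteq> r' \<Longrightarrow> \<exists>v\<in>V. P r v \<noteq> P r' v"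
  shows "\<exists>\<rho> c. (\<forall>x<l. \<rho> x \<in> I \<and> c x \<in> V) \<and> (\<forall>x y. x < y \<longrightarrow> y < l \<longrightarrow> P (\<rho> y) (c x) \<noteq> P (\<rho> x) (c x))"
  using assms
proof (induction l arbitrary: I)
  case 0
  then show ?case by simp
next
  case (Suc l)
  have "(2::nat) \<le> 2 ^ Suc l" by simp
  then have "2 \<le> card I" using Suc.prems(2) by linarith
  then have "\<not> card I \<le> Suc 0" by simp
  then obtain r r' where "r \<in> I" "r' \<in> I" "r \<noteq> r'" using card_le_Suc0_iff_eq[OF Suc.prems(1)] by auto
  then obtain v where v: "v \<in> V" "P r v \<noteq> P r' v" using Suc.prems(3) by blast
  define A where "A b = {s \<in> I. P s v = b}" for b
  have "I = A (P r v) \<union> A (\<not> P r v)" unfolding A_def by auto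
  then have cI: "card I \<le> card (A (P r v)) + card (A (\<not> P r v))" by (metis card_Un_le)
  have "\<exists>b. 2 ^ l \<le> card (A b)"
  proof (rule ccontr)
    assume "\<not> ?thesis"
    then have "card (A (P r v)) < 2 ^ l" "card (A (\<not> P r v)) < 2 ^ l" by (simp_all add: not_le)
    then show False using cI Suc.prems(2) by simp
  qed
  then obtain b where b: "2 ^ l \<le> card (A b)" by blast
  have "\<exists>s\<in>I. P s v \<noteq> b" using v(2) \<open>r \<in> I\<close> \<open>r' \<in> I\<close> by metis
  then obtain s where s: "s \<in> I" "P s v \<noteq> b" by blast
  have sub: "A b \<subseteq> I" unfolding A_def by auto
  have "\<exists>\<rho> c. (\<forall>x<l. \<rho> x \<in> A b \<and> c x \<in> V) \<and> (\<forall>x y. x < y \<longrightarrow> y < l \<longrightarrow> P (\<rho> y) (c x) \<noteq> P (\<rho> x) (c x))"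
  proof (rule Suc.IH[OF _ b])
    show "finite (A b)" using sub Suc.prems(1) finite_subset by blast
    show "\<exists>v\<in>V. P r v \<noteq> P r' v" if "r \<in> A b" "r' \<in> A b" "r \<noteq> r'" for r r'
      using Suc.prems(3) that sub by blast
  qed
  then obtain \<rho> c where rc: "\<And>x. x < l \<Longrightarrow> \<rho> x \<in> A b \<and> c x \<in> V"
    "\<And>x y. x < y \<Longrightarrow> y < l \<Longrightarrow> P (\<rho> y) (c x) \<noteq> P (\<rho> x) (c x)" by blast
  define \<rho>' where "\<rho>' x = (case x of 0 \<Rightarrow> s | Suc x \<Rightarrow> \<rho> x)" for x
  define c' where "c' x = (case x of 0 \<Rightarrow> v | Suc x \<Rightarrow> c x)" for x
  have "\<rho>' x \<in> I \<and> c' x \<in> V" if "x < Suc l" for x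
    using rc(1)[of "x - 1"] s v(1) sub that unfolding \<rho>'_def c'_def by (cases x) auto
  moreover have "P (\<rho>' y) (c' x) \<noteq> P (\<rho>' x) (c' x)" if "x < y" "y < Suc l" for x y
  proof -
    obtain y' where y': "y = Suc y'" "y' < l" using \<open>x < y\<close> \<open>y < Suc l\<close> by (cases y) auto
    show ?thesis
    proof (cases x)
      case 0
      have "P (\<rho> y') v = b" using rc(1)[OF y'(2)] unfolding A_def by auto
      then show ?thesis using 0 y' s(2) unfolding \<rho>'_def c'_def by simp
    next
      case (Suc x')
      then show ?thesis using rc(2)[of x' y'] y' that unfolding \<rho>'_def c'_def by simp
    qed
  qed
  ultimately show ?case by blast
qed

definition block_row :: "nat \<Rightarrow> nat \<Rightarrow> nat rel \<Rightarrow> nat \<Rightarrow> nat \<Rightarrow> nat set" where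
  "block_row n t E r b = {v. v < n \<and> v div t = b \<and> (r, v) \<in> E}"

definition rich_ranges :: "nat \<Rightarrow> nat \<Rightarrow> nat rel \<Rightarrow> nat \<Rightarrow> (nat \<times> nat \<times> nat) set \<Rightarrow> bool" where
  "rich_ranges n t E q F \<longleftrightarrow> (\<forall>(a, x, y)\<in>F.
     q \<le> card ((\<lambda>r. restrict (block_row n t E r) {x..y}) ` {r. r < n \<and> r div t = a}))"

text \<open>A cell with \<open>2 ^ k\<close> distinct rows supplies \<open>k\<close> rows and \<open>k\<close> columns by \<open>halving_sequence\<close>, which serve as the
  labels at the corresponding grid point.\<close>
lemma contains_listed_if_rich_grid:
  "\<exists>N\<ge>1. \<exists>q\<ge>2. \<forall>C n E F t. host C n E \<longrightarrow> rich_ranges n t E q F \<longrightarrow>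
     has_grid F N \<longrightarrow> contains_listed C h"
proof -
  define H where "H = 2 * h + 2"
  obtain k where k: "\<forall>C n E H u w FU FW Q \<Delta>. homogeneous_grid C n E k H u w FU FW Q \<Delta> \<longrightarrow>
     2 * h + 2 \<le> H \<longrightarrow> (\<forall>x y. x < y \<longrightarrow> y < k \<longrightarrow> \<Delta> y x \<noteq> \<Delta> x x) \<longrightarrow> contains_listed C h"
    using contains_listed_if_independent_labels[of h] by (rule exE)
  obtain N0 where N0: "\<forall>C n E u w. labelled_grid C n E k N0 u w \<longrightarrow>
     (\<exists>f g FU FW Q \<Delta>. (\<forall>i<H. f i < N0 \<and> g i < N0) \<and>
        homogeneous_grid C n E k H (\<lambda>x i j. u x (f i) (g j)) (\<lambda>x i j. w x (f i) (g j)) FU FW Q \<Delta>)"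
    using homogeneous_subgrid[of k H] by (rule exE)
  have "contains_listed C h" if host: "host C n E" and rich: "rich_ranges n t E (2 ^ Suc k) F"
    and g: "has_grid F (Suc N0)" for C n E F t
  proof -
    interpret host C n E by (rule host)
    obtain a x y where ax: "\<And>i j. i < Suc N0 \<Longrightarrow> j < Suc N0 \<Longrightarrow> (a i j, x i j, y i j) \<in> F"
      and am: "\<And>i i' j j'. i < i' \<Longrightarrow> i < Suc N0 \<Longrightarrow> i' < Suc N0 \<Longrightarrow> j < Suc N0 \<Longrightarrow> j' < Suc N0 \<Longrightarrow> a i j < a i' j'"
      and xm: "\<And>i i' j j'. j < j' \<Longrightarrow> i < Suc N0 \<Longrightarrow> i' < Suc N0 \<Longrightarrow> j < Suc N0 \<Longrightarrow> j' < Suc N0 \<Longrightarrow> y i j < x i' j'"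
      using g by (rule has_gridE) blast
    have "\<exists>\<rho> c. i < N0 \<longrightarrow> j < N0 \<longrightarrow> (\<forall>l<k. \<rho> l < n \<and> \<rho> l div t = a i j \<and> c l < n \<and> x i j \<le> c l div t \<and> c l div t \<le> y i j) \<and>
      (\<forall>l l'. l < l' \<longrightarrow> l' < k \<longrightarrow> ((\<rho> l', c l) \<in> E) \<noteq> ((\<rho> l, c l) \<in> E))" for i j
    proof (cases "i < N0 \<and> j < N0")
      case True
      define f where "f r = restrict (block_row n t E r) {x i j..y i j}" for r
      define R where "R = {r. r < n \<and> r div t = a i j}"
      have R: "finite R" unfolding R_def by simp
      have big: "2 ^ k \<le> card (f ` R)"
      proof -
        have "2 ^ Suc k \<le> card (f ` R)"
          using rich ax[of i j] True unfolding rich_ranges_def f_def R_def by fastforce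
        then show ?thesis by simp
      qed
      obtain I where I: "I \<subseteq> R" "inj_on f I" "f ` I = f ` R" by (metis subset_image_inj subset_refl)
      have fI: "finite I" using I(1) R finite_subset by blast
      have cI: "2 ^ k \<le> card I" using big I(2,3) card_image by metis
      define V where "V = {v. v < n \<and> x i j \<le> v div t \<and> v div t \<le> y i j}"
      have "\<exists>v\<in>V. ((r, v) \<in> E) \<noteq> ((r', v) \<in> E)" if r: "r \<in> I" "r' \<in> I" "r \<noteq> r'" for r r'
      proof (rule ccontr)
        assume "\<not> ?thesis"
        then have "block_row n t E r b = block_row n t E r' b" if "b \<in> {x i j..y i j}" for b
          using that unfolding V_def block_row_def by auto
        then have "f r = f r'" unfolding f_def by (simp add: restrict_def fun_eq_iff)
        then show False using r I(2) by (auto dest: inj_onD)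
      qed
      from halving_sequence[where P = "\<lambda>r v. (r, v) \<in> E", OF fI cI this]
      obtain \<rho> c where "\<forall>l<k. \<rho> l \<in> I \<and> c l \<in> V"
        "\<forall>l l'. l < l' \<longrightarrow> l' < k \<longrightarrow> ((\<rho> l', c l) \<in> E) \<noteq> ((\<rho> l, c l) \<in> E)" by blast
      then show ?thesis using I(1) unfolding V_def R_def by blast
    qed auto
    then obtain \<rho> c where rc: "\<And>i j l. i < N0 \<Longrightarrow> j < N0 \<Longrightarrow> l < k \<Longrightarrow>
        \<rho> i j l < n \<and> \<rho> i j l div t = a i j \<and> c i j l < n \<and> x i j \<le> c i j l div t \<and> c i j l div t \<le> y i j"
      "\<And>i j l l'. i < N0 \<Longrightarrow> j < N0 \<Longrightarrow> l < l' \<Longrightarrow> l' < k \<Longrightarrow> ((\<rho> i j l', c i j l) \<in> E) \<noteq> ((\<rho> i j l, c i j l) \<in> E)"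
      by metis
    define u where "u l i j = \<rho> i j l" for l i j
    define w where "w l i j = c i j l" for l i j
    have less_of_div: "p < q" if "p div t < q div t" for p q
      using that div_le_mono[of q p t] by linarith
    have lg: "labelled_grid C n E k N0 u w"
    proof unfold_locales
      fix l i j assume "l < k" "i < N0" "j < N0"
      then show "u l i j < n" "w l i j < n" using rc(1) unfolding u_def w_def by auto
    next
      fix l l' i i' j j' assume *: "l < k" "l' < k" "i < i'" "i' < N0" "j < N0" "j' < N0"
      have "\<rho> i j l div t < \<rho> i' j' l' div t" using rc(1) am[of i i' j j'] * by simp
      then show "u l i j < u l' i' j'" unfolding u_def by (rule less_of_div)
    next
      fix l l' i i' j j' assume *: "l < k" "l' < k" "j < j'" "j' < N0" "i < N0" "i' < N0"
      have "c i j l div t \<le> y i j" using rc(1)[of i j l] * by simp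
      also have "y i j < x i' j'" using xm[of j j' i i'] * by simp
      also have "x i' j' \<le> c i' j' l' div t" using rc(1)[of i' j' l'] * by simp
      finally show "w l i j < w l' i' j'" unfolding w_def by (rule less_of_div)
    qed
    obtain f g FU FW Q \<Delta> where fg: "\<forall>i<H. f i < N0 \<and> g i < N0"
      and hg: "homogeneous_grid C n E k H (\<lambda>x i j. u x (f i) (g j)) (\<lambda>x i j. w x (f i) (g j)) FU FW Q \<Delta>"
      using N0[rule_format, OF lg] by (elim exE conjE)
    interpret homogeneous_grid C n E k H "\<lambda>x i j. u x (f i) (g j)" "\<lambda>x i j. w x (f i) (g j)" FU FW Q \<Delta>
      by (rule hg)
    have H0: "0 < H" unfolding H_def by simp
    then have "f 0 < N0" "g 0 < N0" using fg by auto
    note indep = rc(2)[OF this]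
    have "\<Delta> y x \<noteq> \<Delta> x x" if "x < y" "y < k" for x y
      using \<Delta>[of y x 0 0] \<Delta>[of x x 0 0] indep[OF that] H0 that by (simp add: u_def w_def)
    then show ?thesis using k[rule_format, OF hg] unfolding H_def by blast
  qed
  moreover have "2 \<le> (2::nat) ^ Suc k" by simp
  moreover have "1 \<le> Suc N0" by simp
  ultimately show ?thesis by blast
qed

section \<open>Deleting near twins\<close>

lemma sliceD:
  assumes "hereditary C" "E \<in> slice C n"
  shows "E \<subseteq> {..<n} \<times> {..<n}" "sym E" "irrefl E"
proof -
  have "ordered_graph (canonical n E)" using assms unfolding hereditary_def slice_def by blast
  then show "E \<subseteq> {..<n} \<times> {..<n}" "sym E" "irrefl E"
    by (simp_all add: ordered_graph_def canonical_def)
qed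

lemma finite_slice: "hereditary C \<Longrightarrow> finite (slice C n)"
  by (rule finite_subset[of _ "Pow ({..<n} \<times> {..<n})"]) (use sliceD(1) in blast, simp)

definition pullback :: "(nat \<Rightarrow> nat) \<Rightarrow> nat \<Rightarrow> nat rel \<Rightarrow> nat rel" where
  "pullback f m E = {(i, j). i < m \<and> j < m \<and> (f i, f j) \<in> E}"

lemma pullback_in_slice:
  assumes "hereditary C" "E \<in> slice C n" "\<And>i. i < m \<Longrightarrow> f i < n" "\<And>i j. i < j \<Longrightarrow> j < m \<Longrightarrow> f i < f j"
  shows "pullback f m E \<in> slice C m"
  unfolding slice_def
proof (rule CollectI, rule hereditary_embed[OF assms(1), of "canonical n E" _ f])
  show "ordered_graph (canonical m (pullback f m E))"
    unfolding canonical_def ordered_graph_nat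
    using sliceD(2,3)[OF assms(1,2)] by (auto simp: pullback_def sym_def irrefl_def)
qed (use assms in \<open>auto simp: slice_def canonical_def pullback_def\<close>)

definition remaining :: "nat \<Rightarrow> nat set \<Rightarrow> nat \<Rightarrow> nat" where
  "remaining n U = enumerate ({..<n} - U)"

lemma remaining:
  assumes "U \<subseteq> {..<n}"
  shows "bij_betw (remaining n U) {..<n - card U} ({..<n} - U)"
    and "i < j \<Longrightarrow> j < n - card U \<Longrightarrow> remaining n U i < remaining n U j"
proof -
  have c: "card ({..<n} - U) = n - card U" using assms finite_subset by (subst card_Diff_subset) auto
  show "bij_betw (remaining n U) {..<n - card U} ({..<n} - U)"
    unfolding remaining_def using finite_bij_enumerate[of "{..<n} - U"] c by simp
  show "i < j \<Longrightarrow> j < n - card U \<Longrightarrow> remaining n U i < remaining n U j"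
    unfolding remaining_def using finite_enumerate_mono[of i j "{..<n} - U"] c by simp
qed

text \<open>In its uses \<open>V\<close> contains exactly one vertex of the interval of length \<open>t\<close> around \<open>d\<close>.\<close>
definition twin_in :: "nat \<Rightarrow> nat set \<Rightarrow> nat \<Rightarrow> nat" where
  "twin_in t V d = (THE r. r \<in> V \<and> r div t = d div t)"

definition twin_difference :: "nat \<Rightarrow> nat \<Rightarrow> nat set \<Rightarrow> nat set \<Rightarrow> nat rel \<Rightarrow> nat rel" where
  "twin_difference n t U V E =
     {(d, v). d \<in> U \<and> v < n \<and> ((d, v) \<in> E) \<noteq> ((twin_in t V d, v) \<in> E)}"

text \<open>A row of a deleted vertex is recovered from that of its twin, first in the remaining columns; by symmetry this
  gives the columns of the deleted vertices in the remaining rows, and then their mutual adjacencies.\<close>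
lemma determined_by_deletion:
  assumes E: "E \<subseteq> {..<n} \<times> {..<n}" "sym E" and E': "E' \<subseteq> {..<n} \<times> {..<n}" "sym E'"
    and U: "U \<subseteq> {..<n}" and V: "\<And>d. d \<in> U \<Longrightarrow> twin_in t V d \<in> {..<n} - U"
    and D: "twin_difference n t U V E = twin_difference n t U V E'"
    and rest: "pullback (remaining n U) (n - card U) E = pullback (remaining n U) (n - card U) E'"
  shows "E = E'"
proof -
  let ?f = "remaining n U" and ?p = "twin_in t V"
  have outside: "(a, b) \<in> E \<longleftrightarrow> (a, b) \<in> E'" if a: "a \<in> {..<n} - U" "b \<in> {..<n} - U" for a b
  proof -
    have "?f ` {..<n - card U} = {..<n} - U" using remaining(1)[OF U] by (rule bij_betw_imp_surj_on)
    then obtain i j where ij: "i < n - card U" "j < n - card U" "a = ?f i" "b = ?f j"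
      using a by (metis (no_types, lifting) imageE lessThan_iff)
    have "(i, j) \<in> pullback ?f (n - card U) E \<longleftrightarrow> (i, j) \<in> pullback ?f (n - card U) E'" using rest by simp
    then show ?thesis using ij by (simp add: pullback_def)
  qed
  have dif: "((d, v) \<in> E) \<noteq> ((?p d, v) \<in> E) \<longleftrightarrow> ((d, v) \<in> E') \<noteq> ((?p d, v) \<in> E')"
    if "d \<in> U" "v < n" for d v
  proof -
    have "(d, v) \<in> twin_difference n t U V E \<longleftrightarrow> (d, v) \<in> twin_difference n t U V E'" using D by simp
    then show ?thesis using that by (simp add: twin_difference_def)
  qed
  have one: "(d, v) \<in> E \<longleftrightarrow> (d, v) \<in> E'" if "d \<in> U" "v \<in> {..<n} - U" for d v
    using dif[of d v] outside[OF V[OF that(1)] that(2)] that by auto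
  have one': "(v, d) \<in> E \<longleftrightarrow> (v, d) \<in> E'" if "d \<in> U" "v \<in> {..<n} - U" for d v
    using one[OF that] E(2) E'(2) by (meson symD)
  have two: "(d, d') \<in> E \<longleftrightarrow> (d, d') \<in> E'" if "d \<in> U" "d' \<in> U" for d d'
    using dif[of d d'] one'[OF that(2) V[OF that(1)]] that U by auto
  have "(a, b) \<in> E \<longleftrightarrow> (a, b) \<in> E'" for a b
  proof (cases "a < n \<and> b < n")
    case True
    then show ?thesis
      using outside[of a b] one[of a b] one'[of b a] two[of a b] by (cases "a \<in> U"; cases "b \<in> U") simp_all
  next
    case False
    then have "(a, b) \<notin> {..<n} \<times> {..<n}" by simp
    then show ?thesis using E(1) E'(1) by blast
  qed
  then show ?thesis by (intro equalityI subrelI) simp_all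
qed

lemma div_block: "0 < t \<Longrightarrow> (r div t = a) = (r \<in> {a * t..<a * t + t})" for r a t :: nat
  by (metis (no_types, lifting) add.commute atLeastLessThan_iff div_nat_eqI dividend_less_div_times mult.commute mult_Suc div_times_less_eq_dividend)

text \<open>An interval without near twins contributes \<open>c\<close> disjoint ranges of blocks with \<open>q\<close> distinct rows each. If
  this family has no grid, it is linear in the number of blocks, so for \<open>c = 4 * K + 1\<close> at most half of the
  intervals can be of this kind.\<close>
lemma few_bad_blocks:
  assumes q: "2 \<le> q"
    and noG: "\<And>F. rich_ranges n t E q F \<Longrightarrow> \<not> has_grid F N"
    and K: "\<And>m F. range_family F \<Longrightarrow> \<not> has_grid F N \<Longrightarrow>
        (\<And>a x y. (a, x, y) \<in> F \<Longrightarrow> a < m \<and> y < m) \<Longrightarrow> card F \<le> K * m"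
    and c: "c = 4 * K + 1" and t: "t = q ^ c" and n: "t \<le> n"
  shows "(n div t + 1) div 2 \<le> card {a. a < n div t \<and> (\<exists>r r'. r div t = a \<and> r' div t = a \<and> r \<noteq> r' \<and>
     card {b. b < n div t + 1 \<and> block_row n t E r b \<noteq> block_row n t E r' b} \<le> c)}"
    (is "_ \<le> card ?good")
proof -
  have t0: "0 < t" using t q by simp
  define m where "m = n div t + 1"
  define Bad where "Bad = {..<n div t} - ?good"
  have rows: "{r. r < n \<and> r div t = a} = {a * t..<a * t + t}" if "a < n div t" for a
  proof -
    have "Suc a * t \<le> n div t * t" using that by (intro mult_right_mono) auto
    also have "n div t * t \<le> n" by (rule div_times_less_eq_dividend)
    finally have "a * t + t \<le> n" by simp
    then show ?thesis using div_block[OF t0] by auto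
  qed
  define Rng where "Rng a x y \<longleftrightarrow> (\<forall>l<c. 0 \<le> x l \<and> x l \<le> y l \<and> y l < m \<and>
        q \<le> card ((\<lambda>r. restrict (block_row n t E r) {x l..y l}) ` {r. r < n \<and> r div t = a})) \<and>
      (\<forall>l<c. \<forall>l'<c. l < l' \<longrightarrow> y l < x l')" for a and x y :: "nat \<Rightarrow> nat"
  have "\<exists>x y. Rng a x y" if a: "a \<in> Bad" for a
    unfolding Rng_def
  proof (rule disjoint_distinguishing_ranges)
    have an: "a < n div t" using a unfolding Bad_def by auto
    show "q ^ c \<le> card {r. r < n \<and> r div t = a}" unfolding rows[OF an] using t by simp
    fix r r' assume "r \<in> {r. r < n \<and> r div t = a}" "r' \<in> {r. r < n \<and> r div t = a}" "r \<noteq> r'"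
    then have "\<not> card {b. b < n div t + 1 \<and> block_row n t E r b \<noteq> block_row n t E r' b} \<le> c"
      using a unfolding Bad_def by blast
    then show "c < card {b. 0 \<le> b \<and> b < m \<and> block_row n t E r b \<noteq> block_row n t E r' b}"
      unfolding m_def by simp
  qed (use q in auto)
  then obtain x y where "\<And>a. a \<in> Bad \<Longrightarrow> Rng a (x a) (y a)" by metis
  then have xy: "\<And>a l. a \<in> Bad \<Longrightarrow> l < c \<Longrightarrow> x a l \<le> y a l \<and> y a l < m \<and>
        q \<le> card ((\<lambda>r. restrict (block_row n t E r) {x a l..y a l}) ` {r. r < n \<and> r div t = a})"
    and dj: "\<And>a l l'. a \<in> Bad \<Longrightarrow> l < l' \<Longrightarrow> l' < c \<Longrightarrow> y a l < x a l'"
    unfolding Rng_def by simp_all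
  define F where "F = (\<lambda>(a, l). (a, x a l, y a l)) ` (Bad \<times> {..<c})"
  have Fi: "\<exists>l<c. p = x a l \<and> r = y a l \<and> a \<in> Bad" if "(a, p, r) \<in> F" for a p r
    using that unfolding F_def by auto
  have finB: "finite Bad" unfolding Bad_def by simp
  have "inj_on (\<lambda>(a, l). (a, x a l, y a l)) (Bad \<times> {..<c})"
  proof (rule inj_onI, clarsimp)
    fix a l l' assume *: "a \<in> Bad" "l < c" "l' < c" "x a l = x a l'" "y a l = y a l'"
    show "l = l'"
      using dj[OF *(1), of l l'] dj[OF *(1), of l' l] xy[OF *(1), of l] xy[OF *(1), of l'] *
      by (cases l l' rule: linorder_cases) auto
  qed
  then have cF: "card F = card Bad * c" unfolding F_def by (simp add: card_image card_cartesian_product)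
  have "range_family F" unfolding range_family_def
  proof (intro conjI allI)
    show "finite F" unfolding F_def using finB by simp
    fix a show "disjoint_ranges (F `` {a})"
    proof (rule disjoint_rangesI)
      fix p r assume "(p, r) \<in> F `` {a}"
      then obtain l where l: "l < c" "p = x a l" "r = y a l" "a \<in> Bad" using Fi by blast
      then show "p \<le> r" using xy[OF l(4,1)] by blast
    next
      fix p r p' r' assume "(p, r) \<in> F `` {a}" "(p', r') \<in> F `` {a}"
      then obtain l l' where l: "l < c" "p = x a l" "r = y a l" "a \<in> Bad" "l' < c" "p' = x a l'" "r' = y a l'"
        using Fi[of a p r] Fi[of a p' r'] by auto
      then show "(p, r) = (p', r') \<or> r < p' \<or> r' < p"
        using dj[OF l(4), of l l'] dj[OF l(4), of l' l] by (cases l l' rule: linorder_cases) auto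
    qed
  qed
  moreover have "rich_ranges n t E q F" unfolding rich_ranges_def
  proof clarify
    fix a p p' assume "(a, p, p') \<in> F"
    then obtain l where l: "l < c" "p = x a l" "p' = y a l" "a \<in> Bad" using Fi by blast
    show "q \<le> card ((\<lambda>r. restrict (block_row n t E r) {p..p'}) ` {r. r < n \<and> r div t = a})"
      unfolding l(2,3) using xy[OF l(4,1)] by blast
  qed
  then have "\<not> has_grid F N" by (rule noG)
  moreover have "a < m \<and> r < m" if "(a, p, r) \<in> F" for a p r
  proof -
    obtain l where l: "l < c" "p = x a l" "r = y a l" "a \<in> Bad" using Fi \<open>(a, p, r) \<in> F\<close> by blast
    have "a < m" using l(4) unfolding Bad_def m_def by auto
    then show ?thesis using xy[OF l(4,1)] l(3) by blast
  qed
  ultimately have "card F \<le> K * m" by (rule K)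
  moreover have "1 \<le> n div t" using n t0 by (simp add: Suc_le_eq div_greater_zero_iff)
  then have "K * m \<le> K * (2 * (n div t))" unfolding m_def by (intro mult_left_mono) auto
  ultimately have "card Bad * (4 * K + 1) \<le> K * (2 * (n div t))"
    unfolding cF c by (rule le_trans)
  then have main: "2 * K * (2 * card Bad) + card Bad \<le> 2 * K * (n div t)" by (simp add: algebra_simps)
  have "2 * card Bad \<le> n div t"
  proof (rule ccontr)
    assume large: "\<not> 2 * card Bad \<le> n div t"
    then have "2 * K * (n div t) \<le> 2 * K * (2 * card Bad)" by (intro mult_left_mono) auto
    then have "card Bad = 0" using main by linarith
    then show False using large by simp
  qed
  moreover have "card {..<n div t} \<le> card Bad + card ?good"
  proof -
    have "{..<n div t} \<subseteq> Bad \<union> ?good" unfolding Bad_def by auto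
    then have "card {..<n div t} \<le> card (Bad \<union> ?good)" by (intro card_mono) (auto simp: finB)
    then show ?thesis using card_Un_le[of Bad ?good] by linarith
  qed
  ultimately show ?thesis by simp
qed

lemma near_twin_differences:
  assumes t: "0 < t" and c: "card {b. b < n div t + 1 \<and> block_row n t E r b \<noteq> block_row n t E r' b} \<le> c"
  shows "card {v. v < n \<and> ((r, v) \<in> E) \<noteq> ((r', v) \<in> E)} \<le> c * t"
proof -
  let ?B = "{b. b < n div t + 1 \<and> block_row n t E r b \<noteq> block_row n t E r' b}"
  have "{v. v < n \<and> ((r, v) \<in> E) \<noteq> ((r', v) \<in> E)} \<subseteq> (\<Union>b\<in>?B. {b * t..<b * t + t})"
  proof
    fix v assume v: "v \<in> {v. v < n \<and> ((r, v) \<in> E) \<noteq> ((r', v) \<in> E)}"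
    then have "v div t < n div t + 1" using div_le_mono[of v n t] by simp
    moreover have "v \<in> block_row n t E r (v div t) \<longleftrightarrow> v \<notin> block_row n t E r' (v div t)"
      using v unfolding block_row_def by auto
    then have "block_row n t E r (v div t) \<noteq> block_row n t E r' (v div t)" by blast
    moreover have "v \<in> {v div t * t..<v div t * t + t}" using div_block[OF t, of v "v div t"] by blast
    ultimately show "v \<in> (\<Union>b\<in>?B. {b * t..<b * t + t})" by blast
  qed
  then have "card {v. v < n \<and> ((r, v) \<in> E) \<noteq> ((r', v) \<in> E)} \<le> card (\<Union>b\<in>?B. {b * t..<b * t + t})"
    by (intro card_mono) auto
  also have "\<dots> \<le> (\<Sum>b\<in>?B. card {b * t..<b * t + t})" by (rule card_UN_le) simp
  also have "\<dots> = card ?B * t" by simp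
  also have "\<dots> \<le> c * t" using c by (rule mult_right_mono) simp
  finally show ?thesis .
qed

text \<open>At least half of the intervals of length \<open>t\<close> contain near twins. Deleting one vertex of each of \<open>s n\<close>
  pairs leaves a smaller member of the class, and the deleted part is described by two sets of vertices and
  a grid-free relation. This gives a factor \<open>(4 * L) ^ n\<close> for the removal of at least \<open>n / (4 * t)\<close> vertices,
  and hence an exponential bound.\<close>
theorem slice_bounded_if_not_contains_listed:
  assumes C: "hereditary C" and nc: "\<not> contains_listed C h"
  shows "\<exists>M\<ge>1. \<forall>n. card (slice C n) \<le> M ^ n"
proof -
  obtain N1 q where N1: "N1 \<ge> 1" "q \<ge> 2" and rich: "\<forall>C n E F t. host C n E \<longrightarrow>
     rich_ranges n t E q F \<longrightarrow> has_grid F N1 \<longrightarrow> contains_listed C h"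
    using contains_listed_if_rich_grid[of h] by (elim exE conjE)
  obtain K where K: "\<forall>m F. range_family F \<longrightarrow> \<not> has_grid F N1 \<longrightarrow>
     (\<forall>a x y. (a, x, y) \<in> F \<longrightarrow> a < m \<and> y < m) \<longrightarrow> card F \<le> K * m"
    using grid_free_range_family_linear[OF N1(1)] by (rule exE)
  define c where "c = 4 * K + 1"
  define t where "t = q ^ c"
  have t0: "0 < t" unfolding t_def using N1(2) by simp
  obtain N2 where N2: "N2 \<ge> 1" and twin: "\<forall>C n E D p. host C n E \<longrightarrow>
     near_twin_pairs n E (c * t) p D \<longrightarrow> has_grid (point_ranges D) N2 \<longrightarrow> contains_listed C h"
    using contains_listed_if_near_twin_grid[of "c * t" h] by (elim exE conjE)
  obtain L where L: "L \<ge> 1" "\<forall>n. card {D. D \<subseteq> {..<n} \<times> {..<n} \<and> \<not> has_grid (point_ranges D) N2} \<le> L ^ n"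
    using card_grid_free_relations[OF N2] by (elim exE conjE)
  define GF where "GF n = {D. D \<subseteq> {..<n} \<times> {..<n} \<and> \<not> has_grid (point_ranges D) N2}" for n
  have finGF: "finite (GF n)" for n
    by (rule finite_subset[of _ "Pow ({..<n} \<times> {..<n})"]) (auto simp: GF_def)
  define s where "s n = (n div t + 1) div 2" for n
  define deletable where "deletable n E U V \<longleftrightarrow> U \<subseteq> {..<n} \<and> V \<subseteq> {..<n} \<and> card U = s n \<and>
      (\<forall>d\<in>U. twin_in t V d \<in> {..<n} - U) \<and> twin_difference n t U V E \<in> GF n" for n E U V
  have deletion: "\<exists>U V. deletable n E U V" if n: "t \<le> n" and E: "E \<in> slice C n" for n E
  proof -
    have host: "host C n E" using C E by unfold_locales
    define good where "good = {a. a < n div t \<and> (\<exists>r r'. r div t = a \<and> r' div t = a \<and> r \<noteq> r' \<and>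
       card {b. b < n div t + 1 \<and> block_row n t E r b \<noteq> block_row n t E r' b} \<le> c)}"
    have "s n \<le> card good"
      unfolding s_def good_def
    proof (rule few_bad_blocks[OF N1(2), of n t E N1 K c])
      show "\<not> has_grid F N1" if "rich_ranges n t E q F" for F
        using rich host nc that by blast
      show "card F \<le> K * m" if "range_family F" "\<not> has_grid F N1"
        "\<And>a x y. (a, x, y) \<in> F \<Longrightarrow> a < m \<and> y < m" for m F
        using K that by blast
    qed (use n c_def t_def in auto)
    then obtain S where S: "S \<subseteq> good" "card S = s n" by (meson obtain_subset_with_card_n)
    define twins where "twins a r r' \<longleftrightarrow> r div t = a \<and> r' div t = a \<and> r \<noteq> r' \<and>
       card {b. b < n div t + 1 \<and> block_row n t E r b \<noteq> block_row n t E r' b} \<le> c" for a r r'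
    have "good = {a. a < n div t \<and> (\<exists>r r'. twins a r r')}" unfolding good_def twins_def ..
    then have "\<exists>r r'. twins a r r'" if "a \<in> S" for a using S(1) that by auto
    then obtain r r' where "\<And>a. a \<in> S \<Longrightarrow> twins a (r a) (r' a)" by metis
    then have rr: "\<And>a. a \<in> S \<Longrightarrow> r a div t = a \<and> r' a div t = a \<and> r a \<noteq> r' a \<and>
       card {b. b < n div t + 1 \<and> block_row n t E (r a) b \<noteq> block_row n t E (r' a) b} \<le> c"
      unfolding twins_def .
    define U where "U = r' ` S"
    define V where "V = r ` S"
    have bd: "p < n" if "p div t \<in> S" for p
    proof -
      have "p div t < n div t" using S(1) that unfolding good_def by auto
      then show ?thesis using div_le_mono[of n p t] by linarith
    qed
    have UV: "U \<subseteq> {..<n}" "V \<subseteq> {..<n}" unfolding U_def V_def using bd rr by auto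
    have tw: "twin_in t V d = r (d div t)" "d div t \<in> S" "d = r' (d div t)" if "d \<in> U" for d
    proof -
      obtain a where a: "a \<in> S" "d = r' a" using \<open>d \<in> U\<close> unfolding U_def by blast
      then have d: "d div t = a" using rr by auto
      show "d div t \<in> S" "d = r' (d div t)" using a d by auto
      show "twin_in t V d = r (d div t)" unfolding twin_in_def
      proof (rule the_equality)
        show "r (d div t) \<in> V \<and> r (d div t) div t = d div t" using a d rr unfolding V_def by auto
        show "p = r (d div t)" if p: "p \<in> V \<and> p div t = d div t" for p
          using p rr unfolding V_def by auto
      qed
    qed
    have "card U = s n"
    proof -
      have "inj_on r' S" by (rule inj_onI) (metis rr)
      then show ?thesis unfolding U_def using S(2) card_image by metis
    qed
    moreover have "twin_in t V d \<in> {..<n} - U" if "d \<in> U" for d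
    proof -
      have a: "d div t \<in> S" using tw that by blast
      have "r (d div t) \<notin> U"
      proof
        assume "r (d div t) \<in> U"
        then have "r (d div t) = r' (r (d div t) div t)" using tw(3) by blast
        then show False using rr[OF a] by auto
      qed
      moreover have "r (d div t) < n" using bd rr[OF a] a by auto
      ultimately show ?thesis using tw(1)[OF that] by auto
    qed
    moreover have "twin_difference n t U V E \<in> GF n"
    proof -
      let ?D = "twin_difference n t U V E"
      have Dn: "?D \<subseteq> {..<n} \<times> {..<n}" unfolding twin_difference_def using UV by auto
      have "\<not> has_grid (point_ranges ?D) N2"
      proof
        assume g: "has_grid (point_ranges ?D) N2"
        have p1: "twin_in t V a < n \<and> ((a, v) \<in> E) \<noteq> ((twin_in t V a, v) \<in> E) \<and>
          card {v. v < n \<and> ((a, v) \<in> E) \<noteq> ((twin_in t V a, v) \<in> E)} \<le> c * t" if "(a, v) \<in> ?D" for a v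
        proof -
          have a: "a \<in> U" "((a, v) \<in> E) \<noteq> ((twin_in t V a, v) \<in> E)"
            using that unfolding twin_difference_def by auto
          have "card {v. v < n \<and> ((r (a div t), v) \<in> E) \<noteq> ((r' (a div t), v) \<in> E)} \<le> c * t"
            using near_twin_differences[OF t0] rr[OF tw(2)[OF a(1)]] by blast
          then have "card {v. v < n \<and> ((twin_in t V a, v) \<in> E) \<noteq> ((a, v) \<in> E)} \<le> c * t"
            using tw(1,3)[OF a(1)] by simp
          moreover have "{v. v < n \<and> ((twin_in t V a, v) \<in> E) \<noteq> ((a, v) \<in> E)} =
            {v. v < n \<and> ((a, v) \<in> E) \<noteq> ((twin_in t V a, v) \<in> E)}" by blast
          moreover have "twin_in t V a < n" using bd rr tw[OF a(1)] by simp
          ultimately show ?thesis using a(2) by simp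
        qed
        have p2: "max a (twin_in t V a) < min a' (twin_in t V a')"
          if "(a, v) \<in> ?D" "(a', v') \<in> ?D" "a < a'" for a v a' v'
        proof -
          have a: "a \<in> U" "a' \<in> U" using that unfolding twin_difference_def by auto
          have "a div t \<noteq> a' div t" using tw(3)[OF a(1)] tw(3)[OF a(2)] that(3) by auto
          then have l: "a div t < a' div t" using div_le_mono[of a a' t] that(3) by simp
          have less: "p < p'" if "p div t = a div t" "p' div t = a' div t" for p p'
            using l that div_le_mono[of p' p t] by linarith
          have d: "twin_in t V a div t = a div t" "twin_in t V a' div t = a' div t"
            unfolding tw(1)[OF a(1)] tw(1)[OF a(2)] using rr[OF tw(2)[OF a(1)]] rr[OF tw(2)[OF a(2)]] by blast+
          show ?thesis using less[OF refl refl] less[OF refl d(2)] less[OF d(1) refl] less[OF d] by simp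
        qed
        have "near_twin_pairs n E (c * t) (twin_in t V) ?D"
          unfolding near_twin_pairs_def using Dn p1 p2 by auto
        then have "contains_listed C h" using twin host g by blast
        then show False using nc by blast
      qed
      then show ?thesis unfolding GF_def using Dn by blast
    qed
    ultimately have "deletable n E U V" unfolding deletable_def using UV by blast
    then show ?thesis by blast
  qed
  have step: "card (slice C n) \<le> (4 * L) ^ n * card (slice C (n - s n))" if n: "t \<le> n" for n
  proof -
    obtain U V where "\<And>E. E \<in> slice C n \<Longrightarrow> deletable n E (U E) (V E)"
      using deletion[OF n] by metis
    then have UV: "\<And>E. E \<in> slice C n \<Longrightarrow> U E \<subseteq> {..<n} \<and> V E \<subseteq> {..<n} \<and> card (U E) = s n \<and>
      (\<forall>d\<in>U E. twin_in t (V E) d \<in> {..<n} - U E) \<and> twin_difference n t (U E) (V E) E \<in> GF n"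
      unfolding deletable_def .
    define code where "code E = (U E, V E, twin_difference n t (U E) (V E) E,
      pullback (remaining n (U E)) (n - s n) E)" for E
    have "inj_on code (slice C n)"
    proof (rule inj_onI)
      fix E E' assume E: "E \<in> slice C n" "E' \<in> slice C n" and eq: "code E = code E'"
      then have eq': "U E' = U E" "V E' = V E"
        "twin_difference n t (U E) (V E) E = twin_difference n t (U E) (V E) E'"
        "pullback (remaining n (U E)) (n - card (U E)) E = pullback (remaining n (U E)) (n - card (U E)) E'"
        using UV[OF E(1)] unfolding code_def by auto
      show "E = E'"
        by (rule determined_by_deletion[OF sliceD(1,2)[OF C E(1)] sliceD(1,2)[OF C E(2)] _ _ eq'(3,4)])
          (use UV[OF E(1)] in auto)
    qed
    moreover have "code ` slice C n \<subseteq> Pow {..<n} \<times> Pow {..<n} \<times> GF n \<times> slice C (n - s n)"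
    proof
      fix z assume "z \<in> code ` slice C n"
      then obtain E where E: "E \<in> slice C n" "z = code E" by blast
      note uv = UV[OF E(1)]
      have "pullback (remaining n (U E)) (n - s n) E \<in> slice C (n - s n)"
      proof (rule pullback_in_slice[OF C E(1)])
        show "remaining n (U E) i < n" if "i < n - s n" for i
          using bij_betwE[OF remaining(1)[of "U E" n]] uv that by auto
        show "remaining n (U E) i < remaining n (U E) j" if "i < j" "j < n - s n" for i j
          using remaining(2)[of "U E" n] uv that by auto
      qed
      then show "z \<in> Pow {..<n} \<times> Pow {..<n} \<times> GF n \<times> slice C (n - s n)"
        unfolding E(2) code_def using uv by auto
    qed
    ultimately have "card (slice C n) \<le> card (Pow {..<n} \<times> Pow {..<n} \<times> GF n \<times> slice C (n - s n))"
      using finGF finite_slice[OF C] by (intro card_inj_on_le) auto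
    also have "\<dots> = 2 ^ n * (2 ^ n * (card (GF n) * card (slice C (n - s n))))"
      by (simp add: card_cartesian_product card_Pow)
    also have "\<dots> \<le> 2 ^ n * (2 ^ n * (L ^ n * card (slice C (n - s n))))"
      using L(2) unfolding GF_def by (intro mult_left_mono mult_right_mono) auto
    also have "\<dots> = (4 * L) ^ n * card (slice C (n - s n))"
    proof -
      have "4 * L = 2 * (2 * L)" by simp
      then have "(4 * L) ^ n = 2 ^ n * (2 ^ n * L ^ n)" by (simp only: power_mult_distrib)
      then show ?thesis by (simp only: mult.assoc)
    qed
    finally show ?thesis .
  qed
  define M where "M = (4 * L) ^ (4 * t) * 2 ^ t"
  have M1: "1 \<le> M" unfolding M_def using L(1) by simp
  have "card (slice C n) \<le> M ^ n" for n
  proof (induction n rule: less_induct)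
    case (less n)
    show ?case
    proof (cases "t \<le> n")
      case False
      have "card (slice C n) \<le> card (Pow ({..<n} \<times> {..<n}))"
        using sliceD(1)[OF C] by (intro card_mono) auto
      also have "\<dots> = (2 ^ n) ^ n" by (simp add: card_Pow card_cartesian_product flip: power_mult)
      also have "\<dots> \<le> (2 ^ t) ^ n" using False by (intro power_mono power_increasing) auto
      also have "\<dots> \<le> M ^ n" unfolding M_def using L(1) by (intro power_mono) auto
      finally show ?thesis .
    next
      case True
      have nt: "1 \<le> n div t" using True t0 by (simp add: Suc_le_eq div_greater_zero_iff)
      have s1: "1 \<le> s n" "n div t \<le> 2 * s n" unfolding s_def using nt by linarith+
      have sn: "s n \<le> n"
      proof -
        have "n div t \<le> n" by simp
        then show ?thesis unfolding s_def using nt by linarith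
      qed
      have "n < (n div t + 1) * t" using dividend_less_div_times[OF t0, of n] by simp
      also have "\<dots> \<le> (4 * s n) * t" using nt s1 by (intro mult_right_mono) linarith+
      also have "4 * s n * t = 4 * t * s n" by (simp only: mult.assoc mult.commute[of t])
      finally have n4: "n \<le> 4 * t * s n" by (rule less_imp_le)
      have "card (slice C n) \<le> (4 * L) ^ n * card (slice C (n - s n))" by (rule step[OF True])
      also have "\<dots> \<le> (4 * L) ^ n * M ^ (n - s n)" using less.IH[of "n - s n"] s1 sn by simp
      also have "(4 * L) ^ n \<le> (4 * L) ^ (4 * t * s n)" using n4 L(1) by (intro power_increasing) auto
      also have "\<dots> = ((4 * L) ^ (4 * t)) ^ s n" by (rule power_mult)
      also have "\<dots> \<le> M ^ s n" unfolding M_def by (intro power_mono) auto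
      also have "M ^ s n * M ^ (n - s n) = M ^ n" using sn by (simp flip: power_add)
      finally show ?thesis by simp
    qed
  qed
  then show ?thesis using M1 by blast
qed

section \<open>Growth and hereditary closure\<close>

lemma ograph_iso_sym:
  assumes "G \<cong>\<^sub>o H"
  shows "H \<cong>\<^sub>o G"
proof -
  obtain f where f: "bij_betw f (verts G) (verts H)"
    "\<And>u v. u \<in> verts G \<Longrightarrow> v \<in> verts G \<Longrightarrow> ((u, v) \<in> edges G \<longleftrightarrow> (f u, f v) \<in> edges H) \<and>
      ((u, v) \<in> ord G \<longleftrightarrow> (f u, f v) \<in> ord H)"
    using assms unfolding ograph_iso_def by blast
  let ?g = "inv_into (verts G) f"
  have g: "?g x \<in> verts G" "f (?g x) = x" if "x \<in> verts H" for x
    using f(1) that by (auto simp: bij_betw_def inv_into_into f_inv_into_f)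
  show ?thesis unfolding ograph_iso_def
  proof (intro exI[of _ ?g] conjI ballI)
    show "bij_betw ?g (verts H) (verts G)" using f(1) by (rule bij_betw_inv_into)
    fix x y assume xy: "x \<in> verts H" "y \<in> verts H"
    show "(x, y) \<in> edges H \<longleftrightarrow> (?g x, ?g y) \<in> edges G" "(x, y) \<in> ord H \<longleftrightarrow> (?g x, ?g y) \<in> ord G"
      using f(2)[OF g(1)[OF xy(1)] g(1)[OF xy(2)]] g(2)[OF xy(1)] g(2)[OF xy(2)] by simp_all
  qed
qed

lemma ograph_iso_trans:
  assumes "G \<cong>\<^sub>o H" "H \<cong>\<^sub>o K"
  shows "G \<cong>\<^sub>o K"
proof -
  obtain f where f: "bij_betw f (verts G) (verts H)"
    "\<And>u v. u \<in> verts G \<Longrightarrow> v \<in> verts G \<Longrightarrow> ((u, v) \<in> edges G \<longleftrightarrow> (f u, f v) \<in> edges H) \<and>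
      ((u, v) \<in> ord G \<longleftrightarrow> (f u, f v) \<in> ord H)"
    using assms(1) unfolding ograph_iso_def by blast
  obtain g where g: "bij_betw g (verts H) (verts K)"
    "\<And>u v. u \<in> verts H \<Longrightarrow> v \<in> verts H \<Longrightarrow> ((u, v) \<in> edges H \<longleftrightarrow> (g u, g v) \<in> edges K) \<and>
      ((u, v) \<in> ord H \<longleftrightarrow> (g u, g v) \<in> ord K)"
    using assms(2) unfolding ograph_iso_def by blast
  have fH: "f u \<in> verts H" if "u \<in> verts G" for u using bij_betwE[OF f(1)] that by blast
  show ?thesis unfolding ograph_iso_def
  proof (intro exI[of _ "g \<circ> f"] conjI ballI)
    show "bij_betw (g \<circ> f) (verts G) (verts K)" using f(1) g(1) by (rule bij_betw_trans)
    fix u v assume "u \<in> verts G" "v \<in> verts G"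
    then show "(u, v) \<in> edges G \<longleftrightarrow> ((g \<circ> f) u, (g \<circ> f) v) \<in> edges K"
      "(u, v) \<in> ord G \<longleftrightarrow> ((g \<circ> f) u, (g \<circ> f) v) \<in> ord K"
      using f(2) g(2) fH by simp_all
  qed
qed

lemma ograph_iso_refl: "G \<cong>\<^sub>o G"
  unfolding ograph_iso_def by (intro exI[of _ id]) auto

lemma ordered_graph_induced:
  assumes "ordered_graph G" "W \<subseteq> verts G"
  shows "ordered_graph (induced G W)"
proof -
  have "linear_order_on W (ord G \<inter> W \<times> W)"
    using assms unfolding ordered_graph_def linear_order_on_def partial_order_on_def preorder_on_def
      refl_on_def trans_def antisym_def total_on_def by (auto; blast)
  then show ?thesis
    using assms unfolding ordered_graph_def induced_def
    by (auto simp: sym_def irrefl_def intro: finite_subset)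
qed

lemma induced_iso:
  assumes "H \<cong>\<^sub>o K" "W \<subseteq> verts H"
  shows "\<exists>W' \<subseteq> verts K. induced H W \<cong>\<^sub>o induced K W'"
proof -
  obtain f where f: "bij_betw f (verts H) (verts K)"
    "\<And>u v. u \<in> verts H \<Longrightarrow> v \<in> verts H \<Longrightarrow> ((u, v) \<in> edges H \<longleftrightarrow> (f u, f v) \<in> edges K) \<and>
      ((u, v) \<in> ord H \<longleftrightarrow> (f u, f v) \<in> ord K)"
    using assms(1) unfolding ograph_iso_def by blast
  have b: "bij_betw f W (f ` W)" using f(1) assms(2) by (meson bij_betw_subset subset_refl)
  have e: "((u, v) \<in> edges H \<longleftrightarrow> (f u, f v) \<in> edges K) \<and> ((u, v) \<in> ord H \<longleftrightarrow> (f u, f v) \<in> ord K)"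
    if "u \<in> W" "v \<in> W" for u v using f(2) that assms(2) by blast
  have "induced H W \<cong>\<^sub>o induced K (f ` W)"
    unfolding ograph_iso_def
  proof (intro exI[of _ f] conjI ballI)
    show "bij_betw f (verts (induced H W)) (verts (induced K (f ` W)))" using b by (simp add: induced_def)
    fix u v assume "u \<in> verts (induced H W)" "v \<in> verts (induced H W)"
    then have uv: "u \<in> W" "v \<in> W" by (simp_all add: induced_def)
    then show "(u, v) \<in> edges (induced H W) \<longleftrightarrow> (f u, f v) \<in> edges (induced K (f ` W))"
      "(u, v) \<in> ord (induced H W) \<longleftrightarrow> (f u, f v) \<in> ord (induced K (f ` W))"
      using e[OF uv] by (simp_all add: induced_def)
  qed
  moreover have "f ` W \<subseteq> verts K" using bij_betw_imp_surj_on[OF f(1)] assms(2) by blast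
  ultimately show ?thesis by blast
qed

lemma induced_induced: "W' \<subseteq> W \<Longrightarrow> induced (induced G W) W' = induced G W'"
  unfolding induced_def by auto

lemma hereditary_hereditary_closure:
  assumes "\<And>G. G \<in> S \<Longrightarrow> ordered_graph G"
  shows "hereditary (hereditary_closure S)"
  unfolding hereditary_def
proof (intro conjI ballI allI impI)
  fix G assume G: "G \<in> hereditary_closure S"
  then show "ordered_graph G" unfolding hereditary_closure_def by blast
  fix H :: "nat ograph" assume "ordered_graph H \<and> H \<cong>\<^sub>o G"
  then show "H \<in> hereditary_closure S"
    using G ograph_iso_trans unfolding hereditary_closure_def by blast
next
  fix G W assume G: "G \<in> hereditary_closure S" and W: "W \<subseteq> verts G"
  obtain K U where K: "K \<in> S" "U \<subseteq> verts K" "G \<cong>\<^sub>o induced K U" "ordered_graph G"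
    using G unfolding hereditary_closure_def by blast
  obtain W' where W': "W' \<subseteq> verts (induced K U)" "induced G W \<cong>\<^sub>o induced (induced K U) W'"
    using induced_iso[OF K(3) W] by blast
  have "W' \<subseteq> U" using W'(1) by (simp add: induced_def)
  moreover have "induced G W \<cong>\<^sub>o induced K W'" using W'(2) unfolding induced_induced[OF \<open>W' \<subseteq> U\<close>] .
  ultimately show "induced G W \<in> hereditary_closure S"
    using K(1,2) ordered_graph_induced[OF K(4) W] unfolding hereditary_closure_def by blast
qed

lemma hereditary_M_class: "hereditary (M_class s lam rho)"
  unfolding M_class_def
  by (rule hereditary_hereditary_closure) (auto simp: ordered_graph_M_graph)

text \<open>The standardization of a pattern: positions and values in \<open>W\<close> are replaced by their ranks.\<close>
lemma induced_permutation_ograph: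
  assumes \<pi>: "\<pi> permutes {1..n}" and W: "W \<subseteq> {1..n}"
  shows "\<exists>k \<sigma>. \<sigma> permutes {1..k} \<and> permutation_ograph k \<sigma> \<cong>\<^sub>o induced (permutation_ograph n \<pi>) W"
proof -
  have finW: "finite W" using W finite_subset by blast
  define k where "k = card W"
  obtain h0 where h0: "bij_betw h0 {..<k} W" "strict_mono_on {..<k} h0"
    using ex_bij_betw_strict_mono_card[OF finW] unfolding k_def .
  define h where "h i = h0 (i - 1)" for i
  have "bij_betw (\<lambda>i. i - 1) {1..k} {..<k}"
    by (rule bij_betwI[of _ _ _ Suc]) auto
  then have h: "bij_betw h {1..k} W"
    using bij_betw_trans[OF _ h0(1)] unfolding h_def comp_def by blast
  have hm: "h i < h j" if "i < j" "i \<in> {1..k}" "j \<in> {1..k}" for i j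
    unfolding h_def by (rule strict_mono_onD[OF h0(2)]) (use that in auto)
  have hle: "i \<le> j \<longleftrightarrow> h i \<le> h j" if "i \<in> {1..k}" "j \<in> {1..k}" for i j
    using hm[of i j] hm[of j i] that by (cases i j rule: linorder_cases) auto
  define \<sigma> where "\<sigma> i = (if i \<in> {1..k} then card {j \<in> {1..k}. \<pi> (h j) \<le> \<pi> (h i)} else i)" for i
  have inj: "\<pi> (h i) \<noteq> \<pi> (h j)" if "i \<noteq> j" "i \<in> {1..k}" "j \<in> {1..k}" for i j
    using h permutes_inj[OF \<pi>] that by (metis bij_betw_imp_inj_on inj_onD injD)
  have mono: "\<sigma> i < \<sigma> j" if "\<pi> (h i) < \<pi> (h j)" "i \<in> {1..k}" "j \<in> {1..k}" for i j
  proof -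
    have "j \<in> {l \<in> {1..k}. \<pi> (h l) \<le> \<pi> (h j)}" "j \<notin> {l \<in> {1..k}. \<pi> (h l) \<le> \<pi> (h i)}" using that by auto
    moreover have "{l \<in> {1..k}. \<pi> (h l) \<le> \<pi> (h i)} \<subseteq> {l \<in> {1..k}. \<pi> (h l) \<le> \<pi> (h j)}" using that by auto
    ultimately have "{l \<in> {1..k}. \<pi> (h l) \<le> \<pi> (h i)} \<subset> {l \<in> {1..k}. \<pi> (h l) \<le> \<pi> (h j)}" by blast
    then have "card {l \<in> {1..k}. \<pi> (h l) \<le> \<pi> (h i)} < card {l \<in> {1..k}. \<pi> (h l) \<le> \<pi> (h j)}"
      by (intro psubset_card_mono) auto
    then show ?thesis unfolding \<sigma>_def using that by simp
  qed
  have less: "\<sigma> i < \<sigma> j \<longleftrightarrow> \<pi> (h i) < \<pi> (h j)" if "i \<in> {1..k}" "j \<in> {1..k}" for i j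
    using mono[of i j] mono[of j i] inj[of i j] that by (cases "i = j") (auto simp: not_less_iff_gr_or_eq neq_iff)
  have "\<sigma> permutes {1..k}"
  proof (rule bij_imp_permutes)
    have "inj_on \<sigma> {1..k}"
    proof (rule inj_onI, rule ccontr)
      fix i j assume "i \<in> {1..k}" "j \<in> {1..k}" "\<sigma> i = \<sigma> j" "i \<noteq> j"
      then show False using less[of i j] less[of j i] inj[of i j] by (auto simp: neq_iff)
    qed
    moreover have "\<sigma> ` {1..k} \<subseteq> {1..k}"
    proof
      fix x assume "x \<in> \<sigma> ` {1..k}"
      then obtain i where i: "i \<in> {1..k}" "x = card {j \<in> {1..k}. \<pi> (h j) \<le> \<pi> (h i)}" unfolding \<sigma>_def by auto
      have "card {j \<in> {1..k}. \<pi> (h j) \<le> \<pi> (h i)} \<le> card {1..k}" by (intro card_mono) auto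
      moreover have "card {j \<in> {1..k}. \<pi> (h j) \<le> \<pi> (h i)} \<noteq> 0" using i by auto
      ultimately show "x \<in> {1..k}" unfolding i(2) atLeastAtMost_iff card_atLeastAtMost by linarith
    qed
    ultimately show "bij_betw \<sigma> {1..k} {1..k}"
      by (simp add: bij_betw_def endo_inj_surj)
    show "\<sigma> i = i" if "i \<notin> {1..k}" for i unfolding \<sigma>_def using that by (rule if_not_P)
  qed
  moreover have "permutation_ograph k \<sigma> \<cong>\<^sub>o induced (permutation_ograph n \<pi>) W"
    unfolding ograph_iso_def
  proof (intro exI[of _ h] conjI ballI)
    show "bij_betw h (verts (permutation_ograph k \<sigma>)) (verts (induced (permutation_ograph n \<pi>) W))"
      using h by (simp add: induced_def permutation_ograph_simps)
    fix u v assume "u \<in> verts (permutation_ograph k \<sigma>)" "v \<in> verts (permutation_ograph k \<sigma>)"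
    then have uv: "u \<in> {1..k}" "v \<in> {1..k}" by (simp_all add: permutation_ograph_simps)
    then have hW: "h u \<in> W" "h v \<in> W" using h bij_betwE by blast+
    then have hn: "h u \<in> {1..n}" "h v \<in> {1..n}" using W by blast+
    show "(u, v) \<in> ord (permutation_ograph k \<sigma>) \<longleftrightarrow> (h u, h v) \<in> ord (induced (permutation_ograph n \<pi>) W)"
      using hle[OF uv] uv hW hn by (simp add: induced_def permutation_ograph_simps nat_ord_def)
    have E: "(i, j) \<in> edges (permutation_ograph m \<tau>) \<longleftrightarrow> (i < j \<and> \<tau> j < \<tau> i) \<or> (j < i \<and> \<tau> i < \<tau> j)"
      if "i \<in> {1..m}" "j \<in> {1..m}" for i j m \<tau>
      using that by (auto simp: permutation_ograph_def Let_def)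
    have "u < v \<longleftrightarrow> h u < h v" "v < u \<longleftrightarrow> h v < h u"
      using hle[OF uv] hle[OF uv(2,1)] by (simp_all add: not_le[symmetric])
    then show "(u, v) \<in> edges (permutation_ograph k \<sigma>) \<longleftrightarrow> (h u, h v) \<in> edges (induced (permutation_ograph n \<pi>) W)"
      using hW less[OF uv] less[OF uv(2,1)] unfolding E[OF uv] by (simp add: induced_def E[OF hn])
  qed
  ultimately show ?thesis by blast
qed

lemma hereditary_P_class: "hereditary P_class"
  unfolding hereditary_def
proof (intro conjI ballI allI impI)
  fix G assume G: "G \<in> P_class"
  then show "ordered_graph G" unfolding P_class_def by blast
  fix H :: "nat ograph" assume "ordered_graph H \<and> H \<cong>\<^sub>o G"
  then show "H \<in> P_class"
    using G ograph_iso_trans unfolding P_class_def by blast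
next
  fix G W assume G: "G \<in> P_class" and W: "W \<subseteq> verts G"
  obtain n \<pi> where n: "\<pi> permutes {1..n}" "G \<cong>\<^sub>o permutation_ograph n \<pi>" "ordered_graph G"
    using G unfolding P_class_def by blast
  obtain W' where W': "W' \<subseteq> {1..n}" "induced G W \<cong>\<^sub>o induced (permutation_ograph n \<pi>) W'"
    using induced_iso[OF n(2) W] unfolding permutation_ograph_simps by blast
  obtain k \<sigma> where "\<sigma> permutes {1..k}" "permutation_ograph k \<sigma> \<cong>\<^sub>o induced (permutation_ograph n \<pi>) W'"
    using induced_permutation_ograph[OF n(1) W'(1)] by blast
  then show "induced G W \<in> P_class"
    using W'(2) ograph_iso_sym ograph_iso_trans ordered_graph_induced[OF n(3) W]
    unfolding P_class_def by blast
qed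

lemma increasing_bijection_is_identity:
  fixes f :: "nat \<Rightarrow> nat"
  assumes f: "\<And>i. i < n \<Longrightarrow> f i < n" "\<And>i j. i < j \<Longrightarrow> j < n \<Longrightarrow> f i < f j" and i: "i < n"
  shows "f i = i"
proof (rule antisym)
  have inj: "inj_on f {..<n}" by (rule linorder_inj_onI) (use f(2) in \<open>auto simp: less_imp_neq\<close>)
  have "card (f ` {..<i}) \<le> card {..<f i}" using f(2) i by (intro card_mono) auto
  moreover have "card (f ` {..<i}) = i"
    using card_image[OF inj_on_subset[OF inj, of "{..<i}"]] i by auto
  ultimately show "i \<le> f i" by simp
  have "card (f ` {i<..<n}) \<le> card {f i<..<n}" using f i by (intro card_mono) auto
  moreover have "card (f ` {i<..<n}) = card {i<..<n}"
    by (rule card_image[OF inj_on_subset[OF inj]]) auto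
  ultimately show "f i \<le> i" using f(1)[OF i] i by simp
qed

text \<open>The rank of a vertex is the number of smaller vertices.\<close>
lemma ordered_graph_rank:
  assumes "ordered_graph G"
  shows "\<exists>f. bij_betw f (verts G) {..<card (verts G)} \<and>
    (\<forall>u\<in>verts G. \<forall>v\<in>verts G. (u, v) \<in> ord G \<longleftrightarrow> f u \<le> f v)"
proof -
  let ?V = "verts G" and ?r = "ord G"
  have fin: "finite ?V" and lin: "linear_order_on ?V ?r" using assms unfolding ordered_graph_def by auto
  have refl: "(u, u) \<in> ?r" if "u \<in> ?V" for u
    using lin that unfolding linear_order_on_def partial_order_on_def preorder_on_def refl_on_def by blast
  have tr: "(u, w) \<in> ?r" if "(u, v) \<in> ?r" "(v, w) \<in> ?r" for u v w
    using lin that unfolding linear_order_on_def partial_order_on_def preorder_on_def trans_def by blast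
  have as: "u = v" if "(u, v) \<in> ?r" "(v, u) \<in> ?r" for u v
    using lin that unfolding linear_order_on_def partial_order_on_def antisym_def by blast
  have tot: "(u, v) \<in> ?r \<or> (v, u) \<in> ?r" if "u \<in> ?V" "v \<in> ?V" for u v
  proof (cases "u = v")
    case False
    then show ?thesis using lin that unfolding linear_order_on_def total_on_def by blast
  qed (use refl that in blast)
  define f where "f v = card {u \<in> ?V. (u, v) \<in> ?r \<and> u \<noteq> v}" for v
  have less: "f u < f v" if "(u, v) \<in> ?r" "u \<noteq> v" "u \<in> ?V" "v \<in> ?V" for u v
  proof -
    have "{w \<in> ?V. (w, u) \<in> ?r \<and> w \<noteq> u} \<subset> {w \<in> ?V. (w, v) \<in> ?r \<and> w \<noteq> v}"
      using that tr as by blast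
    then show ?thesis unfolding f_def using fin by (intro psubset_card_mono) auto
  qed
  have bound: "f v < card ?V" if "v \<in> ?V" for v
    unfolding f_def using that fin by (intro psubset_card_mono) auto
  have inj: "inj_on f ?V" by (rule inj_onI) (metis less less_irrefl tot)
  have "f ` ?V = {..<card ?V}"
    using bound card_image[OF inj] by (intro card_subset_eq) auto
  then have "bij_betw f ?V {..<card ?V}" using inj by (simp add: bij_betw_def)
  moreover have "(u, v) \<in> ?r \<longleftrightarrow> f u \<le> f v" if "u \<in> ?V" "v \<in> ?V" for u v
    using less[of u v] less[of v u] tot[OF that] refl that by (cases "u = v") (auto simp: not_le[symmetric])
  ultimately show ?thesis by blast
qed

text \<open>Ordered graphs have no automorphisms except the identity, so every isomorphism class contains
  just one canonical graph.\<close>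
lemma growth_eq_card_slice:
  assumes C: "hereditary C"
  shows "growth C n = card (slice C n)"
proof -
  let ?X = "{G \<in> C. card (verts G) = n}" and ?r = "{(G, H). G \<in> C \<and> H \<in> C \<and> G \<cong>\<^sub>o H}"
  have inC: "canonical n E \<in> C" if "E \<in> slice C n" for E using that unfolding slice_def by simp
  have same: "E = E'" if E: "E \<in> slice C n" "E' \<in> slice C n" and iso: "canonical n E \<cong>\<^sub>o canonical n E'" for E E'
  proof -
    obtain f where f: "bij_betw f {..<n} {..<n}"
      "\<And>u v. u < n \<Longrightarrow> v < n \<Longrightarrow> ((u, v) \<in> E \<longleftrightarrow> (f u, f v) \<in> E') \<and>
        ((u, v) \<in> nat_ord {..<n} \<longleftrightarrow> (f u, f v) \<in> nat_ord {..<n})"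
      using iso unfolding ograph_iso_def canonical_def by auto
    have fn: "f u < n" if "u < n" for u using bij_betwE[OF f(1)] that by blast
    have "f u < f v" if "u < v" "v < n" for u v
      using f(2)[of v u] fn[of u] fn[of v] that by (auto simp: nat_ord_def)
    then have id: "f u = u" if "u < n" for u
      using increasing_bijection_is_identity[of n f u] fn that by blast
    have "(u, v) \<in> E \<longleftrightarrow> (u, v) \<in> E'" if "u < n" "v < n" for u v
      using f(2)[OF that] id that by simp
    then have "(u, v) \<in> E \<longleftrightarrow> (u, v) \<in> E'" for u v
      using sliceD(1)[OF C E(1)] sliceD(1)[OF C E(2)] by blast
    then show ?thesis by (intro equalityI subrelI) simp_all
  qed
  have exists: "\<exists>E \<in> slice C n. canonical n E \<cong>\<^sub>o G" if G: "G \<in> C" "card (verts G) = n" for G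
  proof -
    have og: "ordered_graph G" using C G(1) unfolding hereditary_def by blast
    obtain f where f: "bij_betw f (verts G) {..<n}"
      "\<And>u v. u \<in> verts G \<Longrightarrow> v \<in> verts G \<Longrightarrow> (u, v) \<in> ord G \<longleftrightarrow> f u \<le> f v"
      using ordered_graph_rank[OF og] G(2) by auto
    have fn: "f u < n" if "u \<in> verts G" for u using bij_betwE[OF f(1)] that by blast
    define E where "E = (\<lambda>(u, v). (f u, f v)) ` edges G"
    have eV: "edges G \<subseteq> verts G \<times> verts G" "sym (edges G)" "irrefl (edges G)"
      using og unfolding ordered_graph_def by auto
    have inj: "f u = f v \<longleftrightarrow> u = v" if "u \<in> verts G" "v \<in> verts G" for u v
      using f(1) that by (meson bij_betw_imp_inj_on inj_on_eq_iff)
    have E: "(f u, f v) \<in> E \<longleftrightarrow> (u, v) \<in> edges G" if uv: "u \<in> verts G" "v \<in> verts G" for u v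
    proof
      assume "(f u, f v) \<in> E"
      then obtain a b where ab: "(a, b) \<in> edges G" "f u = f a" "f v = f b" unfolding E_def by auto
      then have "a \<in> verts G" "b \<in> verts G" using eV(1) by auto
      then show "(u, v) \<in> edges G" using ab inj uv by simp
    qed (auto simp: E_def)
    have iso: "G \<cong>\<^sub>o canonical n E"
      unfolding ograph_iso_def
    proof (intro exI[of _ f] conjI ballI)
      fix u v assume uv: "u \<in> verts G" "v \<in> verts G"
      show "(u, v) \<in> edges G \<longleftrightarrow> (f u, f v) \<in> edges (canonical n E)" using E[OF uv] by (simp add: canonical_def)
      show "(u, v) \<in> ord G \<longleftrightarrow> (f u, f v) \<in> ord (canonical n E)"
        using f(2)[OF uv] fn uv by (simp add: canonical_def nat_ord_def)
    qed (use f(1) in \<open>simp add: canonical_def\<close>)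
    have "ordered_graph (canonical n E)"
      unfolding canonical_def ordered_graph_nat
    proof (intro conjI)
      show "E \<subseteq> {..<n} \<times> {..<n}" unfolding E_def using eV(1) fn by auto
      show "sym E" unfolding E_def using eV(2) by (auto simp: sym_def image_iff; force)
      show "irrefl E"
        unfolding E_def irrefl_def
      proof (clarsimp)
        fix u v assume "(u, v) \<in> edges G" "f u = f v"
        then show False using inj[of u v] eV(1,3) unfolding irrefl_def by auto
      qed
    qed simp
    then have "canonical n E \<in> C"
      using C G(1) ograph_iso_sym[OF iso] unfolding hereditary_def by blast
    then show ?thesis using ograph_iso_sym[OF iso] unfolding slice_def by blast
  qed
  have "bij_betw (\<lambda>E. ?r `` {canonical n E}) (slice C n) (?X // ?r)"
    unfolding bij_betw_def
  proof (intro conjI)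
    show "inj_on (\<lambda>E. ?r `` {canonical n E}) (slice C n)"
    proof (rule inj_onI)
      fix E E' assume E: "E \<in> slice C n" "E' \<in> slice C n" "?r `` {canonical n E} = ?r `` {canonical n E'}"
      have "canonical n E' \<in> ?r `` {canonical n E'}" using inC[OF E(2)] ograph_iso_refl by blast
      then have "canonical n E \<cong>\<^sub>o canonical n E'" unfolding E(3)[symmetric] by blast
      then show "E = E'" using same E(1,2) by blast
    qed
    show "(\<lambda>E. ?r `` {canonical n E}) ` slice C n = ?X // ?r"
    proof
      have "canonical n E \<in> ?X" if "E \<in> slice C n" for E using inC[OF that] by (simp add: canonical_def)
      then have "?r `` {canonical n E} \<in> ?X // ?r" if "E \<in> slice C n" for E
        using that by (intro quotientI)
      then show "(\<lambda>E. ?r `` {canonical n E}) ` slice C n \<subseteq> ?X // ?r" by (rule image_subsetI)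
      show "?X // ?r \<subseteq> (\<lambda>E. ?r `` {canonical n E}) ` slice C n"
      proof
        fix Y assume "Y \<in> ?X // ?r"
        then obtain G where G: "G \<in> C" "card (verts G) = n" "Y = ?r `` {G}" by (auto elim!: quotientE)
        obtain E where E: "E \<in> slice C n" "canonical n E \<cong>\<^sub>o G" using exists[OF G(1,2)] by blast
        have "?r `` {G} = ?r `` {canonical n E}"
          using E(2) G(1) inC[OF E(1)] ograph_iso_trans ograph_iso_sym by blast
        then show "Y \<in> (\<lambda>E. ?r `` {canonical n E}) ` slice C n" using G(3) E(1) by blast
      qed
    qed
  qed
  then have "card (slice C n) = card (?X // ?r)" by (rule bij_betw_same_card)
  then show ?thesis unfolding growth_def by simp
qed

section \<open>Growth of the listed classes\<close>

text \<open>The graphs \<open>G \<sigma>\<close> are compared on their first \<open>n\<close> vertices, which may be fewer than all of them.\<close>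
lemma fact_le_card_slice:
  assumes C: "hereditary C" and m: "m \<le> n"
    and G: "\<And>\<sigma>. \<sigma> permutes {1..m} \<Longrightarrow> G \<sigma> \<in> C \<and> ord (G \<sigma>) = nat_ord (verts (G \<sigma>)) \<and> {1..n} \<subseteq> verts (G \<sigma>)"
    and inj: "\<And>\<sigma> \<tau>. \<sigma> permutes {1..m} \<Longrightarrow> \<tau> permutes {1..m} \<Longrightarrow>
      (\<And>i j. i \<in> {1..n} \<Longrightarrow> j \<in> {1..n} \<Longrightarrow> (i, j) \<in> edges (G \<sigma>) \<longleftrightarrow> (i, j) \<in> edges (G \<tau>)) \<Longrightarrow> \<sigma> = \<tau>"
  shows "fact m \<le> card (slice C n)"
proof -
  define R where "R \<sigma> = pullback Suc n (edges (G \<sigma>))" for \<sigma>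
  have "inj_on R {\<sigma>. \<sigma> permutes {1..m}}"
  proof (rule inj_onI, clarify)
    fix \<sigma> \<tau> assume p: "\<sigma> permutes {1..m}" "\<tau> permutes {1..m}" and eq: "R \<sigma> = R \<tau>"
    show "\<sigma> = \<tau>"
    proof (rule inj[OF p])
      fix i j assume ij: "i \<in> {1..n}" "j \<in> {1..n}"
      then have "i = Suc (i - 1)" "j = Suc (j - 1)" "i - 1 < n" "j - 1 < n" by auto
      moreover have "(i - 1, j - 1) \<in> R \<sigma> \<longleftrightarrow> (i - 1, j - 1) \<in> R \<tau>" using eq by simp
      ultimately show "(i, j) \<in> edges (G \<sigma>) \<longleftrightarrow> (i, j) \<in> edges (G \<tau>)"
        unfolding R_def pullback_def by auto
    qed
  qed
  moreover have "R ` {\<sigma>. \<sigma> permutes {1..m}} \<subseteq> slice C n"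
  proof (rule image_subsetI, clarify)
    fix \<sigma> assume p: "\<sigma> permutes {1..m}"
    have og: "ordered_graph (G \<sigma>)" using G[OF p] C unfolding hereditary_def by blast
    have "canonical n (R \<sigma>) \<in> C"
    proof (rule hereditary_embed[OF C, of "G \<sigma>" _ Suc])
      have "sym (edges (G \<sigma>))" "irrefl (edges (G \<sigma>))" using og unfolding ordered_graph_def by auto
      then show "ordered_graph (canonical n (R \<sigma>))"
        unfolding canonical_def ordered_graph_nat R_def by (auto simp: pullback_def sym_def irrefl_def)
    next
      fix u assume "u \<in> verts (canonical n (R \<sigma>))"
      then have "Suc u \<in> {1..n}" by (simp add: canonical_def)
      then show "Suc u \<in> verts (G \<sigma>)" using G[OF p] by blast
    qed (use G[OF p] in \<open>auto simp: canonical_def R_def pullback_def\<close>)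
    then show "R \<sigma> \<in> slice C n" unfolding slice_def by simp
  qed
  ultimately have "card {\<sigma>. \<sigma> permutes {1..m}} \<le> card (slice C n)"
    using finite_slice[OF C] by (rule card_inj_on_le)
  then show ?thesis using card_permutations[of "{1..m}" m] by simp
qed

lemma permutes_eqI:
  assumes "\<sigma> permutes S" "\<tau> permutes S" "\<And>i. i \<in> S \<Longrightarrow> \<sigma> i = \<tau> i"
  shows "\<sigma> = \<tau>"
proof
  fix i show "\<sigma> i = \<tau> i"
    by (cases "i \<in> S") (use assms in \<open>auto simp: permutes_not_in\<close>)
qed

text \<open>The value \<open>\<sigma> i\<close> is the number of positions whose value is at most \<open>\<sigma> i\<close>.\<close>
lemma permutation_eq_of_inversions:
  fixes \<sigma> \<tau> :: "nat \<Rightarrow> nat"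
  assumes \<sigma>: "\<sigma> permutes {1..n}" and \<tau>: "\<tau> permutes {1..n}"
    and inv: "\<And>i j. i \<in> {1..n} \<Longrightarrow> j \<in> {1..n} \<Longrightarrow> i < j \<Longrightarrow> \<sigma> j < \<sigma> i \<longleftrightarrow> \<tau> j < \<tau> i"
  shows "\<sigma> = \<tau>"
proof (rule permutes_eqI[OF \<sigma> \<tau>])
  have rank: "\<rho> i = card {j \<in> {1..n}. \<rho> j \<le> \<rho> i}" if \<rho>: "\<rho> permutes {1..n}" and i: "i \<in> {1..n}" for \<rho> i
  proof -
    have "\<rho> ` {j \<in> {1..n}. \<rho> j \<le> \<rho> i} = {1..\<rho> i}"
    proof
      show "\<rho> ` {j \<in> {1..n}. \<rho> j \<le> \<rho> i} \<subseteq> {1..\<rho> i}" using permutes_in_image[OF \<rho>] by fastforce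
      show "{1..\<rho> i} \<subseteq> \<rho> ` {j \<in> {1..n}. \<rho> j \<le> \<rho> i}"
      proof
        fix x assume x: "x \<in> {1..\<rho> i}"
        have "\<rho> i \<in> {1..n}" using permutes_in_image[OF \<rho>] i by blast
        then have "x \<in> \<rho> ` {1..n}" using x permutes_image[OF \<rho>] by auto
        then show "x \<in> \<rho> ` {j \<in> {1..n}. \<rho> j \<le> \<rho> i}" using x by auto
      qed
    qed
    moreover have "inj_on \<rho> {j \<in> {1..n}. \<rho> j \<le> \<rho> i}" using permutes_inj[OF \<rho>] by (rule inj_on_subset) auto
    ultimately show ?thesis by (metis card_image card_atLeastAtMost diff_Suc_1)
  qed
  fix i assume i: "i \<in> {1..n}"
  have "\<sigma> j \<le> \<sigma> i \<longleftrightarrow> \<tau> j \<le> \<tau> i" if j: "j \<in> {1..n}" for j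
  proof (cases i j rule: linorder_cases)
    case less
    have "\<sigma> j \<noteq> \<sigma> i" "\<tau> j \<noteq> \<tau> i"
      using less permutes_inj[OF \<sigma>] permutes_inj[OF \<tau>] by (auto dest: injD)
    then show ?thesis using inv[OF i j less] by linarith
  next
    case greater
    then show ?thesis using inv[OF j i greater] by linarith
  qed simp
  then have "{j \<in> {1..n}. \<sigma> j \<le> \<sigma> i} = {j \<in> {1..n}. \<tau> j \<le> \<tau> i}" by blast
  then show "\<sigma> i = \<tau> i" using rank[OF \<sigma> i] rank[OF \<tau> i] by simp
qed

lemma permutation_eq_of_cross_adj:
  assumes \<sigma>: "\<sigma> permutes {1..m}" and \<tau>: "\<tau> permutes {1..m}"
    and eq: "\<And>i j. i \<in> {1..m} \<Longrightarrow> j \<in> {1..m} \<Longrightarrow> cross_adj s \<sigma> i j \<longleftrightarrow> cross_adj s \<tau> i j"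
  shows "\<sigma> = \<tau>"
proof -
  have in_range: "\<rho> i \<in> {1..m}" "inv \<rho> i \<in> {1..m}" if "\<rho> permutes {1..m}" "i \<in> {1..m}" for \<rho> i
    using permutes_in_image[OF that(1)] permutes_in_image[OF permutes_inv[OF that(1)]] that(2) by blast+
  have by_rows: "\<sigma> = \<tau>" if "\<And>i. i \<in> {1..m} \<Longrightarrow> \<sigma> i = \<tau> i"
    using permutes_eqI[OF \<sigma> \<tau>] that by blast
  have by_columns: "\<sigma> = \<tau>" if "\<And>j. j \<in> {1..m} \<Longrightarrow> inv \<sigma> j = inv \<tau> j"
  proof -
    have "inv \<sigma> = inv \<tau>" using permutes_eqI[OF permutes_inv[OF \<sigma>] permutes_inv[OF \<tau>]] that by blast
    then show ?thesis using permutes_inv_inv[OF \<sigma>] permutes_inv_inv[OF \<tau>] by metis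
  qed
  consider "s \<in> {S_eq, S_neq, S_le_r, S_ge_r}" | "s \<in> {S_le_l, S_ge_l}" by (cases s) auto
  then show ?thesis
  proof cases
    case 1
    show ?thesis
    proof (rule by_rows)
      fix i assume i: "i \<in> {1..m}"
      show "\<sigma> i = \<tau> i"
        using 1 eq[OF i in_range(1)[OF \<sigma> i]] eq[OF i in_range(1)[OF \<tau> i]] by auto
    qed
  next
    case 2
    show ?thesis
    proof (rule by_columns)
      fix j assume j: "j \<in> {1..m}"
      show "inv \<sigma> j = inv \<tau> j"
        using 2 eq[OF in_range(2)[OF \<sigma> j] j] eq[OF in_range(2)[OF \<tau> j] j] by auto
    qed
  qed
qed

lemma permutation_ograph_in_P_class: "\<pi> permutes {1..n} \<Longrightarrow> permutation_ograph n \<pi> \<in> P_class"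
  unfolding P_class_def using ordered_graph_permutation_ograph ograph_iso_refl by blast

lemma M_graph_in_M_class:
  assumes "\<sigma> permutes {1..n}"
  shows "M_graph s lam rho n \<sigma> \<in> M_class s lam rho"
proof -
  let ?G = "M_graph s lam rho n \<sigma>"
  have "edges ?G \<subseteq> verts ?G \<times> verts ?G" "ord ?G \<subseteq> verts ?G \<times> verts ?G"
    using ordered_graph_M_graph[of s lam rho n \<sigma>] unfolding ordered_graph_def
    by (simp, auto simp: M_graph_simps nat_ord_def)
  then have "induced ?G (verts ?G) = ?G" unfolding induced_def by (auto simp: inf.absorb1)
  then show ?thesis
    unfolding M_class_def hereditary_closure_def
    using assms ordered_graph_M_graph ograph_iso_refl[of ?G] by fastforce
qed

lemma fact_le_card_slice_P_class: "fact (n div 2) \<le> card (slice P_class n)"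
proof (rule fact_le_card_slice[OF hereditary_P_class, where G = "permutation_ograph n"])
  fix \<sigma> assume "\<sigma> permutes {1..n div 2}"
  then have "\<sigma> permutes {1..n}" by (rule permutes_subset) auto
  then show "permutation_ograph n \<sigma> \<in> P_class \<and> ord (permutation_ograph n \<sigma>) = nat_ord (verts (permutation_ograph n \<sigma>)) \<and>
    {1..n} \<subseteq> verts (permutation_ograph n \<sigma>)"
    by (simp add: permutation_ograph_in_P_class permutation_ograph_simps)
next
  have sub: "{1..n div 2} \<subseteq> {1..n}" by auto
  fix \<sigma> \<tau> assume "\<sigma> permutes {1..n div 2}" "\<tau> permutes {1..n div 2}"
  then have p: "\<sigma> permutes {1..n}" "\<tau> permutes {1..n}" using sub permutes_subset by blast+
  assume eq: "\<And>i j. i \<in> {1..n} \<Longrightarrow> j \<in> {1..n} \<Longrightarrow>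
    (i, j) \<in> edges (permutation_ograph n \<sigma>) \<longleftrightarrow> (i, j) \<in> edges (permutation_ograph n \<tau>)"
  show "\<sigma> = \<tau>"
  proof (rule permutation_eq_of_inversions[OF p])
    fix i j assume ij: "i \<in> {1..n}" "j \<in> {1..n}" "i < j"
    show "\<sigma> j < \<sigma> i \<longleftrightarrow> \<tau> j < \<tau> i" using eq[OF ij(1,2)] unfolding permutation_ograph_edge_iff[OF ij] .
  qed
qed simp

text \<open>For odd \<open>n\<close> the last vertex of a graph on \<open>n + 1\<close> vertices is dropped. Nothing is lost, because
  the permutations used fix the last point.\<close>
lemma fact_le_card_slice_M_class: "fact (n div 2) \<le> card (slice (M_class s lam rho) n)"
proof -
  define k where "k = n - n div 2"
  have k: "n div 2 \<le> k" "n \<le> 2 * k" "k + n div 2 = n" unfolding k_def by linarith+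
  show ?thesis
  proof (rule fact_le_card_slice[OF hereditary_M_class, where G = "M_graph s lam rho k"])
    fix \<sigma> assume "\<sigma> permutes {1..n div 2}"
    then have "\<sigma> permutes {1..k}" by (rule permutes_subset) (use k in auto)
    then show "M_graph s lam rho k \<sigma> \<in> M_class s lam rho \<and>
        ord (M_graph s lam rho k \<sigma>) = nat_ord (verts (M_graph s lam rho k \<sigma>)) \<and>
        {1..n} \<subseteq> verts (M_graph s lam rho k \<sigma>)"
      using k(2) by (simp add: M_graph_in_M_class M_graph_simps)
  next
    fix \<sigma> \<tau> assume p: "\<sigma> permutes {1..n div 2}" "\<tau> permutes {1..n div 2}"
    assume eq: "\<And>i j. i \<in> {1..n} \<Longrightarrow> j \<in> {1..n} \<Longrightarrow>
      (i, j) \<in> edges (M_graph s lam rho k \<sigma>) \<longleftrightarrow> (i, j) \<in> edges (M_graph s lam rho k \<tau>)"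
    show "\<sigma> = \<tau>"
    proof (rule permutation_eq_of_cross_adj[OF p])
      fix i j assume ij: "i \<in> {1..n div 2}" "j \<in> {1..n div 2}"
      then have "i \<in> {1..k}" "j \<in> {1..k}" "i \<in> {1..n}" "k + j \<in> {1..n}" using k by auto
      then show "cross_adj s \<sigma> i j \<longleftrightarrow> cross_adj s \<tau> i j"
        using eq[of i "k + j"] by (simp only: M_graph_edge_iff(1))
    qed
  qed simp
qed

lemma power_le_fact: "(B::nat) ^ k \<le> B ^ B * fact k"
proof (cases "k \<le> B")
  case True
  show ?thesis
  proof (cases "B = 0")
    case False
    then have "B ^ k \<le> B ^ B" using True by (intro power_increasing) auto
    also have "\<dots> \<le> B ^ B * fact k" by (simp add: Suc_leI)
    finally show ?thesis .
  qed (use True in simp)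
next
  case False
  then have "B \<le> k" by simp
  then show ?thesis
  proof (induction k rule: dec_induct)
    case base
    show ?case by (simp add: Suc_leI)
  next
    case (step k)
    have "B ^ Suc k = B * B ^ k" by simp
    also have "\<dots> \<le> Suc k * (B ^ B * fact k)" using step by (intro mult_le_mono) auto
    finally show ?case by (simp add: algebra_simps)
  qed
qed

lemma growth_two_pow_omega_of_fact:
  assumes "\<And>n. fact (n div 2) \<le> growth C n"
  shows "growth_two_pow_omega C"
proof -
  define f where "f n = log 2 (real (growth C n))" for n
  have pos: "0 < growth C n" for n using assms[of n] fact_gt_zero[of "n div 2"] by (meson le_trans less_le_trans)
  have "real (growth C n) = 2 powr f n" for n unfolding f_def using pos[of n] by simp
  moreover have "filterlim (\<lambda>n. f n / real n) at_top sequentially"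
    unfolding filterlim_at_top
  proof
    fix Z :: real
    \<comment> \<open>With \<open>B = 2 ^ b\<close> the growth is at least \<open>2 ^ (b * (n div 2))\<close> up to a constant factor, and \<open>b\<close> exceeds twice the desired slope.\<close>
    obtain b :: nat where b: "2 * Z + 2 \<le> real b" using real_arch_simple by blast
    define B where "B = (2::nat) ^ b"
    have lower: "real b * real (n div 2) - real b * real B \<le> f n" for n
    proof -
      have "B ^ (n div 2) \<le> B ^ B * growth C n"
        using power_le_fact[of B "n div 2"] assms[of n] by (meson le_trans mult_le_mono2)
      then have "real (B ^ (n div 2)) \<le> real (B ^ B * growth C n)" by (rule of_nat_mono)
      then have "log 2 (real (B ^ (n div 2))) \<le> log 2 (real (B ^ B * growth C n))"
        unfolding B_def by (intro log_mono) auto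
      then have "real (n div 2) * log 2 (real B) \<le> real B * log 2 (real B) + f n"
        unfolding f_def using pos[of n] by (simp add: B_def log_mult log_nat_power)
      moreover have "log 2 (real B) = real b" unfolding B_def by (simp add: log_nat_power)
      ultimately show ?thesis by (simp add: algebra_simps)
    qed
    show "\<forall>\<^sub>F n in sequentially. Z \<le> f n / real n"
      unfolding eventually_sequentially
    proof (intro exI[of _ "1 + b + b * B"] allI impI)
      fix n assume n: "1 + b + b * B \<le> n"
      have "real n \<le> 2 * real (n div 2) + 1" by linarith
      then have "real b * real n \<le> real b * (2 * real (n div 2) + 1)" by (rule mult_left_mono) simp
      then have 1: "real b * real n \<le> 2 * (real b * real (n div 2)) + real b" by (simp add: algebra_simps)
      have 2: "(2 * Z + 2) * real n \<le> real b * real n" using b by (rule mult_right_mono) simp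
      have "real (1 + b + b * B) \<le> real n" using n by (rule of_nat_mono)
      then have 3: "1 + real b + real b * real B \<le> real n" by simp
      have "2 * (Z * real n) + 2 * real n \<le> 2 * f n + 2 * (real b * real B) + real b"
        using 1 2 lower[of n] by (simp add: algebra_simps)
      moreover have "2 * (real b * real B) + real b \<le> 2 * real n" using 3 by linarith
      ultimately have "Z * real n \<le> f n" by linarith
      then show "Z \<le> f n / real n" using n by (simp add: pos_le_divide_eq)
    qed
  qed
  ultimately show ?thesis unfolding growth_two_pow_omega_def by blast
qed

lemma growth_two_pow_O_of_power:
  assumes "M \<ge> 1" "\<And>n. growth C n \<le> M ^ n"
  shows "growth_two_pow_O C"
  unfolding growth_two_pow_O_def
proof (intro bexI allI)
  fix n
  have "real (growth C n) \<le> real (M ^ n)" using assms(2) by (rule of_nat_mono)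
  also have "\<dots> = 2 powr (real n * log 2 (real M))"
    using assms(1) by (simp add: powr_powr[symmetric] mult.commute[of "real n"] powr_realpow)
  finally show "real (growth C n) \<le> 2 powr (real n * log 2 (real M))" .
qed (auto intro: landau_o.bigI)

lemma not_growth_two_pow_O_if_omega:
  assumes "growth_two_pow_omega C"
  shows "\<not> growth_two_pow_O C"
proof
  assume "growth_two_pow_O C"
  then obtain g where g: "g \<in> O(\<lambda>n. real n)" "\<And>n. real (growth C n) \<le> 2 powr g n"
    unfolding growth_two_pow_O_def by blast
  obtain f where f: "\<And>n. real (growth C n) = 2 powr f n" "filterlim (\<lambda>n. f n / real n) at_top sequentially"
    using assms unfolding growth_two_pow_omega_def by blast
  have fg: "f n \<le> g n" for n using g(2)[of n] f(1)[of n] by simp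
  obtain c where c: "\<forall>\<^sub>F n in sequentially. norm (g n) \<le> c * norm (real n)"
    using g(1) by (rule landau_o.bigE)
  have "\<forall>\<^sub>F n in sequentially. c + 1 \<le> f n / real n"
    using f(2) unfolding filterlim_at_top by blast
  then have "\<forall>\<^sub>F n in sequentially. False"
    using c eventually_gt_at_top[of 0]
  proof eventually_elim
    case (elim n)
    have "(c + 1) * real n \<le> f n" using elim(1,3) by (simp add: pos_le_divide_eq)
    also have "f n \<le> c * real n" using fg[of n] elim(2) by simp
    finally show False using elim(3) by (simp add: algebra_simps)
  qed
  then show False by simp
qed

section \<open>The listed classes are pairwise incomparable\<close>

lemma iso_induced_embedding:
  assumes H: "ord H = nat_ord (verts H)" and K: "ord K = nat_ord (verts K)" and W: "W \<subseteq> verts K"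
    and iso: "H \<cong>\<^sub>o induced K W"
  obtains f where "\<And>u. u \<in> verts H \<Longrightarrow> f u \<in> verts K"
    "\<And>u v. u \<in> verts H \<Longrightarrow> v \<in> verts H \<Longrightarrow> u < v \<Longrightarrow> f u < f v"
    "\<And>u v. u \<in> verts H \<Longrightarrow> v \<in> verts H \<Longrightarrow> (u, v) \<in> edges H \<longleftrightarrow> (f u, f v) \<in> edges K"
proof -
  obtain f where f: "bij_betw f (verts H) W"
    "\<And>u v. u \<in> verts H \<Longrightarrow> v \<in> verts H \<Longrightarrow> ((u, v) \<in> edges H \<longleftrightarrow> (f u, f v) \<in> edges K \<inter> W \<times> W) \<and>
      ((u, v) \<in> nat_ord (verts H) \<longleftrightarrow> (f u, f v) \<in> nat_ord (verts K) \<inter> W \<times> W)"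
    using iso unfolding ograph_iso_def induced_def by (auto simp: H K)
  have fW: "f u \<in> W" if "u \<in> verts H" for u using bij_betwE[OF f(1)] that by blast
  show thesis
  proof (rule that[of f])
    show "f u \<in> verts K" if "u \<in> verts H" for u using fW[OF that] W by blast
    show "(u, v) \<in> edges H \<longleftrightarrow> (f u, f v) \<in> edges K" if "u \<in> verts H" "v \<in> verts H" for u v
      using f(2)[OF that] fW[OF that(1)] fW[OF that(2)] by blast
    show "f u < f v" if uv: "u \<in> verts H" "v \<in> verts H" "u < v" for u v
    proof -
      have "\<not> f v \<le> f u"
      proof
        assume "f v \<le> f u"
        then have "(f v, f u) \<in> nat_ord (verts K) \<inter> W \<times> W"
          using fW[OF uv(1)] fW[OF uv(2)] W by (auto simp: nat_ord_def)
        then have "(v, u) \<in> nat_ord (verts H)" using f(2)[OF uv(2,1)] by blast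
        then show False using uv(3) by (simp add: nat_ord_def)
      qed
      then show ?thesis by simp
    qed
  qed
qed

text \<open>An embedding is increasing, so the vertices that it sends to the first side form an initial segment.\<close>
lemma embedding_into_M_class:
  assumes "H \<in> M_class s lam rho" "ord H = nat_ord (verts H)"
  obtains n \<sigma> f where "\<sigma> permutes {1..n}"
    "\<And>u. u \<in> verts H \<Longrightarrow> f u \<in> {1..2 * n}"
    "\<And>u v. u \<in> verts H \<Longrightarrow> v \<in> verts H \<Longrightarrow> u < v \<Longrightarrow> f u < f v"
    "\<And>u v. u \<in> verts H \<Longrightarrow> v \<in> verts H \<Longrightarrow> u < v \<Longrightarrow> f v \<le> n \<Longrightarrow> (u, v) \<in> edges H \<longleftrightarrow> lam"
    "\<And>u v. u \<in> verts H \<Longrightarrow> v \<in> verts H \<Longrightarrow> u < v \<Longrightarrow> n < f u \<Longrightarrow> (u, v) \<in> edges H \<longleftrightarrow> rho"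
    "\<And>u v. u \<in> verts H \<Longrightarrow> v \<in> verts H \<Longrightarrow> f u \<le> n \<Longrightarrow> n < f v \<Longrightarrow>
      (u, v) \<in> edges H \<longleftrightarrow> cross_adj s \<sigma> (f u) (f v - n)"
proof -
  obtain n \<sigma> W where n: "\<sigma> permutes {1..n}" "W \<subseteq> verts (M_graph s lam rho n \<sigma>)"
    "H \<cong>\<^sub>o induced (M_graph s lam rho n \<sigma>) W"
    using assms(1) unfolding M_class_def hereditary_closure_def by blast
  let ?K = "M_graph s lam rho n \<sigma>"
  have "ord ?K = nat_ord (verts ?K)" by (simp add: M_graph_simps)
  then obtain f where f: "\<And>u. u \<in> verts H \<Longrightarrow> f u \<in> verts ?K"
    "\<And>u v. u \<in> verts H \<Longrightarrow> v \<in> verts H \<Longrightarrow> u < v \<Longrightarrow> f u < f v"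
    "\<And>u v. u \<in> verts H \<Longrightarrow> v \<in> verts H \<Longrightarrow> (u, v) \<in> edges H \<longleftrightarrow> (f u, f v) \<in> edges ?K"
    using iso_induced_embedding[OF assms(2) _ n(2,3)] by metis
  have fr: "1 \<le> f u \<and> f u \<le> 2 * n" if "u \<in> verts H" for u using f(1)[OF that] by (simp add: M_graph_simps)
  have hi: "f u = n + (f u - n) \<and> f u - n \<in> {1..n}" if "u \<in> verts H" "n < f u" for u
    using fr[OF that(1)] that(2) by (simp, linarith)
  show thesis
  proof (rule that[OF n(1), of f])
    show "f u \<in> {1..2 * n}" if "u \<in> verts H" for u using fr[OF that] by simp
    show "f u < f v" if "u \<in> verts H" "v \<in> verts H" "u < v" for u v using f(2) that .
    show "(u, v) \<in> edges H \<longleftrightarrow> lam" if uv: "u \<in> verts H" "v \<in> verts H" "u < v" "f v \<le> n" for u v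
    proof -
      have "f u < f v" using f(2) uv by blast
      then have "f u \<in> {1..n}" "f v \<in> {1..n}" "f u \<noteq> f v" using fr[OF uv(1)] fr[OF uv(2)] uv(4) by auto
      then show ?thesis unfolding f(3)[OF uv(1,2)] by (rule M_graph_edge_iff(2))
    qed
    show "(u, v) \<in> edges H \<longleftrightarrow> rho" if uv: "u \<in> verts H" "v \<in> verts H" "u < v" "n < f u" for u v
    proof -
      have less: "f u < f v" using f(2) uv by blast
      then have v: "n < f v" using uv(4) by simp
      have ne: "f u - n \<noteq> f v - n" using less uv(4) by simp
      have "(n + (f u - n), n + (f v - n)) \<in> edges ?K \<longleftrightarrow> rho"
        using hi[OF uv(1,4)] hi[OF uv(2) v] ne by (intro M_graph_edge_iff(3)) auto
      then show ?thesis unfolding f(3)[OF uv(1,2)] using hi[OF uv(1,4)] hi[OF uv(2) v] by simp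
    qed
    show "(u, v) \<in> edges H \<longleftrightarrow> cross_adj s \<sigma> (f u) (f v - n)"
      if uv: "u \<in> verts H" "v \<in> verts H" "f u \<le> n" "n < f v" for u v
    proof -
      have "(f u, n + (f v - n)) \<in> edges ?K \<longleftrightarrow> cross_adj s \<sigma> (f u) (f v - n)"
        using hi[OF uv(2,4)] fr[OF uv(1)] uv(3) by (intro M_graph_edge_iff(1)) auto
      then show ?thesis unfolding f(3)[OF uv(1,2)] using hi[OF uv(2,4)] by simp
    qed
  qed
qed

lemma swap_ends_permutes: "transpose 1 4 permutes {1..4::nat}"
  by (rule permutes_swap_id) auto

text \<open>Exchanging 1 and 4 is generic enough to tell all six symbols apart: except for the configuration that
  the symbol itself excludes, rows 1 to 3 and columns 2 to 4 of its matrix contain two ones in a row, two zeros in a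
  row, and both orders of a zero and a one in some row and in some column.\<close>
abbreviation test_graph :: "rel_symbol \<Rightarrow> bool \<Rightarrow> bool \<Rightarrow> nat ograph" where
  "test_graph s lam rho \<equiv> M_graph s lam rho 4 (transpose 1 4)"

lemma test_graph_edges:
  "\<And>i j. i \<in> {1,2,3,4} \<Longrightarrow> j \<in> {1,2,3,4} \<Longrightarrow>
     (i, 4 + j) \<in> edges (test_graph s lam rho) \<longleftrightarrow> cross_adj s (transpose 1 4) i j"
  "(1, 2) \<in> edges (test_graph s lam rho) \<longleftrightarrow> lam" "(1, 3) \<in> edges (test_graph s lam rho) \<longleftrightarrow> lam"
  "(2, 3) \<in> edges (test_graph s lam rho) \<longleftrightarrow> lam"
  "(6, 7) \<in> edges (test_graph s lam rho) \<longleftrightarrow> rho" "(6, 8) \<in> edges (test_graph s lam rho) \<longleftrightarrow> rho"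
  "(7, 8) \<in> edges (test_graph s lam rho) \<longleftrightarrow> rho"
proof -
  show "(i, 4 + j) \<in> edges (test_graph s lam rho) \<longleftrightarrow> cross_adj s (transpose 1 4) i j"
    if "i \<in> {1,2,3,4}" "j \<in> {1,2,3,4}" for i j
    using that by (intro M_graph_edge_iff(1)) auto
  show "(1, 2) \<in> edges (test_graph s lam rho) \<longleftrightarrow> lam" "(1, 3) \<in> edges (test_graph s lam rho) \<longleftrightarrow> lam"
    "(2, 3) \<in> edges (test_graph s lam rho) \<longleftrightarrow> lam"
    by (rule M_graph_edge_iff(2); simp)+
  show "(6, 7) \<in> edges (test_graph s lam rho) \<longleftrightarrow> rho" "(6, 8) \<in> edges (test_graph s lam rho) \<longleftrightarrow> rho"
    "(7, 8) \<in> edges (test_graph s lam rho) \<longleftrightarrow> rho"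
    using M_graph_edge_iff(3)[of 2 4 3 s lam rho "transpose 1 4"]
      M_graph_edge_iff(3)[of 2 4 4 s lam rho "transpose 1 4"]
      M_graph_edge_iff(3)[of 3 4 4 s lam rho "transpose 1 4"] by simp_all
qed

lemma swap_ends_values:
  "transpose 1 4 (1::nat) = (4::nat)" "transpose 1 4 (2::nat) = (2::nat)"
  "transpose 1 4 (3::nat) = (3::nat)" "transpose 1 4 (4::nat) = (1::nat)"
  "inv (transpose 1 (4::nat)) = transpose 1 4"
  by (simp_all add: transpose_def)

lemma test_cross_adj:
  "cross_adj S_eq (transpose 1 4) i j \<longleftrightarrow> transpose 1 4 i = j"
  "cross_adj S_neq (transpose 1 4) i j \<longleftrightarrow> transpose 1 4 i \<noteq> j"
  "cross_adj S_le_l (transpose 1 4) i j \<longleftrightarrow> i \<le> transpose 1 4 j"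
  "cross_adj S_ge_l (transpose 1 4) i j \<longleftrightarrow> transpose 1 4 j \<le> i"
  "cross_adj S_le_r (transpose 1 4) i j \<longleftrightarrow> j \<le> transpose 1 4 i"
  "cross_adj S_ge_r (transpose 1 4) i j \<longleftrightarrow> transpose 1 4 i \<le> j"
  by (simp_all add: swap_ends_values(5))

text \<open>In an embedding of the test graph the border between the two sides must fall between the vertices 3 and
  6, since otherwise column 2 or row 3 of its matrix would be constant. Then \<open>lam\<close> and \<open>rho\<close> can be read off, and
  rows 1 to 3 and columns 2 to 4 determine the symbol.\<close>
lemma M_class_subset_M_class:
  assumes "M_class s lam rho \<subseteq> M_class s' lam' rho'"
  shows "s = s' \<and> lam = lam' \<and> rho = rho'"
proof -
  define G where "G = test_graph s lam rho"
  let ?c = "cross_adj s (transpose 1 4)"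
  have "G \<in> M_class s' lam' rho'" using assms M_graph_in_M_class[OF swap_ends_permutes] unfolding G_def by blast
  moreover have "ord G = nat_ord (verts G)" by (simp add: G_def M_graph_simps)
  ultimately obtain n \<sigma> f where \<sigma>: "\<sigma> permutes {1..n}"
    and f: "\<And>u. u \<in> verts G \<Longrightarrow> f u \<in> {1..2 * n}"
    "\<And>u v. u \<in> verts G \<Longrightarrow> v \<in> verts G \<Longrightarrow> u < v \<Longrightarrow> f u < f v"
    "\<And>u v. u \<in> verts G \<Longrightarrow> v \<in> verts G \<Longrightarrow> u < v \<Longrightarrow> f v \<le> n \<Longrightarrow> (u, v) \<in> edges G \<longleftrightarrow> lam'"
    "\<And>u v. u \<in> verts G \<Longrightarrow> v \<in> verts G \<Longrightarrow> u < v \<Longrightarrow> n < f u \<Longrightarrow> (u, v) \<in> edges G \<longleftrightarrow> rho'"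
    "\<And>u v. u \<in> verts G \<Longrightarrow> v \<in> verts G \<Longrightarrow> f u \<le> n \<Longrightarrow> n < f v \<Longrightarrow>
      (u, v) \<in> edges G \<longleftrightarrow> cross_adj s' \<sigma> (f u) (f v - n)"
    by (rule embedding_into_M_class) blast
  have V: "u \<in> verts G \<longleftrightarrow> 1 \<le> u \<and> u \<le> 8" for u by (simp add: G_def M_graph_simps)
  note e = test_graph_edges[where s = s and lam = lam and rho = rho, folded G_def]
  have f6: "n < f 6"
  proof (rule ccontr)
    assume "\<not> n < f 6"
    then have "?c i 2 \<longleftrightarrow> lam'" if "i \<in> {1,2,3,4}" for i
      using f(3)[of i 6] e(1)[of i 2] that by (auto simp: V)
    then have "?c 1 2 = ?c 2 2" "?c 2 2 = ?c 3 2" "?c 3 2 = ?c 4 2" by simp_all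
    then show False by (cases s) (simp_all only: test_cross_adj swap_ends_values, simp_all)
  qed
  have f3: "f 3 \<le> n"
  proof (rule ccontr)
    assume "\<not> f 3 \<le> n"
    then have "?c 3 j \<longleftrightarrow> rho'" if "j \<in> {1,2,3,4}" for j
      using f(4)[of 3 "4 + j"] e(1)[of 3 j] that by (auto simp: V)
    then have "?c 3 1 = ?c 3 2" "?c 3 2 = ?c 3 3" "?c 3 3 = ?c 3 4" by simp_all
    then show False by (cases s) (simp_all only: test_cross_adj swap_ends_values, simp_all)
  qed
  have inc: "f 1 < f 2" "f 2 < f 3" "f 6 < f 7" "f 7 < f 8" using f(2) by (simp_all add: V)
  have lam: "lam = lam'" using f(3)[of 1 2] e(2) inc f3 by (simp add: V)
  have rho: "rho = rho'" using f(4)[of 7 8] e(7) inc f6 by (simp add: V)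
  define x where "x i = f i" for i
  define y where "y j = f (4 + j) - n" for j
  have x: "x 1 < x 2" "x 2 < x 3" unfolding x_def using inc by simp_all
  have y: "y 2 < y 3" "y 3 < y 4" unfolding y_def using inc f6 by simp_all
  have c: "?c i j \<longleftrightarrow> cross_adj s' \<sigma> (x i) (y j)" if "i \<in> {1,2,3}" "j \<in> {2,3,4}" for i j
  proof -
    have "f i \<le> n" "n < f (4 + j)" using that inc f3 f6 by auto
    then show ?thesis unfolding x_def y_def using f(5)[of i "4 + j"] e(1)[of i j] that by (auto simp: V)
  qed
  have cs: "?c 1 2 \<longleftrightarrow> cross_adj s' \<sigma> (x 1) (y 2)" "?c 1 3 \<longleftrightarrow> cross_adj s' \<sigma> (x 1) (y 3)"
    "?c 1 4 \<longleftrightarrow> cross_adj s' \<sigma> (x 1) (y 4)" "?c 2 2 \<longleftrightarrow> cross_adj s' \<sigma> (x 2) (y 2)"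
    "?c 2 3 \<longleftrightarrow> cross_adj s' \<sigma> (x 2) (y 3)" "?c 2 4 \<longleftrightarrow> cross_adj s' \<sigma> (x 2) (y 4)"
    "?c 3 2 \<longleftrightarrow> cross_adj s' \<sigma> (x 3) (y 2)" "?c 3 3 \<longleftrightarrow> cross_adj s' \<sigma> (x 3) (y 3)"
    "?c 3 4 \<longleftrightarrow> cross_adj s' \<sigma> (x 3) (y 4)"
    by (rule c; simp)+
  have "s = s'"
  proof (rule ccontr)
    assume ne: "s \<noteq> s'"
    then show False using cs x y
      by (cases s'; cases s) (simp_all only: test_cross_adj swap_ends_values cross_adj.simps, simp_all)
  qed
  then show ?thesis using lam rho by blast
qed

text \<open>A member of \<open>M_class s lam rho\<close> has a border such that the vertices before it, and those after it, form a
  clique or an independent set. The permutation graph with the edges 23 and 56 on six vertices has no such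
  border, since neither 1, 2, 3 nor 4, 5, 6 are a clique or independent.\<close>
lemma not_P_class_subset_M_class: "\<not> P_class \<subseteq> M_class s lam rho"
proof
  assume sub: "P_class \<subseteq> M_class s lam rho"
  define \<pi> where "\<pi> = transpose 2 (3::nat) \<circ> transpose 5 6"
  have \<pi>: "\<pi> permutes {1..6}"
    unfolding \<pi>_def by (intro permutes_compose permutes_swap_id) auto
  let ?G = "permutation_ograph 6 \<pi>"
  have "?G \<in> M_class s lam rho" using sub permutation_ograph_in_P_class[OF \<pi>] by blast
  moreover have "ord ?G = nat_ord (verts ?G)" by (simp add: permutation_ograph_simps)
  ultimately obtain n :: nat and f :: "nat \<Rightarrow> nat" where
    f: "\<And>u v. u \<in> verts ?G \<Longrightarrow> v \<in> verts ?G \<Longrightarrow> u < v \<Longrightarrow> f u < f v"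
    "\<And>u v. u \<in> verts ?G \<Longrightarrow> v \<in> verts ?G \<Longrightarrow> u < v \<Longrightarrow> f v \<le> n \<Longrightarrow> (u, v) \<in> edges ?G \<longleftrightarrow> lam"
    "\<And>u v. u \<in> verts ?G \<Longrightarrow> v \<in> verts ?G \<Longrightarrow> u < v \<Longrightarrow> n < f u \<Longrightarrow> (u, v) \<in> edges ?G \<longleftrightarrow> rho"
    by (rule embedding_into_M_class) blast
  have V: "u \<in> verts ?G \<longleftrightarrow> 1 \<le> u \<and> u \<le> 6" for u by (simp add: permutation_ograph_simps)
  have E: "(i, j) \<in> edges ?G \<longleftrightarrow> \<pi> j < \<pi> i" if "1 \<le> i" "i < j" "j \<le> 6" for i j
    using that by (intro permutation_ograph_edge_iff) auto
  have e: "(1, 2) \<notin> edges ?G" "(2, 3) \<in> edges ?G" "(4, 5) \<notin> edges ?G" "(5, 6) \<in> edges ?G"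
  proof -
    have "\<pi> 1 = 1" "\<pi> 2 = 3" "\<pi> 3 = 2" "\<pi> 4 = 4" "\<pi> 5 = 6" "\<pi> 6 = 5"
      by (simp_all add: \<pi>_def transpose_def)
    then show "(1, 2) \<notin> edges ?G" "(2, 3) \<in> edges ?G" "(4, 5) \<notin> edges ?G" "(5, 6) \<in> edges ?G"
      using E[of 1 2] E[of 2 3] E[of 4 5] E[of 5 6] by simp_all
  qed
  show False
  proof (cases "f 3 \<le> n")
    case True
    moreover have "f 2 < f 3" using f(1) by (simp add: V)
    ultimately show False using f(2)[of 1 2] f(2)[of 2 3] e by (simp add: V)
  next
    case False
    moreover have "f 3 < f 4" "f 4 < f 5" using f(1) by (simp_all add: V)
    ultimately show False using f(3)[of 4 5] f(3)[of 5 6] e by (simp add: V)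
  qed
qed

text \<open>Adjacency and nonadjacency in an ordered permutation graph are both transitive along the order. The
  test graph violates one of the two on two vertices of one side and one of the other.\<close>
lemma not_M_class_subset_P_class: "\<not> M_class s lam rho \<subseteq> P_class"
proof
  define G where "G = test_graph s lam rho"
  let ?c = "cross_adj s (transpose 1 4)"
  assume "M_class s lam rho \<subseteq> P_class"
  then have "G \<in> P_class" using M_graph_in_M_class[OF swap_ends_permutes] unfolding G_def by blast
  then obtain n \<pi> where n: "\<pi> permutes {1..n}" "G \<cong>\<^sub>o permutation_ograph n \<pi>"
    unfolding P_class_def by blast
  let ?K = "permutation_ograph n \<pi>"
  have "induced ?K (verts ?K) = ?K"
    by (auto simp: induced_def permutation_ograph_def Let_def nat_ord_def)
  then have iso: "G \<cong>\<^sub>o induced ?K (verts ?K)" using n(2) by simp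
  have oG: "ord G = nat_ord (verts G)" and oK: "ord ?K = nat_ord (verts ?K)"
    by (simp_all add: G_def M_graph_simps permutation_ograph_simps)
  obtain f where f: "\<And>u. u \<in> verts G \<Longrightarrow> f u \<in> verts ?K"
    "\<And>u v. u \<in> verts G \<Longrightarrow> v \<in> verts G \<Longrightarrow> u < v \<Longrightarrow> f u < f v"
    "\<And>u v. u \<in> verts G \<Longrightarrow> v \<in> verts G \<Longrightarrow> (u, v) \<in> edges G \<longleftrightarrow> (f u, f v) \<in> edges ?K"
    using iso_induced_embedding[OF oG oK subset_refl iso] by metis
  define p where "p u = \<pi> (f u)" for u
  have V: "u \<in> verts G \<longleftrightarrow> 1 \<le> u \<and> u \<le> 8" for u by (simp add: G_def M_graph_simps)
  have E: "(u, v) \<in> edges G \<longleftrightarrow> p v < p u" if "1 \<le> u" "u < v" "v \<le> 8" for u v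
  proof -
    have uv: "u \<in> verts G" "v \<in> verts G" using that by (simp_all add: V)
    then have "f u \<in> {1..n}" "f v \<in> {1..n}" "f u < f v"
      using f(1)[OF uv(1)] f(1)[OF uv(2)] f(2)[OF uv] that(2) by (simp_all add: permutation_ograph_simps)
    then show ?thesis unfolding f(3)[OF uv] p_def by (rule permutation_ograph_edge_iff)
  qed
  note e = test_graph_edges[where s = s and lam = lam and rho = rho, folded G_def]
  have c: "?c i j \<longleftrightarrow> p (4 + j) < p i" if "i \<in> {1,2,3}" "j \<in> {2,3,4}" for i j
    using e(1)[of i j] E[of i "4 + j"] that by auto
  have cs: "?c 1 2 \<longleftrightarrow> p (4 + 2) < p 1" "?c 1 3 \<longleftrightarrow> p (4 + 3) < p 1"
    "?c 1 4 \<longleftrightarrow> p (4 + 4) < p 1" "?c 2 2 \<longleftrightarrow> p (4 + 2) < p 2"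
    "?c 2 3 \<longleftrightarrow> p (4 + 3) < p 2" "?c 2 4 \<longleftrightarrow> p (4 + 4) < p 2"
    "?c 3 2 \<longleftrightarrow> p (4 + 2) < p 3" "?c 3 3 \<longleftrightarrow> p (4 + 3) < p 3"
    "?c 3 4 \<longleftrightarrow> p (4 + 4) < p 3"
    by (rule c; simp)+
  have l: "lam \<longleftrightarrow> p 2 < p 1" "lam \<longleftrightarrow> p 3 < p 1" "lam \<longleftrightarrow> p 3 < p 2"
    using E[of 1 2] E[of 1 3] E[of 2 3] e(2-4) by simp_all
  have r: "rho \<longleftrightarrow> p 7 < p 6" "rho \<longleftrightarrow> p 8 < p 6" "rho \<longleftrightarrow> p 8 < p 7"
    using E[of 6 7] E[of 6 8] E[of 7 8] e(5-7) by simp_all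
  show False
    using cs l r
    by (cases s; cases lam; cases rho) (simp_all only: test_cross_adj swap_ends_values, simp_all)
qed

lemma card_listed_classes: "card listed_classes = 25"
proof -
  let ?M = "\<lambda>(s, lam, rho). M_class s lam rho"
  have U: "(UNIV :: rel_symbol set) = {S_eq, S_neq, S_le_l, S_ge_l, S_le_r, S_ge_r}"
    by (auto intro: rel_symbol.exhaust)
  have range: "{M_class s lam rho | s lam rho. True} = range ?M"
    by (intro set_eqI) (simp add: image_iff)
  have "inj ?M"
  proof (rule injI)
    fix p p' assume eq: "?M p = ?M p'"
    obtain s lam rho s' lam' rho' where p: "p = (s, lam, rho)" "p' = (s', lam', rho')"
      by (cases p, cases p')
    have "M_class s lam rho \<subseteq> M_class s' lam' rho'" using eq unfolding p by simp
    then show "p = p'" unfolding p using M_class_subset_M_class by blast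
  qed
  then have "card (range ?M) = card (UNIV :: (rel_symbol \<times> bool \<times> bool) set)" by (rule card_image)
  also have "\<dots> = card (UNIV :: rel_symbol set) * (card (UNIV :: bool set) * card (UNIV :: bool set))"
    by (simp only: UNIV_Times_UNIV[symmetric] card_cartesian_product)
  also have "\<dots> = 24" unfolding U by simp
  finally have c: "card (range ?M) = 24" .
  then have "finite (range ?M)" by (intro card_ge_0_finite) simp
  moreover have "P_class \<notin> range ?M" using not_P_class_subset_M_class by auto
  ultimately show ?thesis unfolding listed_classes_def range using c by simp
qed

section \<open>The minimal classes of superexponential growth\<close>

lemma listed_classes_antichain:
  assumes "A \<in> listed_classes" "B \<in> listed_classes" "A \<subseteq> B"
  shows "A = B"
  using assms not_P_class_subset_M_class not_M_class_subset_P_class M_class_subset_M_class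
  unfolding listed_classes_def by blast

lemma listed_class_properties:
  assumes "L \<in> listed_classes"
  shows "hereditary L" "growth_two_pow_omega L"
proof -
  consider "L = P_class" | s lam rho where "L = M_class s lam rho"
    using assms unfolding listed_classes_def by blast
  then show "hereditary L" "growth_two_pow_omega L"
    by (cases; simp add: hereditary_P_class hereditary_M_class growth_two_pow_omega_of_fact
      growth_eq_card_slice fact_le_card_slice_P_class fact_le_card_slice_M_class)+
qed

lemma contains_mono:
  "contains_P C h \<Longrightarrow> h' \<le> h \<Longrightarrow> contains_P C h'"
  "contains_M C s lam rho h \<Longrightarrow> h' \<le> h \<Longrightarrow> contains_M C s lam rho h'"
  unfolding contains_P_def contains_M_def by (meson le_trans)+

text \<open>If every listed class failed at some size, then all would fail at the maximum of these 25 sizes.\<close>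
lemma listed_class_subset:
  assumes C: "hereditary C" and all: "\<And>h. contains_listed C h"
  shows "\<exists>L\<in>listed_classes. L \<subseteq> C"
proof -
  have "(\<forall>h. contains_P C h) \<or> (\<exists>s lam rho. \<forall>h. contains_M C s lam rho h)"
  proof (rule ccontr)
    assume "\<not> ?thesis"
    then obtain hP hM where hP: "\<not> contains_P C hP" and hM: "\<And>s lam rho. \<not> contains_M C s lam rho (hM s lam rho)"
      by metis
    have "finite (UNIV :: rel_symbol set)"
      by (rule finite_subset[of _ "{S_eq, S_neq, S_le_l, S_ge_l, S_le_r, S_ge_r}"])
        (auto intro: rel_symbol.exhaust)
    then have "finite (range (\<lambda>(s, lam, rho). hM s lam rho))"
      by (intro finite_imageI) (simp add: finite_prod)
    then obtain b where b: "\<And>s lam rho. hM s lam rho \<le> b"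
      unfolding finite_nat_set_iff_bounded_le by auto
    have "\<not> contains_P C (max hP b)" using hP contains_mono(1) by (meson max.cobounded1)
    moreover have "\<not> contains_M C s lam rho (max hP b)" for s lam rho
      using hM[of s lam rho] contains_mono(2) b[of s lam rho] by (meson le_trans max.cobounded2)
    ultimately show False using all[of "max hP b"] unfolding contains_listed_def by blast
  qed
  then show ?thesis
  proof (elim disjE exE)
    assume P: "\<forall>h. contains_P C h"
    have "P_class \<subseteq> C"
    proof
      fix G assume "G \<in> P_class"
      then obtain n \<pi> where "\<pi> permutes {1..n}" "G \<cong>\<^sub>o permutation_ograph n \<pi>" "ordered_graph G"
        unfolding P_class_def by blast
      moreover have "permutation_ograph n \<pi> \<in> C"
        using P calculation(1) unfolding contains_P_def by blast
      ultimately show "G \<in> C" using C unfolding hereditary_def by blast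
    qed
    then show ?thesis unfolding listed_classes_def by blast
  next
    fix s lam rho assume M: "\<forall>h. contains_M C s lam rho h"
    have "M_class s lam rho \<subseteq> C"
    proof
      fix G assume "G \<in> M_class s lam rho"
      then obtain n \<sigma> W where G: "\<sigma> permutes {1..n}" "W \<subseteq> verts (M_graph s lam rho n \<sigma>)"
        "G \<cong>\<^sub>o induced (M_graph s lam rho n \<sigma>) W" "ordered_graph G"
        unfolding M_class_def hereditary_closure_def by blast
      have "M_graph s lam rho n \<sigma> \<in> C" using M G(1) unfolding contains_M_def by blast
      then have "induced (M_graph s lam rho n \<sigma>) W \<in> C" using C G(2) unfolding hereditary_def by blast
      then show "G \<in> C" using C G(3,4) unfolding hereditary_def by blast
    qed
    then show ?thesis unfolding listed_classes_def by blast
  qed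
qed

text \<open>The dichotomy: a hereditary class without any listed subclass has exponential growth.\<close>
lemma listed_class_subset_or_growth_O:
  assumes "hereditary C"
  shows "growth_two_pow_O C \<or> (\<exists>L\<in>listed_classes. L \<subseteq> C)"
proof (cases "\<forall>h. contains_listed C h")
  case True
  then show ?thesis using listed_class_subset[OF assms] by blast
next
  case False
  then obtain h where "\<not> contains_listed C h" by blast
  then obtain M where "M \<ge> 1" "\<And>n. card (slice C n) \<le> M ^ n"
    using slice_bounded_if_not_contains_listed[OF assms] by blast
  then have "growth_two_pow_O C" using growth_two_pow_O_of_power growth_eq_card_slice[OF assms] by simp
  then show ?thesis by blast
qed

theorem corollary48:
  shows "card listed_classes = 25 \<and>
         listed_classes =
           {C. hereditary C \<and> growth_two_pow_omega C \<and>
               (\<forall>D. hereditary D \<and> D \<subset> C \<longrightarrow> growth_two_pow_O D)}"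
proof (intro conjI card_listed_classes equalityI subsetI)
  fix C assume C: "C \<in> listed_classes"
  have "growth_two_pow_O D" if D: "hereditary D" "D \<subset> C" for D
  proof (rule ccontr)
    assume "\<not> growth_two_pow_O D"
    then obtain L where L: "L \<in> listed_classes" "L \<subseteq> D"
      using listed_class_subset_or_growth_O[OF D(1)] by blast
    then have "L = C" using listed_classes_antichain[OF L(1) C] D(2) by blast
    then show False using L(2) D(2) by blast
  qed
  then show "C \<in> {C. hereditary C \<and> growth_two_pow_omega C \<and>
               (\<forall>D. hereditary D \<and> D \<subset> C \<longrightarrow> growth_two_pow_O D)}"
    using listed_class_properties[OF C] by blast
next
  fix C assume "C \<in> {C. hereditary C \<and> growth_two_pow_omega C \<and>
               (\<forall>D. hereditary D \<and> D \<subset> C \<longrightarrow> growth_two_pow_O D)}"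
  then have C: "hereditary C" "growth_two_pow_omega C"
    and min: "\<And>D. hereditary D \<Longrightarrow> D \<subset> C \<Longrightarrow> growth_two_pow_O D" by blast+
  obtain L where L: "L \<in> listed_classes" "L \<subseteq> C"
    using listed_class_subset_or_growth_O[OF C(1)] not_growth_two_pow_O_if_omega[OF C(2)] by blast
  have "\<not> growth_two_pow_O L"
    using listed_class_properties(2)[OF L(1)] by (rule not_growth_two_pow_O_if_omega)
  then have "L = C" using min[OF listed_class_properties(1)[OF L(1)]] L(2) by blast
  then show "C \<in> listed_classes" using L(1) by simp
qed

end
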